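(* Assume (A1) $n_i/n\to\kappa_i>0$ as $n\to\infty$ for every $i\in\{1,\dots,k\}$, and (A2) for every $i\in\{1,\dots,k\}$ and $\ell\in\{1,\dots,d\}$ the marginal distribution function $F_{i\ell}$ is continuously differentiable at $q_{i\ell}$ with positive derivative $f_{i\ell}(q_{i\ell})>0$. Let $\hat{\mathbf\Sigma}$ be a consistent estimator of the matrix $\mathbf\Sigma$, i.e. $\hat{\mathbf\Sigma}\to\mathbf\Sigma$ in probability as $n\to\infty$. Let $S_n(\mathbf T)=n(\mathbf T\hat{\mathbf q})'E(\mathbf T,\hat{\mathbf\Sigma})\mathbf T\hat{\mathbf q}$, where $E$ is either the ATS choice or the MATS choice (see context). Then, as $n\to\infty$: (i) If $\mathbf T\mathbf q=\mathbf 0_{dk}$, then $S_n(\mathbf T)\stackrel{d}{\longrightarrow}B=\sum_{i=1}^{dk}\lambda_iB_i$, where $B_1,\dots,B_{dk}$ are i.i.d. $\chi^2_1$-distributed and $\lambda_1,\dots,\lambda_{dk}\ge 0$ are the eigenvalues of $E(\mathbf T,\mathbf\Sigma)\mathbf T\mathbf\Sigma\mathbf T$. (ii) If $\mathbf T\mathbf q\neq\mathbf 0_{dk}$, then $S_n(\mathbf T)$ converges in probability to $\infty$.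
   Context: Setting. Fix integers $k,d\ge1$ and $p\in(0,1)$. For each group $i\in\{1,\dots,k\}$ let $\mathbf X_{ij}=(X_{ij1},\dots,X_{ijd})'$, $j=1,\dots,n_i$, be $\mathbb R^d$-valued with joint distribution $\mathbb P_i$; all observation vectors are mutually independent. Put $n=\sum_{i=1}^kn_i$; all limits are as $n\to\infty$. $F_{i\ell}$ denotes the distribution function of $X_{i1\ell}$ (with density $f_{i\ell}$) and $F_{i\ell m}$ the joint distribution function of $(X_{i1\ell},X_{i1m})$. Quantiles. $q_{i\ell}=F_{i\ell}^{-1}(p)=\inf\{t\in\mathbb R: F_{i\ell}(t)\ge p\}$, $\mathbf q_i=(q_{i1},\dots,q_{id})'$, $\mathbf q=(\mathbf q_1',\dots,\mathbf q_k')'\in\mathbb R^{dk}$. Empirical versions: $\hat F_{i\ell}(t)=n_i^{-1}\sum_{j=1}^{n_i}\mathbf 1\{X_{ij\ell}\le t\}$, $\hat q_{i\ell}=\inf\{t:\hat F_{i\ell}(t)\ge p\}$, and $\hat{\mathbf q}$ is the vector of all $\hat q_{i\ell}$ stacked like $\mathbf q$. Matrix $\mathbf T$. Let $\mathbf H\in\mathbb R^{r\times dk}$ be a contrast matrix ($\mathbf H\mathbf 1_{dk}=\mathbf 0_r$) and $\mathbf T=\mathbf H'(\mathbf H\mathbf H')^+\mathbf H\in\mathbb R^{dk\times dk}$, where $^+$ denotes the Moore–Penrose inverse; $\mathbf T$ is a symmetric idempotent matrix. Covariance matrix. $\mathbf\Sigma=\bigoplus_{i=1}^k\mathbf\Sigma^{(i)}$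 (block diagonal) with $\mathbf\Sigma^{(i)}_{\ell\ell}=\kappa_i^{-1}f_{i\ell}(q_{i\ell})^{-2}(p-p^2)$ and $\mathbf\Sigma^{(i)}_{\ell m}=\kappa_i^{-1}\{f_{i\ell}(q_{i\ell})f_{im}(q_{im})\}^{-1}\left[F_{i\ell m}(q_{i\ell},q_{im})-p^2\right]$ for $\ell\ne m$. The index 0 ($\mathbf\Sigma_0,\hat{\mathbf\Sigma}_0$) denotes the diagonal matrix keeping only the diagonal elements. Choices of $E$. For a symmetric $dk\times dk$ matrix $\mathbf A$: ATS: $E(\mathbf T,\mathbf A)=\mathrm{tr}(\mathbf T\mathbf A\mathbf T)^{-1}\mathbf I_{dk}$; MATS: $E(\mathbf T,\mathbf A)=(\mathbf T\mathbf A_0\mathbf T)^+$, $\mathbf A_0$ being the diagonal part of $\mathbf A$. In the ATS case it is understood that $\mathrm{tr}(\mathbf T\mathbf\Sigma\mathbf T)\neq0$, so that $E(\mathbf T,\mathbf\Sigma)$ is defined. *)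

theory Defs
  imports "HOL-Probability.Probability" "HOL-Computational_Algebra.Polynomial"
begin

(* The index types 'k and 'd stand for the k groups and the d coordinates.  Stacked vectors in
   R^(dk) are indexed by pairs (i, l) :: 'k * 'd; the order of stacking is immaterial. *)

definition is_moore_penrose :: "real ^ 'n ^ 'm \<Rightarrow> real ^ 'm ^ 'n \<Rightarrow> bool" where
  "is_moore_penrose A B \<longleftrightarrow>
     A ** B ** A = A \<and> B ** A ** B = B \<and>
     transpose (A ** B) = A ** B \<and> transpose (B ** A) = B ** A"

definition moore_penrose :: "real ^ 'n ^ 'm \<Rightarrow> real ^ 'm ^ 'n" where
  "moore_penrose A = (THE B. is_moore_penrose A B)"

definition contrast_matrix :: "real ^ 'n ^ 'r \<Rightarrow> bool" where
  "contrast_matrix H \<longleftrightarrow> H *v 1 = 0"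

definition projection_matrix :: "real ^ 'n ^ 'r \<Rightarrow> real ^ 'n ^ 'n" where
  "projection_matrix H = transpose H ** moore_penrose (H ** transpose H) ** H"

definition diag_part :: "real ^ 'n ^ 'n \<Rightarrow> real ^ 'n ^ 'n" where
  "diag_part A = (\<chi> a b. if a = b then A $ a $ a else 0)"

definition charpoly :: "real ^ 'n ^ 'n \<Rightarrow> real poly" where
  "charpoly A = det (\<chi> a b. (if a = b then [:0, 1:] else 0) - [:A $ a $ b:])"

(* lam lists all eigenvalues of A with their algebraic multiplicities; in particular the
   characteristic polynomial splits over the reals. *)
definition eigenvalues_of :: "real ^ 'n ^ 'n \<Rightarrow> ('n \<Rightarrow> real) \<Rightarrow> bool" where
  "eigenvalues_of A lam \<longleftrightarrow> charpoly A = (\<Prod>a\<in>UNIV. [:- lam a, 1:])"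

datatype scaling = ATS | MATS

(* For ATS with vanishing trace the value is the zero matrix, as 1 / 0 = 0. *)
fun scaling_matrix :: "scaling \<Rightarrow> real ^ 'n ^ 'n \<Rightarrow> real ^ 'n ^ 'n \<Rightarrow> real ^ 'n ^ 'n" where
  "scaling_matrix ATS T A = (1 / trace (T ** A ** T)) *\<^sub>R mat 1"
| "scaling_matrix MATS T A = moore_penrose (T ** diag_part A ** T)"

definition quantile :: "(real \<Rightarrow> real) \<Rightarrow> real \<Rightarrow> real" where
  "quantile F p = Inf {t. p \<le> F t}"

definition marginal_cdf :: "(real ^ 'd) measure \<Rightarrow> 'd \<Rightarrow> real \<Rightarrow> real" where
  "marginal_cdf P l = cdf (distr P borel (\<lambda>x. x $ l))"

definition joint_cdf :: "(real ^ 'd) measure \<Rightarrow> 'd \<Rightarrow> 'd \<Rightarrow> real \<Rightarrow> real \<Rightarrow> real" where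
  "joint_cdf P l m s t = measure P {x \<in> space P. x $ l \<le> s \<and> x $ m \<le> t}"

definition empirical_cdf :: "nat \<Rightarrow> (nat \<Rightarrow> real) \<Rightarrow> real \<Rightarrow> real" where
  "empirical_cdf n x t = (\<Sum>j<n. indicator {..t} (x j)) / real n"

definition quantile_vector :: "('k::finite \<Rightarrow> (real ^ 'd) measure) \<Rightarrow> real \<Rightarrow> real ^ ('k \<times> 'd)" where
  "quantile_vector P p = (\<chi> a. quantile (marginal_cdf (P (fst a)) (snd a)) p)"

(* Group i contributes the observations x i 0, ..., x i (n i - 1). *)
definition empirical_quantile_vector ::
    "('k::finite \<Rightarrow> nat) \<Rightarrow> ('k \<Rightarrow> nat \<Rightarrow> real ^ 'd) \<Rightarrow> real \<Rightarrow> real ^ ('k \<times> 'd)" where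
  "empirical_quantile_vector n x p =
     (\<chi> a. quantile (empirical_cdf (n (fst a)) (\<lambda>j. x (fst a) j $ snd a)) p)"

definition continuously_differentiable_at :: "(real \<Rightarrow> real) \<Rightarrow> real \<Rightarrow> bool" where
  "continuously_differentiable_at F x \<longleftrightarrow>
     (\<forall>\<^sub>F y in nhds x. F field_differentiable (at y)) \<and> isCont (deriv F) x"

definition density_at_quantile :: "(real ^ 'd) measure \<Rightarrow> real \<Rightarrow> 'd \<Rightarrow> real" where
  "density_at_quantile P p l = deriv (marginal_cdf P l) (quantile (marginal_cdf P l) p)"

definition group_covariance ::
    "(real ^ 'd) measure \<Rightarrow> real \<Rightarrow> real \<Rightarrow> real ^ 'd ^ 'd" where
  "group_covariance P \<kappa> p =
     (\<chi> l m. if l = m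
        then inverse \<kappa> * inverse ((density_at_quantile P p l)\<^sup>2) * (p - p\<^sup>2)
        else inverse \<kappa> * inverse (density_at_quantile P p l * density_at_quantile P p m) *
             (joint_cdf P l m (quantile (marginal_cdf P l) p) (quantile (marginal_cdf P m) p) - p\<^sup>2))"

definition quantile_covariance ::
    "('k::finite \<Rightarrow> (real ^ 'd) measure) \<Rightarrow> ('k \<Rightarrow> real) \<Rightarrow> real \<Rightarrow> real ^ ('k \<times> 'd) ^ ('k \<times> 'd)" where
  "quantile_covariance P \<kappa> p =
     (\<chi> a b. if fst a = fst b
        then group_covariance (P (fst a)) (\<kappa> (fst a)) p $ snd a $ snd b else 0)"

definition quantile_statistic ::
    "scaling \<Rightarrow> real ^ 'n ^ 'n \<Rightarrow> nat \<Rightarrow> real ^ 'n \<Rightarrow> real ^ 'n ^ 'n \<Rightarrow> real" where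
  "quantile_statistic E T N v A = real N * ((T *v v) \<bullet> (scaling_matrix E T A *v (T *v v)))"

definition chi_square_1 :: "real measure" where
  "chi_square_1 = distr std_normal_distribution borel (\<lambda>z. z\<^sup>2)"

(* Law of the sum of c a * B a, where the B a are i.i.d. with distribution chi_square_1
   (realised as the coordinates of the product space). *)
definition weighted_chi_square :: "('n::finite \<Rightarrow> real) \<Rightarrow> real measure" where
  "weighted_chi_square c =
     distr (\<Pi>\<^sub>M a\<in>UNIV. chi_square_1) borel (\<lambda>b. \<Sum>a\<in>UNIV. c a * b a)"

definition tendsto_in_probability ::
    "'w measure \<Rightarrow> (nat \<Rightarrow> 'w \<Rightarrow> 'b::metric_space) \<Rightarrow> 'b \<Rightarrow> bool" where
  "tendsto_in_probability M Y y \<longleftrightarrow>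
     (\<forall>\<epsilon>>0. (\<lambda>m. measure M {w \<in> space M. dist (Y m w) y > \<epsilon>}) \<longlonglongrightarrow> 0)"

definition tendsto_infinity_in_probability :: "'w measure \<Rightarrow> (nat \<Rightarrow> 'w \<Rightarrow> real) \<Rightarrow> bool" where
  "tendsto_infinity_in_probability M Y \<longleftrightarrow>
     (\<forall>K. (\<lambda>m. measure M {w \<in> space M. Y m w > K}) \<longlonglongrightarrow> 1)"

end

theory Submission
  imports Defs
begin

text \<open>
  The sample quantiles are asymptotically linear. By the Galois connection between quantiles and
  distribution functions, the event that a scaled quantile error is at most \<open>y\<close> is the event that the
  empirical distribution function at a nearby point is at least \<open>p\<close>. The increments of the empirical
  process near the quantile are negligible and the distribution function is differentiable there, so this
  event differs from the one for a normalized sum of bounded independent variables only by a vanishing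
  shift of the level. Hence the error and the sum have a difference that tends to zero in probability
  (\<open>bahadur_linearization\<close>), and the characteristic functions of the vector of errors tend to the Gaussian
  one with covariance \<open>\<Sigma>\<close> (\<open>scaled_error_characteristic_function\<close>).

  The passage to quadratic forms avoids weak convergence of random vectors. The Laplace transform of
  \<open>(norm (L *v V))\<^sup>2\<close> is the average of the characteristic function of \<open>V\<close> at a Gaussian random argument,
  so dominated convergence gives convergence of Laplace transforms, and these determine weak limits of
  nonnegative variables (\<open>laplace_transform_weak_conv\<close>, \<open>quadratic_form_weak_conv\<close>). The limit is a weighted
  sum of squares as soon as the factor \<open>L\<close> of the limiting form is chosen such that \<open>L ** \<Sigma> ** transpose L\<close>
  is diagonal; its diagonal then lists the eigenvalues of the nonsymmetric matrix in the statement
  (\<open>quadratic_form_normal_form\<close>).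

  The estimated scaling matrix is replaced by its limit through continuity. For MATS this concerns a
  pseudoinverse, which is discontinuous in general. But \<open>T ** D ** T\<close> has the same rank for all positive
  diagonal \<open>D\<close>, which makes its pseudoinverse continuous in \<open>D\<close> (\<open>moore_penrose_compressed_diag\<close>). The same
  formula shows that the limiting form is definite on the range of \<open>T\<close>. If \<open>T *v q\<close> does not vanish, the
  statistic therefore grows like the total sample size.
\<close>

section \<open>Diagonalization of symmetric matrices\<close>

lemma inner_symmetric_matrix:
  fixes A :: "real ^ 'n ^ 'n"
  assumes "transpose A = A"
  shows "x \<bullet> (A *v y) = (A *v x) \<bullet> y"
  by (metis assms dot_lmul_matrix transpose_matrix_vector)

text \<open>Symmetry is part of the notion: without it, a nonnegative quadratic form does not even make the
  eigenvalues real.\<close>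

definition psd :: "real ^ 'n ^ 'n \<Rightarrow> bool" where
  "psd A \<longleftrightarrow> transpose A = A \<and> (\<forall>x. 0 \<le> x \<bullet> (A *v x))"

definition diag_mat :: "('n \<Rightarrow> real) \<Rightarrow> real ^ 'n ^ 'n" where
  "diag_mat d = (\<chi> i j. if i = j then d i else 0)"

text \<open>First-order condition at a maximizer of the Rayleigh quotient. The defect
  \<open>w = A *v v - l *\<^sub>R v\<close> is orthogonal to \<open>v\<close>, so moving from \<open>v\<close> to \<open>v + t *\<^sub>R w\<close> changes the form at
  first order by \<open>2 * t * (w \<bullet> w)\<close> but the squared norm only at second order; maximality forces
  \<open>w = 0\<close>.\<close>

lemma symmetric_matrix_maximizer_is_eigenvector:
  fixes A :: "real ^ 'n ^ 'n"
  assumes sym: "transpose A = A" and S: "subspace S" and inv: "\<And>x. x \<in> S \<Longrightarrow> A *v x \<in> S"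
    and v: "v \<in> S" "norm v = 1"
    and max: "\<And>x. x \<in> S \<Longrightarrow> norm x = 1 \<Longrightarrow> x \<bullet> (A *v x) \<le> v \<bullet> (A *v v)"
  shows "A *v v = (v \<bullet> (A *v v)) *\<^sub>R v"
proof -
  define l where "l = v \<bullet> (A *v v)"
  define w where "w = A *v v - l *\<^sub>R v"
  have vv: "v \<bullet> v = 1" using v(2) by (simp add: norm_eq_1)
  have wS: "w \<in> S" unfolding w_def using v inv S by (simp add: subspace_diff subspace_scale)
  have wv: "v \<bullet> w = 0" "w \<bullet> v = 0" unfolding w_def by (simp_all add: inner_diff_right inner_diff_left vv l_def inner_commute)
  have wAv: "w \<bullet> (A *v v) = w \<bullet> w"
    using wv by (simp add: w_def inner_diff_left inner_diff_right vv)
  have hom: "x \<bullet> (A *v x) \<le> l * (x \<bullet> x)" if "x \<in> S" for x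
  proof (cases "x = 0")
    case False
    define y where "y = (1 / norm x) *\<^sub>R x"
    have "y \<in> S" "norm y = 1" using that False S by (auto simp: y_def subspace_scale)
    then have "y \<bullet> (A *v y) \<le> l" using max l_def by blast
    moreover have "y \<bullet> (A *v y) = (x \<bullet> (A *v x)) / (norm x)^2"
      by (simp add: y_def matrix_vector_mult_scaleR power2_eq_square)
    ultimately show ?thesis using False by (simp add: divide_simps dot_square_norm split: if_splits)
  qed auto
  define c where "c = l * (w \<bullet> w) - w \<bullet> (A *v w)"
  have key: "2 * t * (w \<bullet> w) \<le> t^2 * c" for t
  proof -
    have "(v + t *\<^sub>R w) \<bullet> (A *v (v + t *\<^sub>R w)) \<le> l * ((v + t *\<^sub>R w) \<bullet> (v + t *\<^sub>R w))"
      by (intro hom) (use v wS S in \<open>auto simp: subspace_add subspace_scale\<close>)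
    moreover have "v \<bullet> (A *v w) = w \<bullet> w"
      using inner_symmetric_matrix[OF sym, of v w] wAv by (simp add: inner_commute)
    ultimately show ?thesis
      using wAv wv by (simp add: c_def l_def[symmetric] vv matrix_vector_right_distrib matrix_vector_mult_scaleR inner_add_left inner_add_right power2_eq_square algebra_simps)
  qed
  have "w = 0"
  proof (rule ccontr)
    assume "w \<noteq> 0"
    then have a: "0 < w \<bullet> w" by simp
    define t where "t = (w \<bullet> w) / (\<bar>c\<bar> + 1)"
    have t: "t > 0" "t * (\<bar>c\<bar> + 1) = w \<bullet> w" using a by (simp_all add: t_def)
    have "2 * (w \<bullet> w) \<le> t * c"
      using key[of t] t(1) by (simp add: power2_eq_square)
    also have "\<dots> \<le> t * (\<bar>c\<bar> + 1)" using t by (intro mult_left_mono) auto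
    finally show False using t a by simp
  qed
  then show ?thesis by (simp add: w_def l_def)
qed

text \<open>Splitting off one maximizing eigenvector leaves its orthogonal complement in \<open>S\<close>, which is
  invariant because \<open>A\<close> is symmetric and has smaller dimension.\<close>

lemma orthonormal_eigenbasis_of_invariant_subspace:
  fixes A :: "real ^ 'n ^ 'n"
  assumes sym: "transpose A = A"
  shows "subspace S \<Longrightarrow> (\<And>x. x \<in> S \<Longrightarrow> A *v x \<in> S) \<Longrightarrow>
    \<exists>B\<subseteq>S. pairwise orthogonal B \<and> (\<forall>v\<in>B. norm v = 1 \<and> (\<exists>l. A *v v = l *\<^sub>R v)) \<and> S \<subseteq> span B"
proof (induction "dim S" arbitrary: S rule: less_induct)
  case less
  show ?case
  proof (cases "S \<subseteq> {0}")
    case True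
    then show ?thesis by (intro exI[of _ "{}"]) auto
  next
    case False
    then obtain u where u: "u \<in> S" "u \<noteq> 0" by auto
    have "compact (sphere 0 1 \<inter> S)"
      using closed_subspace[OF less.prems(1)] by (simp add: compact_Int_closed)
    moreover have "(1 / norm u) *\<^sub>R u \<in> sphere 0 1 \<inter> S"
      using u less.prems(1) by (auto simp: subspace_scale)
    moreover have "continuous_on (sphere 0 1 \<inter> S) (\<lambda>x. x \<bullet> (A *v x))"
      by (intro continuous_intros)
    ultimately obtain v where v: "v \<in> sphere 0 1 \<inter> S"
        and max: "\<forall>x\<in>sphere 0 1 \<inter> S. x \<bullet> (A *v x) \<le> v \<bullet> (A *v v)"
      using continuous_attains_sup[of "sphere 0 1 \<inter> S" "\<lambda>x. x \<bullet> (A *v x)"] by blast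
    define l where "l = v \<bullet> (A *v v)"
    have Av: "A *v v = l *\<^sub>R v" unfolding l_def
      by (rule symmetric_matrix_maximizer_is_eigenvector[OF sym less.prems]) (use v max in auto)
    have vv: "v \<bullet> v = 1" using v by (simp add: norm_eq_1)
    define S' where "S' = {x \<in> S. v \<bullet> x = 0}"
    have S': "subspace S'" "S' \<subseteq> S" "v \<notin> S'"
      using less.prems(1) vv by (auto simp: S'_def subspace_def inner_add_right)
    have inv': "A *v x \<in> S'" if "x \<in> S'" for x
      using that less.prems(2) inner_symmetric_matrix[OF sym, of v x] by (auto simp: S'_def Av)
    have "S' \<noteq> S" using v S' by auto
    then have "dim S' < dim S"
      using S' less.prems(1) by (metis dim_psubset psubsetI span_eq_iff)
    then obtain B where B: "B \<subseteq> S'" "pairwise orthogonal B"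
        "\<forall>v\<in>B. norm v = 1 \<and> (\<exists>l. A *v v = l *\<^sub>R v)" "S' \<subseteq> span B"
      using less.hyps[OF _ S'(1) inv'] by blast
    have "x \<in> span (insert v B)" if "x \<in> S" for x
    proof -
      have "x - (v \<bullet> x) *\<^sub>R v \<in> S'"
        using that v less.prems(1) by (auto simp: S'_def inner_diff_right vv subspace_diff subspace_scale)
      then show ?thesis using B(4) span_breakdown_eq by blast
    qed
    moreover have "pairwise orthogonal (insert v B)"
      using B(1,2) by (auto simp: pairwise_insert S'_def orthogonal_def inner_commute)
    ultimately show ?thesis
      using B(1,3) v Av S'(2) by (intro exI[of _ "insert v B"]) auto
  qed
qed

lemma diag_mat_mult_left: "(diag_mat d ** A) $ i $ j = d i * A $ i $ j"
proof -
  have "(diag_mat d ** A) $ i $ j = (\<Sum>k\<in>UNIV. if i = k then d i * A $ k $ j else 0)"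
    unfolding matrix_matrix_mult_def diag_mat_def by (simp add: if_distrib if_distribR cong: if_cong)
  then show ?thesis by simp
qed

lemma diag_mat_mult_right: "(A ** diag_mat d) $ i $ j = A $ i $ j * d j"
proof -
  have "(A ** diag_mat d) $ i $ j = (\<Sum>k\<in>UNIV. if k = j then A $ i $ k * d j else 0)"
    unfolding matrix_matrix_mult_def diag_mat_def by (simp add: if_distrib if_distribR cong: if_cong)
  then show ?thesis by simp
qed

lemma diag_mat_vec: "(diag_mat d *v x) $ i = d i * x $ i"
proof -
  have "(diag_mat d *v x) $ i = (\<Sum>k\<in>UNIV. if i = k then d i * x $ k else 0)"
    unfolding matrix_vector_mult_def diag_mat_def by (simp add: if_distrib if_distribR cong: if_cong)
  then show ?thesis by simp
qed

lemma diag_mat_quadratic_form: "x \<bullet> (diag_mat d *v x) = (\<Sum>i\<in>UNIV. d i * (x $ i)\<^sup>2)"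
  by (simp add: inner_vec_def diag_mat_vec power2_eq_square mult_ac)

lemma diag_mat_mult: "diag_mat c ** diag_mat d = diag_mat (\<lambda>i. c i * d i)"
  by (simp add: vec_eq_iff diag_mat_mult_left) (simp add: diag_mat_def)

lemma transpose_diag_mat [simp]: "transpose (diag_mat d) = diag_mat d"
  by (simp add: vec_eq_iff transpose_def diag_mat_def)

theorem symmetric_matrix_diagonalization:
  fixes A :: "real ^ 'n ^ 'n"
  assumes sym: "transpose A = A"
  obtains W d where "orthogonal_matrix W" "A = W ** diag_mat d ** transpose W"
proof -
  obtain B where B: "pairwise orthogonal B" "\<forall>v\<in>B. norm v = 1 \<and> (\<exists>l. A *v v = l *\<^sub>R v)" "UNIV \<subseteq> span B"
    using orthonormal_eigenbasis_of_invariant_subspace[OF sym subspace_UNIV] by blast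
  have "0 \<notin> B" using B(2) by force
  then have ind: "independent B" using B(1) pairwise_orthogonal_independent by blast
  have "span B = (UNIV :: (real^'n) set)" using B(3) by auto
  then have "card B = CARD('n)"
    using dim_span_eq_card_independent[OF ind] by simp
  moreover have "finite B" using ind independent_imp_finite by blast
  ultimately obtain f where f: "bij_betw f (UNIV :: 'n set) B"
    using finite_same_card_bij[of "UNIV :: 'n set" B] by auto
  then have fB: "f i \<in> B" for i by (auto simp: bij_betw_def)
  have ff: "f i \<bullet> f j = (if i = j then 1 else 0)" for i j
  proof (cases "i = j")
    case True then show ?thesis using B(2) fB[of i] by (simp add: norm_eq_1)
  next
    case False
    then have "f i \<noteq> f j" using f by (auto simp: bij_betw_def inj_def)
    then show ?thesis using B(1) fB False by (auto simp: pairwise_def orthogonal_def)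
  qed
  have "\<forall>i. \<exists>l. A *v f i = l *\<^sub>R f i" using B(2) fB by blast
  then obtain d where d: "\<And>i. A *v f i = d i *\<^sub>R f i" by metis
  define W :: "real^'n^'n" where "W = (\<chi> i j. f j $ i)"
  have W: "orthogonal_matrix W" unfolding orthogonal_matrix
    using ff by (simp add: vec_eq_iff W_def matrix_matrix_mult_def transpose_def mat_def inner_vec_def)
  have "A ** W = W ** diag_mat d"
  proof -
    have "(A ** W) $ i $ j = (A *v f j) $ i" for i j
      by (simp add: W_def matrix_matrix_mult_def matrix_vector_mult_def)
    then show ?thesis by (simp add: vec_eq_iff diag_mat_mult_right d) (simp add: W_def)
  qed
  then have "A ** (W ** transpose W) = W ** diag_mat d ** transpose W"
    by (simp add: matrix_mul_assoc)
  then show ?thesis using W that by (simp add: orthogonal_matrix_def)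
qed

lemma quadratic_form_conjugate:
  fixes W :: "real ^ 'n ^ 'm" and A :: "real ^ 'n ^ 'n"
  shows "x \<bullet> ((W ** A ** transpose W) *v x) = (transpose W *v x) \<bullet> (A *v (transpose W *v x))"
  by (simp add: matrix_vector_mul_assoc[symmetric] dot_lmul_matrix[symmetric] flip: transpose_matrix_vector)

lemma psd_conjugate:
  fixes B :: "real ^ 'n ^ 'm" and A :: "real ^ 'n ^ 'n"
  assumes "psd A" shows "psd (B ** A ** transpose B)"
  using assms by (auto simp: psd_def quadratic_form_conjugate matrix_transpose_mul matrix_mul_assoc)

lemma psd_diagonalization:
  fixes A :: "real ^ 'n ^ 'n"
  assumes "psd A"
  obtains W d where "orthogonal_matrix W" "A = W ** diag_mat d ** transpose W" "\<And>i. 0 \<le> d i"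
proof -
  obtain W d where W: "orthogonal_matrix W" "A = W ** diag_mat d ** transpose W"
    using symmetric_matrix_diagonalization assms unfolding psd_def by blast
  have "0 \<le> d i" for i
  proof -
    define x where "x = W *v axis i (1::real)"
    have "transpose W *v x = axis i 1"
      using W(1) by (simp add: x_def matrix_vector_mul_assoc orthogonal_matrix_def)
    then have "x \<bullet> (A *v x) = d i"
      by (simp add: W(2) quadratic_form_conjugate inner_axis' diag_mat_vec)
    then show ?thesis using assms unfolding psd_def by metis
  qed
  then show ?thesis using W that by blast
qed

lemma psd_square_root:
  fixes A :: "real ^ 'n ^ 'n"
  assumes "psd A"
  obtains R where "psd R" "R ** R = A"
proof -
  obtain W d where W: "orthogonal_matrix W" "A = W ** diag_mat d ** transpose W" "\<And>i. 0 \<le> d i"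
    using psd_diagonalization[OF assms] by metis
  define R where "R = W ** diag_mat (\<lambda>i. sqrt (d i)) ** transpose W"
  have "psd (diag_mat (\<lambda>i. sqrt (d i)))"
    using W(3) by (simp add: psd_def diag_mat_quadratic_form sum_nonneg)
  then have "psd R" unfolding R_def by (rule psd_conjugate)
  have "R ** R = W ** diag_mat (\<lambda>i. sqrt (d i)) ** (transpose W ** W) ** diag_mat (\<lambda>i. sqrt (d i)) ** transpose W"
    by (simp add: R_def matrix_mul_assoc)
  also have "\<dots> = W ** (diag_mat (\<lambda>i. sqrt (d i)) ** diag_mat (\<lambda>i. sqrt (d i))) ** transpose W"
    using W(1) unfolding orthogonal_matrix_def by (simp only: matrix_mul_rid) (simp only: matrix_mul_assoc)
  also have "\<dots> = A" using W(2,3) by (simp add: diag_mat_mult)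
  finally show ?thesis using \<open>psd R\<close> that by blast
qed

section \<open>Moore-Penrose inverses of symmetric matrices\<close>

lemma is_moore_penrose_transpose:
  assumes "is_moore_penrose A B"
  shows "is_moore_penrose (transpose A) (transpose B)"
proof -
  have "transpose A ** transpose B ** transpose A = transpose (A ** B ** A)"
    "transpose B ** transpose A ** transpose B = transpose (B ** A ** B)"
    "transpose A ** transpose B = transpose (B ** A)"
    "transpose B ** transpose A = transpose (A ** B)"
    by (simp_all add: matrix_transpose_mul matrix_mul_assoc)
  then show ?thesis using assms unfolding is_moore_penrose_def by simp
qed

text \<open>\<open>A ** B\<close> is the orthogonal projection onto the range of \<open>A\<close>, whichever inverse \<open>B\<close> is taken.\<close>

lemma moore_penrose_range_projection_unique:
  assumes "is_moore_penrose A B" "is_moore_penrose A C"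
  shows "A ** B = A ** C"
proof -
  have "A ** B = transpose ((A ** C) ** (A ** B))"
    using assms unfolding is_moore_penrose_def by (metis matrix_mul_assoc)
  also have "\<dots> = (A ** B) ** (A ** C)"
    using assms unfolding is_moore_penrose_def by (simp add: matrix_transpose_mul)
  also have "\<dots> = A ** C"
    using assms unfolding is_moore_penrose_def by (metis matrix_mul_assoc)
  finally show ?thesis .
qed

lemma moore_penrose_unique:
  assumes "is_moore_penrose A B" "is_moore_penrose A C"
  shows "B = C"
proof -
  have "is_moore_penrose (transpose A) (transpose B)" "is_moore_penrose (transpose A) (transpose C)"
    using assms by (simp_all add: is_moore_penrose_transpose)
  then have "transpose (B ** A) = transpose (C ** A)"
    unfolding matrix_transpose_mul by (rule moore_penrose_range_projection_unique)
  then have "B ** A = C ** A" by (metis transpose_transpose)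
  moreover have "B = B ** A ** B" "C = C ** A ** C"
    using assms unfolding is_moore_penrose_def by auto
  ultimately show ?thesis
    using moore_penrose_range_projection_unique[OF assms] by (metis matrix_mul_assoc)
qed

lemma moore_penrose_eqI: "is_moore_penrose A B \<Longrightarrow> moore_penrose A = B"
  unfolding moore_penrose_def using moore_penrose_unique by blast

text \<open>Inverting the nonzero eigenvalues in a diagonalization yields an inverse; the convention
  \<open>inverse 0 = 0\<close> is the right one on the kernel.\<close>

lemma is_moore_penrose_symmetric:
  fixes A :: "real ^ 'n ^ 'n"
  assumes "transpose A = A"
  shows "is_moore_penrose A (moore_penrose A)"
proof -
  obtain W d where W: "orthogonal_matrix W" "A = W ** diag_mat d ** transpose W"
    using symmetric_matrix_diagonalization[OF assms] by blast
  define B where "B = W ** diag_mat (\<lambda>i. inverse (d i)) ** transpose W"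
  have mult: "(W ** diag_mat a ** transpose W) ** (W ** diag_mat b ** transpose W)
      = W ** diag_mat (\<lambda>i. a i * b i) ** transpose W" for a b
  proof -
    have "(W ** diag_mat a ** transpose W) ** (W ** diag_mat b ** transpose W)
      = W ** diag_mat a ** (transpose W ** W) ** diag_mat b ** transpose W"
      by (simp add: matrix_mul_assoc)
    also have "\<dots> = W ** (diag_mat a ** diag_mat b) ** transpose W"
      using W(1) unfolding orthogonal_matrix_def by (simp only: matrix_mul_rid) (simp only: matrix_mul_assoc)
    finally show ?thesis by (simp only: diag_mat_mult)
  qed
  have "transpose (W ** diag_mat a ** transpose W) = W ** diag_mat a ** transpose W" for a
    by (simp add: matrix_transpose_mul matrix_mul_assoc)
  moreover have "(\<lambda>i. d i * inverse (d i) * d i) = d"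
    "(\<lambda>i. inverse (d i) * d i * inverse (d i)) = (\<lambda>i. inverse (d i))"
    by (intro ext; case_tac "d i = 0"; simp)+
  ultimately have "is_moore_penrose A B"
    unfolding is_moore_penrose_def W(2) B_def by (simp only: mult simp_thms)
  then show ?thesis using moore_penrose_eqI by metis
qed

lemma moore_penrose_symmetric:
  fixes A :: "real ^ 'n ^ 'n"
  assumes "transpose A = A"
  shows "transpose (moore_penrose A) = moore_penrose A"
proof -
  have "is_moore_penrose A (transpose (moore_penrose A))"
    using is_moore_penrose_symmetric[OF assms] assms unfolding is_moore_penrose_def
    by (metis matrix_transpose_mul matrix_mul_assoc)
  then show ?thesis using moore_penrose_eqI by metis
qed

lemma projection_matrix_symmetric: "transpose (projection_matrix H) = projection_matrix H"
  unfolding projection_matrix_def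
  by (simp add: matrix_transpose_mul moore_penrose_symmetric matrix_mul_assoc)

lemma projection_matrix_idempotent: "projection_matrix H ** projection_matrix H = projection_matrix H"
proof -
  define B where "B = moore_penrose (H ** transpose H)"
  have "B ** (H ** transpose H) ** B = B"
    using is_moore_penrose_symmetric[of "H ** transpose H"] unfolding is_moore_penrose_def B_def
    by (simp add: matrix_transpose_mul)
  then have "transpose H ** (B ** (H ** transpose H) ** B) ** H = transpose H ** B ** H" by simp
  then show ?thesis unfolding projection_matrix_def B_def[symmetric] by (simp add: matrix_mul_assoc)
qed

text \<open>Cramer's formula presents the inverse as a rational expression in the entries. As a total
  function it is Borel measurable everywhere, and it is continuous wherever the determinant does not vanish.\<close>

definition cramer_inverse :: "real ^ 'n ^ 'n \<Rightarrow> real ^ 'n ^ 'n" where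
  "cramer_inverse A = (\<chi> k j. det (\<chi> r c. if c = k then axis j 1 $ r else A $ r $ c) / det A)"

lemma cramer_inverse:
  assumes "det A \<noteq> 0"
  shows "A ** cramer_inverse A = mat 1" "cramer_inverse A ** A = mat 1"
proof -
  have "A *v column j (cramer_inverse A) = axis j 1" for j
    using cramer[OF assms, of "column j (cramer_inverse A)" "axis j 1"]
    by (simp add: column_def cramer_inverse_def)
  then have "(A ** cramer_inverse A) $ i $ j = mat 1 $ i $ j" for i j
    by (simp add: vec_eq_iff matrix_vector_mult_def matrix_matrix_mult_def column_def mat_def axis_def)
  then show "A ** cramer_inverse A = mat 1" by (simp add: vec_eq_iff)
  then show "cramer_inverse A ** A = mat 1" using matrix_left_right_inverse by blast
qed

lemma continuous_on_det: "continuous_on UNIV (det :: real ^ 'n ^ 'n \<Rightarrow> real)"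
  unfolding det_def[abs_def] by (intro continuous_intros)

lemma continuous_on_replaced_column:
  fixes b :: real
  shows "continuous_on S (\<lambda>A :: real ^ 'n ^ 'm. if P then b else A $ r $ c)"
  by (cases P) (auto intro!: continuous_intros)

lemma continuous_on_cramer_inverse: "continuous_on {A. det A \<noteq> 0} cramer_inverse"
  unfolding cramer_inverse_def[abs_def]
  by (intro continuous_intros continuous_on_compose2[OF continuous_on_det] continuous_on_vec_lambda)
     (auto intro!: continuous_on_replaced_column continuous_intros)

lemma isCont_cramer_inverse:
  assumes "det A \<noteq> 0" shows "isCont cramer_inverse A"
proof -
  have "open {A :: real^'n^'n. det A \<noteq> 0}"
    using continuous_on_det by (intro open_Collect_neq) (auto intro: continuous_intros)
  then show ?thesis
    using continuous_on_cramer_inverse assms continuous_on_eq_continuous_at by blast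
qed

lemma borel_measurable_vec:
  fixes f :: "'a \<Rightarrow> ('b::euclidean_space) ^ 'n"
  assumes "\<And>i. (\<lambda>x. f x $ i) \<in> borel_measurable M"
  shows "f \<in> borel_measurable M"
  using assms by (subst borel_measurable_euclidean_space)
    (auto simp: Basis_vec_def inner_axis intro!: borel_measurable_inner)

lemma borel_measurable_det: "det \<in> borel_measurable (borel :: (real ^ 'n ^ 'n) measure)"
  by (intro borel_measurable_continuous_onI continuous_on_det)

lemma borel_measurable_cramer_inverse:
  "cramer_inverse \<in> borel_measurable (borel :: (real ^ 'n ^ 'n) measure)"
proof (intro borel_measurable_vec)
  fix k j :: 'n
  have "(\<lambda>A :: real^'n^'n. \<chi> r c. if c = k then axis j 1 $ r else A $ r $ c) \<in> borel_measurable borel"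
    by (intro borel_measurable_continuous_onI continuous_on_vec_lambda)
       (auto intro!: continuous_on_replaced_column continuous_intros)
  then have "(\<lambda>A :: real^'n^'n. det (\<chi> r c. if c = k then axis j 1 $ r else A $ r $ c)) \<in> borel_measurable borel"
    by (rule measurable_compose[OF _ borel_measurable_det])
  then show "(\<lambda>A. cramer_inverse A $ k $ j) \<in> borel_measurable borel"
    unfolding cramer_inverse_def by (simp add: borel_measurable_divide borel_measurable_det)
qed

lemma det_nonzero_positive_definite:
  fixes A :: "real ^ 'n ^ 'n"
  assumes "\<And>x. x \<noteq> 0 \<Longrightarrow> 0 < x \<bullet> (A *v x)"
  shows "det A \<noteq> 0"
proof -
  have "\<And>x. A *v x = 0 \<Longrightarrow> x = 0" using assms by (metis inner_zero_right less_irrefl)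
  then show ?thesis
    by (metis invertible_det_nz invertible_left_inverse matrix_left_invertible_ker)
qed

lemma mat_scaled_vec: "mat c *v x = c *\<^sub>R (x :: real ^ 'n)"
  by (simp add: mat_def matrix_vector_mult_def vec_eq_iff if_distrib if_distribR cong: if_cong)

lemma det_nonzero_psd_shift:
  assumes "psd A" "0 < c"
  shows "det (A + mat c) \<noteq> 0"
proof (rule det_nonzero_positive_definite)
  fix x :: "real^'a" assume "x \<noteq> 0"
  then have "0 < c * (x \<bullet> x)" using assms by simp
  then show "0 < x \<bullet> ((A + mat c) *v x)"
    using assms(1) unfolding psd_def
    by (simp add: matrix_vector_mult_add_rdistrib mat_scaled_vec inner_add_right add_nonneg_pos)
qed

lemma psd_square: "transpose A = A \<Longrightarrow> psd (A ** A)"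
  unfolding psd_def
  by (metis inner_ge_zero inner_symmetric_matrix matrix_transpose_mul matrix_vector_mul_assoc)

lemma tendsto_matrix_mult [tendsto_intros]:
  fixes f :: "'a \<Rightarrow> real ^ 'n ^ 'm" and g :: "'a \<Rightarrow> real ^ 'k ^ 'n"
  assumes "(f \<longlongrightarrow> A) F" "(g \<longlongrightarrow> B) F"
  shows "((\<lambda>x. f x ** g x) \<longlongrightarrow> A ** B) F"
  unfolding matrix_matrix_mult_def
  by (intro vec_tendstoI) (simp, intro tendsto_intros assms)

lemma tendsto_mat [tendsto_intros]:
  "(f \<longlongrightarrow> c) F \<Longrightarrow> ((\<lambda>x. mat (f x) :: real ^ 'n ^ 'n) \<longlongrightarrow> mat c) F"
  unfolding mat_def by (intro vec_tendstoI) (simp add: if_distrib if_distribR)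

lemma matrix_mult_add_left: "(A + B) ** C = A ** C + B ** (C :: real ^ 'n ^ 'm)"
  by (simp add: vec_eq_iff matrix_matrix_mult_def algebra_simps sum.distrib)

lemma matrix_mult_diff_left: "(A - B) ** C = A ** C - B ** (C :: real ^ 'n ^ 'm)"
  by (simp add: vec_eq_iff matrix_matrix_mult_def algebra_simps sum_subtractf)

lemma matrix_mult_diff_right: "A ** (B - C) = A ** B - A ** (C :: real ^ 'n ^ 'm)"
  by (simp add: vec_eq_iff matrix_matrix_mult_def algebra_simps sum_subtractf)

lemma mat_mult_left: "mat c ** A = c *\<^sub>R (A :: real ^ 'n ^ 'm)"
  by (simp add: mat_def matrix_matrix_mult_def vec_eq_iff if_distrib if_distribR cong: if_cong)

lemma mat_mult_right: "A ** mat c = c *\<^sub>R (A :: real ^ 'n ^ 'm)"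
  by (simp add: mat_def matrix_matrix_mult_def vec_eq_iff if_distrib if_distribR mult.commute cong: if_cong)

text \<open>The Moore-Penrose inverse is discontinuous where the rank drops, so its measurability needs an
  argument: it is the pointwise limit of the regularized inverses \<open>inverse (A\<^sup>2 + \<epsilon>) A\<close>. Indeed, with
  \<open>B\<close> the Moore-Penrose inverse, the defining equations turn the regularized inverse into
  \<open>B inverse (1 + \<epsilon> B\<^sup>2)\<close>, which is continuous in \<open>\<epsilon>\<close>.\<close>

lemma moore_penrose_limit:
  fixes A :: "real ^ 'n ^ 'n"
  assumes sym: "transpose A = A"
  shows "(\<lambda>k. cramer_inverse (A ** A + mat (inverse (real (Suc k)))) ** A) \<longlonglongrightarrow> moore_penrose A"
proof -
  define B where "B = moore_penrose A"
  have Bsym: "transpose B = B" unfolding B_def by (rule moore_penrose_symmetric[OF sym])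
  have MP: "A ** B ** A = A" "B ** A ** B = B" "transpose (A ** B) = A ** B"
    using is_moore_penrose_symmetric[OF sym] unfolding is_moore_penrose_def B_def by auto
  have comm: "A ** B = B ** A" using MP(3) by (simp add: matrix_transpose_mul sym Bsym)
  have step: "cramer_inverse (A ** A + mat c) ** A = B ** cramer_inverse (mat 1 + c *\<^sub>R (B ** B))"
    if c: "c > 0" for c
  proof -
    define Y where "Y = cramer_inverse (A ** A + mat c)"
    have Y: "Y ** (A ** A + mat c) = mat 1"
      unfolding Y_def by (intro cramer_inverse(2) det_nonzero_psd_shift psd_square sym c)
    have 1: "(A ** A + mat c) ** B = A + c *\<^sub>R B"
      by (simp add: matrix_mult_add_left mat_mult_left) (metis MP(1) comm matrix_mul_assoc)
    have 2: "B = A ** (B ** B)" by (metis MP(2) comm matrix_mul_assoc)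
    have "B = Y ** A + Y ** (c *\<^sub>R B)"
      using 1 Y by (metis matrix_add_ldistrib matrix_mul_assoc matrix_mul_lid)
    also have "Y ** (c *\<^sub>R B) = (Y ** A) ** (c *\<^sub>R (B ** B))"
      by (subst 2) (simp add: matrix_mul_assoc flip: mat_mult_right)
    finally have B: "B = Y ** A ** (mat 1 + c *\<^sub>R (B ** B))"
      by (simp add: matrix_add_ldistrib)
    have "psd (c *\<^sub>R (B ** B))"
      using psd_square[OF Bsym] c by (auto simp: psd_def scaleR_matrix_vector_assoc[symmetric] transpose_scalar)
    then have "det (mat 1 + c *\<^sub>R (B ** B)) \<noteq> 0"
      using det_nonzero_psd_shift[of _ 1] by (metis add.commute zero_less_one)
    then have "B ** cramer_inverse (mat 1 + c *\<^sub>R (B ** B)) = Y ** A"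
      using B cramer_inverse(1) by (metis matrix_mul_assoc matrix_mul_rid)
    then show ?thesis by (simp add: Y_def)
  qed
  have "(\<lambda>k. inverse (real (Suc k))) \<longlonglongrightarrow> 0" by (rule LIMSEQ_inverse_real_of_nat)
  then have "(\<lambda>k. mat 1 + inverse (real (Suc k)) *\<^sub>R (B ** B)) \<longlonglongrightarrow> mat 1 + 0 *\<^sub>R (B ** B)"
    by (intro tendsto_intros)
  then have "(\<lambda>k. cramer_inverse (mat 1 + inverse (real (Suc k)) *\<^sub>R (B ** B))) \<longlonglongrightarrow> cramer_inverse (mat 1)"
    by (intro isCont_tendsto_compose[OF isCont_cramer_inverse]) auto
  then have "(\<lambda>k. B ** cramer_inverse (mat 1 + inverse (real (Suc k)) *\<^sub>R (B ** B))) \<longlonglongrightarrow> B ** cramer_inverse (mat 1)"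
    by (intro tendsto_intros)
  moreover have "cramer_inverse (mat 1) = (mat 1 :: real^'n^'n)"
    using cramer_inverse(1)[of "mat 1 :: real^'n^'n"] by simp
  ultimately show ?thesis by (simp add: step B_def)
qed

section \<open>The two scaling matrices\<close>

lemma diag_part_eq: "diag_part A = diag_mat (\<lambda>i. A $ i $ i)"
  by (simp add: diag_part_def diag_mat_def vec_eq_iff)

lemma symmetric_compression:
  fixes T A :: "real ^ 'n ^ 'n"
  assumes "transpose T = T" "transpose A = A"
  shows "transpose (T ** A ** T) = T ** A ** T"
  using assms by (simp add: matrix_transpose_mul matrix_mul_assoc)

lemma tendsto_diag_part [tendsto_intros]:
  "(f \<longlongrightarrow> A) F \<Longrightarrow> ((\<lambda>x. diag_part (f x)) \<longlongrightarrow> diag_part A) F"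
  unfolding diag_part_def by (intro vec_tendstoI) (auto intro!: tendsto_intros)

lemma tendsto_trace [tendsto_intros]:
  "(f \<longlongrightarrow> A) F \<Longrightarrow> ((\<lambda>x. trace (f x)) \<longlongrightarrow> trace (A :: real ^ 'n ^ 'n)) F"
  unfolding trace_def by (intro tendsto_intros)

lemma borel_measurable_isCont:
  fixes f :: "'a::t2_space \<Rightarrow> 'b::topological_space"
  shows "(\<And>x. isCont f x) \<Longrightarrow> f \<in> borel_measurable borel"
  by (intro borel_measurable_continuous_onI continuous_at_imp_continuous_on) auto

lemma borel_measurable_scaling_matrix:
  fixes T :: "real ^ 'n ^ 'n"
  assumes sym: "transpose T = T"
  shows "scaling_matrix E T \<in> borel_measurable borel"
proof (cases E)
  case ATS
  have "(\<lambda>A. trace (T ** A ** T)) \<in> borel_measurable borel"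
    by (intro borel_measurable_isCont) (simp add: isCont_def, intro tendsto_intros)
  then have "(\<lambda>A. (1 / trace (T ** A ** T)) *\<^sub>R (mat 1 :: real^'n^'n)) \<in> borel_measurable borel"
    by measurable
  moreover have "scaling_matrix E T = (\<lambda>A. (1 / trace (T ** A ** T)) *\<^sub>R mat 1)"
    by (simp add: ATS fun_eq_iff)
  ultimately show ?thesis by simp
next
  case MATS
  define Q where "Q A = T ** diag_part A ** T" for A
  have Q: "transpose (Q A) = Q A" for A
    unfolding Q_def by (intro symmetric_compression sym) (simp add: diag_part_eq)
  have "(\<lambda>A. cramer_inverse (Q A ** Q A + mat (inverse (real (Suc k)))) ** Q A) \<in> borel_measurable borel" for k
  proof -
    have "Q \<in> borel_measurable borel" "(\<lambda>A. Q A ** Q A + mat (inverse (real (Suc k)))) \<in> borel_measurable borel"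
      unfolding Q_def[abs_def]
      by (intro borel_measurable_isCont; simp add: isCont_def; intro tendsto_intros)+
    then have m: "Q \<in> borel_measurable borel"
      "(\<lambda>A. cramer_inverse (Q A ** Q A + mat (inverse (real (Suc k))))) \<in> borel_measurable borel"
      by (auto intro: measurable_compose[OF _ borel_measurable_cramer_inverse])
    have "(\<lambda>p. fst p ** snd p) \<in> borel_measurable (borel :: ((real^'n^'n) \<times> (real^'n^'n)) measure)"
      by (intro borel_measurable_isCont) (simp only: isCont_def, intro tendsto_intros)
    from measurable_compose[OF borel_measurable_Pair[OF m(2,1)] this] show ?thesis by simp
  qed
  then have "(\<lambda>A. moore_penrose (Q A)) \<in> borel_measurable borel"
    by (rule borel_measurable_LIMSEQ_metric) (rule moore_penrose_limit[OF Q])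
  moreover have "scaling_matrix E T = (\<lambda>A. moore_penrose (Q A))"
    by (simp add: MATS Q_def fun_eq_iff)
  ultimately show ?thesis by simp
qed

context
  fixes T :: "real ^ 'n ^ 'n"
  assumes sym: "transpose T = T" and idem: "T ** T = T"
begin

text \<open>Compressing a positive diagonal matrix by the projection \<open>T\<close> leaves it definite on the range of
  \<open>T\<close>; adding \<open>mat 1 - T\<close> makes it definite on the kernel as well.\<close>

lemma compressed_shift_positive_definite:
  assumes "\<And>i. 0 < d i" "x \<noteq> 0"
  shows "0 < x \<bullet> ((T ** diag_mat d ** T + (mat 1 - T)) *v x)"
proof -
  define y where "y = T *v x"
  define z where "z = x - y"
  have Ty: "T *v y = y" by (simp add: y_def matrix_vector_mul_assoc idem)
  have "x \<bullet> ((T ** diag_mat d ** T) *v x) = y \<bullet> (diag_mat d *v y)"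
    using quadratic_form_conjugate[of x T "diag_mat d"] by (simp add: sym y_def)
  moreover have "x \<bullet> ((mat 1 - T) *v x) = z \<bullet> z"
  proof -
    have "y \<bullet> y = x \<bullet> y" using inner_symmetric_matrix[OF sym, of x y] Ty y_def by simp
    then show ?thesis
      by (simp add: z_def matrix_vector_mult_diff_rdistrib y_def[symmetric] inner_diff_left inner_diff_right inner_commute)
  qed
  ultimately have eq: "x \<bullet> ((T ** diag_mat d ** T + (mat 1 - T)) *v x) = (\<Sum>i\<in>UNIV. d i * (y $ i)\<^sup>2) + z \<bullet> z"
    by (simp add: matrix_vector_mult_add_rdistrib inner_add_right diag_mat_quadratic_form)
  have nn: "0 \<le> d i * (y $ i)\<^sup>2" for i using assms(1)[of i] by simp
  show ?thesis
  proof (cases "z = 0")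
    case False
    then show ?thesis unfolding eq by (intro add_nonneg_pos sum_nonneg nn) auto
  next
    case True
    then have "y \<noteq> 0" using assms(2) z_def by simp
    then obtain i where "y $ i \<noteq> 0" by (auto simp: vec_eq_iff)
    then have "0 < d i * (y $ i)\<^sup>2" using assms(1)[of i] by simp
    then have "0 < (\<Sum>i\<in>UNIV. d i * (y $ i)\<^sup>2)"
      by (intro sum_pos2[of UNIV i]) (auto simp: nn)
    then show ?thesis unfolding eq by (simp add: add_pos_nonneg)
  qed
qed

text \<open>The formula that makes the Moore-Penrose inverse harmless here: the rank of \<open>T D T\<close> is that of
  \<open>T\<close> for every positive diagonal \<open>D\<close>, so the pseudoinverse is an honest inverse, continuous in \<open>D\<close>,
  followed by \<open>T\<close>.\<close>

lemma moore_penrose_compressed_diag: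
  assumes d: "\<And>i. 0 < d i"
  shows "moore_penrose (T ** diag_mat d ** T) = T ** cramer_inverse (T ** diag_mat d ** T + (mat 1 - T))"
proof (rule moore_penrose_eqI)
  define A where "A = T ** diag_mat d ** T"
  define G where "G = A + (mat 1 - T)"
  define Gi where "Gi = cramer_inverse G"
  have "det G \<noteq> 0" unfolding G_def A_def
    by (intro det_nonzero_positive_definite compressed_shift_positive_definite d)
  then have Gi: "G ** Gi = mat 1" "Gi ** G = mat 1" unfolding Gi_def by (auto intro: cramer_inverse)
  have TA: "T ** A = A" "A ** T = A" unfolding A_def using idem by (metis matrix_mul_assoc)+
  have TG: "T ** G = A" "G ** T = A"
    unfolding G_def by (simp_all add: matrix_add_ldistrib matrix_mult_add_left TA matrix_mult_diff_left matrix_mult_diff_right idem)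
  have comm: "T ** Gi = Gi ** T"
    by (metis Gi TG matrix_mul_assoc matrix_mul_lid matrix_mul_rid)
  have 1: "A ** (T ** Gi) = T" by (metis Gi(1) TA(2) TG(1) matrix_mul_assoc matrix_mul_rid)
  have 2: "(T ** Gi) ** A = T" by (metis Gi(2) TA(1) TG(2) comm matrix_mul_assoc matrix_mul_lid)
  show "is_moore_penrose A (T ** Gi)"
    unfolding is_moore_penrose_def 1 2 by (simp add: sym TA matrix_mul_assoc idem)
qed

lemma isCont_scaling_matrix:
  assumes diag: "\<And>i. 0 < A $ i $ i" and tr: "E = ATS \<Longrightarrow> trace (T ** A ** T) \<noteq> 0"
  shows "isCont (scaling_matrix E T) A"
proof (cases E)
  case ATS
  have "(\<lambda>A. (1 / trace (T ** A ** T)) *\<^sub>R (mat 1 :: real^'n^'n)) \<midarrow>A\<rightarrow> (1 / trace (T ** A ** T)) *\<^sub>R mat 1"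
    by (intro tendsto_intros) (use ATS tr in auto)
  moreover have "scaling_matrix E T = (\<lambda>A. (1 / trace (T ** A ** T)) *\<^sub>R mat 1)"
    by (simp add: ATS fun_eq_iff)
  ultimately show ?thesis by (simp add: isCont_def)
next
  case MATS
  define G where "G B = T ** diag_part B ** T + (mat 1 - T)" for B
  have "open (\<Inter>i. {B :: real^'n^'n. 0 < B $ i $ i})"
    by (intro open_INT ballI open_Collect_less continuous_intros) auto
  moreover have "A \<in> (\<Inter>i. {B :: real^'n^'n. 0 < B $ i $ i})" using diag by auto
  ultimately have "\<forall>\<^sub>F B in nhds A. B \<in> (\<Inter>i. {B. 0 < B $ i $ i})"
    using eventually_nhds by blast
  then have ev: "\<forall>\<^sub>F B in nhds A. scaling_matrix E T B = T ** cramer_inverse (G B)"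
    by eventually_elim (simp add: MATS G_def diag_part_eq moore_penrose_compressed_diag)
  have "det (G A) \<noteq> 0" unfolding G_def diag_part_eq
    by (intro det_nonzero_positive_definite compressed_shift_positive_definite diag)
  then have "isCont cramer_inverse (G A)" by (rule isCont_cramer_inverse)
  moreover have "isCont G A" unfolding G_def[abs_def] isCont_def by (intro tendsto_intros)
  ultimately have "isCont (\<lambda>B. cramer_inverse (G B)) A" by (rule isCont_o2[rotated])
  then have "isCont (\<lambda>B. T ** cramer_inverse (G B)) A"
    unfolding isCont_def by (intro tendsto_intros)
  then show ?thesis using isCont_cong[OF ev] by blast
qed

text \<open>The second part is what makes the statistic diverge under alternatives: the form is definite on
  the range of \<open>T\<close>.\<close>

lemma scaling_matrix_psd:
  assumes A: "psd A" and diag: "\<And>i. 0 < A $ i $ i" and tr: "E = ATS \<Longrightarrow> trace (T ** A ** T) \<noteq> 0"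
  shows "psd (scaling_matrix E T A)"
    and "T *v x \<noteq> 0 \<Longrightarrow> 0 < (T *v x) \<bullet> (scaling_matrix E T A *v (T *v x))"
proof -
  have "psd (scaling_matrix E T A) \<and>
    (T *v x \<noteq> 0 \<longrightarrow> 0 < (T *v x) \<bullet> (scaling_matrix E T A *v (T *v x)))"
  proof (cases E)
    case ATS
    have "psd (T ** A ** T)" using psd_conjugate[OF A, of T] sym by simp
    then have "0 \<le> axis i 1 \<bullet> ((T ** A ** T) *v axis i 1)" for i
      unfolding psd_def by blast
    then have "0 \<le> (T ** A ** T) $ i $ i" for i
      by (simp add: inner_axis' matrix_vector_mult_basis column_def)
    then have "0 \<le> trace (T ** A ** T)" unfolding trace_def by (intro sum_nonneg)
    then have "0 < 1 / trace (T ** A ** T)" using tr ATS by simp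
    then show ?thesis
      by (simp add: ATS psd_def transpose_scalar scaleR_matrix_vector_assoc[symmetric] zero_less_mult_iff)
  next
    case MATS
    define d where "d i = A $ i $ i" for i
    define D where "D = T ** diag_mat d ** T"
    define G where "G = D + (mat 1 - T)"
    define B where "B = moore_penrose D"
    have d: "0 < d i" for i using diag by (simp add: d_def)
    have D: "transpose D = D" unfolding D_def by (intro symmetric_compression sym) simp
    have "psd (diag_mat d)" using d by (simp add: psd_def diag_mat_quadratic_form sum_nonneg less_imp_le)
    then have "psd D" using psd_conjugate[of "diag_mat d" T] sym by (simp add: D_def)
    have Bs: "transpose B = B" unfolding B_def by (rule moore_penrose_symmetric[OF D])
    have "B = B ** D ** transpose B"
      using is_moore_penrose_symmetric[OF D] Bs unfolding B_def is_moore_penrose_def by simp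
    then have "psd B" using psd_conjugate[OF \<open>psd D\<close>] by metis
    moreover have "0 < (T *v x) \<bullet> (B *v (T *v x))" if "T *v x \<noteq> 0"
    proof -
      define y z where "y = T *v x" and "z = cramer_inverse G *v y"
      have "det G \<noteq> 0" unfolding G_def D_def
        by (intro det_nonzero_positive_definite compressed_shift_positive_definite d)
      then have Gz: "G *v z = y" by (simp add: z_def matrix_vector_mul_assoc cramer_inverse)
      then have "z \<noteq> 0" using that y_def by auto
      then have "0 < z \<bullet> (G *v z)"
        unfolding G_def D_def by (intro compressed_shift_positive_definite d)
      also have "z \<bullet> (G *v z) = y \<bullet> z" by (simp add: Gz inner_commute)
      also have "\<dots> = y \<bullet> (T *v z)"
        using inner_symmetric_matrix[OF sym, of y z] by (simp add: y_def matrix_vector_mul_assoc idem)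
      also have "T *v z = B *v y"
        unfolding B_def D_def moore_penrose_compressed_diag[OF d]
        by (simp add: z_def matrix_vector_mul_assoc G_def D_def)
      finally show ?thesis by (simp add: y_def)
    qed
    moreover have "scaling_matrix E T A = B"
      by (simp add: MATS diag_part_eq B_def D_def d_def[abs_def])
    ultimately show ?thesis by simp
  qed
  then show "psd (scaling_matrix E T A)"
    "T *v x \<noteq> 0 \<Longrightarrow> 0 < (T *v x) \<bullet> (scaling_matrix E T A *v (T *v x))" by auto
qed

end

section \<open>Eigenvalues of a product of two symmetric matrices\<close>

lemma poly_charpoly: "poly (charpoly A) x = det (mat x - A)"
proof -
  have "poly (of_int k) x = of_int k" for k :: int by (cases k rule: int_cases) auto
  then show ?thesis
    unfolding charpoly_def det_def
    by (auto simp: poly_sum poly_prod mat_def intro!: sum.cong prod.cong)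
qed

lemma det_shift_commute:
  fixes A B :: "real ^ 'n ^ 'n"
  assumes "det A \<noteq> 0"
  shows "det (mat x - A ** B) = det (mat x - B ** A)"
proof -
  have "A ** (mat x - B ** A) = (mat x - A ** B) ** A"
    by (simp add: matrix_mult_diff_left matrix_mult_diff_right mat_mult_left mat_mult_right matrix_mul_assoc)
  then have "det A * det (mat x - B ** A) = det (mat x - A ** B) * det A" by (metis det_mul)
  then show ?thesis using assms by simp
qed

text \<open>If \<open>A\<close> is invertible then \<open>A ** B\<close> and \<open>B ** A\<close> are similar. A positive semidefinite \<open>A\<close> is the
  limit of the invertible matrices \<open>A + \<epsilon>\<close>, and determinants are continuous.\<close>

lemma charpoly_mult_commute_psd:
  fixes A B :: "real ^ 'n ^ 'n"
  assumes "psd A"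
  shows "charpoly (A ** B) = charpoly (B ** A)"
proof -
  have "det (mat x - A ** B) = det (mat x - B ** A)" for x
  proof -
    define A' where "A' k = A + mat (inverse (real (Suc k)))" for k
    have "A' \<longlonglongrightarrow> A + mat 0" unfolding A'_def
      by (intro tendsto_intros LIMSEQ_inverse_real_of_nat)
    then have A': "A' \<longlonglongrightarrow> A" by (simp add: mat_def zero_vec_def[symmetric] vec_eq_iff)
    have c: "isCont det M" for M :: "real^'n^'n"
      using continuous_on_det continuous_on_eq_continuous_at by blast
    have "(\<lambda>k. det (mat x - A' k ** B)) \<longlonglongrightarrow> det (mat x - A ** B)"
      by (intro isCont_tendsto_compose[OF c] tendsto_intros A')
    moreover have "(\<lambda>k. det (mat x - B ** A' k)) \<longlonglongrightarrow> det (mat x - B ** A)"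
      by (intro isCont_tendsto_compose[OF c] tendsto_intros A')
    moreover have "det (mat x - A' k ** B) = det (mat x - B ** A' k)" for k
      by (intro det_shift_commute) (simp add: A'_def det_nonzero_psd_shift[OF assms])
    ultimately show ?thesis using LIMSEQ_unique by fastforce
  qed
  then show ?thesis by (metis poly_charpoly poly_eqI2 ext poly_eq_poly_eq_iff)
qed

lemma eigenvalues_of_orthogonal_diagonalization:
  fixes W :: "real ^ 'n ^ 'n"
  assumes W: "orthogonal_matrix W" and K: "K = W ** diag_mat d ** transpose W"
  shows "eigenvalues_of K d"
proof -
  have "poly (charpoly K) x = poly (\<Prod>a\<in>UNIV. [:- d a, 1:]) x" for x
  proof -
    have "W ** mat x ** transpose W = mat x"
      using W by (simp add: mat_mult_right scaleR_matrix_vector_assoc orthogonal_matrix_def) (metis mat_mult_left mat_mult_right matrix_mul_assoc matrix_mul_rid)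
    then have "mat x - K = W ** (mat x - diag_mat d) ** transpose W"
      by (simp add: K matrix_mult_diff_left matrix_mult_diff_right)
    then have "det (mat x - K) = det (W ** transpose W) * det (mat x - diag_mat d)"
      by (simp add: det_mul mult_ac)
    also have "det (W ** transpose W) = 1" using W by (simp add: orthogonal_matrix_def)
    also have "det (mat x - diag_mat d) = (\<Prod>i\<in>UNIV. x - d i)"
      by (subst det_diagonal) (auto simp: mat_def diag_mat_def)
    finally show ?thesis by (simp add: poly_charpoly poly_prod)
  qed
  then show ?thesis unfolding eigenvalues_of_def by (metis poly_eq_poly_eq_iff ext)
qed

text \<open>The matrix \<open>C ** T ** K ** T\<close> is not symmetric, but with \<open>R\<close> the square root of \<open>C\<close> its
  characteristic polynomial is that of the symmetric matrix \<open>R T K T R\<close>, which a rotation \<open>W\<close>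
  diagonalizes. The factor \<open>L\<close> of the quadratic form \<open>T C T\<close> absorbs this rotation, so that \<open>L K L'\<close>
  is exactly diagonal.\<close>

theorem quadratic_form_normal_form:
  fixes T C K :: "real ^ 'n ^ 'n"
  assumes sym: "transpose T = T" and C: "psd C" and K: "psd K"
  obtains L lam where "\<And>a. 0 \<le> lam a" "eigenvalues_of (C ** T ** K ** T) lam"
    "transpose L ** L = T ** C ** T" "L ** K ** transpose L = diag_mat lam"
proof -
  obtain R where R: "psd R" "R ** R = C" using psd_square_root[OF C] .
  have Rs: "transpose R = R" using R by (simp add: psd_def)
  have "psd ((R ** T) ** K ** transpose (R ** T))" by (rule psd_conjugate[OF K])
  then obtain W lam where W: "orthogonal_matrix W" "\<And>i. 0 \<le> lam i"
      "(R ** T) ** K ** transpose (R ** T) = W ** diag_mat lam ** transpose W"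
    using psd_diagonalization by metis
  define L where "L = transpose W ** R ** T"
  have WW: "transpose W ** W = mat 1" "W ** transpose W = mat 1" using W(1) by (auto simp: orthogonal_matrix_def)
  show ?thesis
  proof
    show "0 \<le> lam a" for a by (rule W)
    have "charpoly (C ** T ** K ** T) = charpoly (R ** (R ** T ** K ** T))"
      by (simp add: matrix_mul_assoc R(2)[symmetric])
    also have "\<dots> = charpoly ((R ** T ** K ** T) ** R)" by (rule charpoly_mult_commute_psd[OF R(1)])
    also have "(R ** T ** K ** T) ** R = (R ** T) ** K ** transpose (R ** T)"
      by (simp add: matrix_transpose_mul sym Rs matrix_mul_assoc)
    finally show "eigenvalues_of (C ** T ** K ** T) lam"
      using eigenvalues_of_orthogonal_diagonalization[OF W(1,3)] by (simp add: eigenvalues_of_def)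
    have "transpose L ** L = T ** R ** (W ** transpose W) ** R ** T"
      by (simp add: L_def matrix_transpose_mul sym Rs matrix_mul_assoc)
    then show "transpose L ** L = T ** C ** T"
      by (simp only: WW matrix_mul_rid R(2)[symmetric]) (simp only: matrix_mul_assoc)
    have "L ** K ** transpose L = transpose W ** ((R ** T) ** K ** transpose (R ** T)) ** W"
      by (simp add: L_def matrix_transpose_mul matrix_mul_assoc)
    also have "\<dots> = (transpose W ** W) ** diag_mat lam ** (transpose W ** W)"
      by (simp add: W(3) matrix_mul_assoc)
    finally show "L ** K ** transpose L = diag_mat lam" by (simp add: WW)
  qed
qed

section \<open>Convergence and boundedness in probability\<close>

definition bounded_in_probability :: "'w measure \<Rightarrow> (nat \<Rightarrow> 'w \<Rightarrow> 'b::real_normed_vector) \<Rightarrow> bool" where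
  "bounded_in_probability M Y \<longleftrightarrow>
     (\<forall>\<eta>>0. \<exists>K. \<forall>\<^sub>F m in sequentially. measure M {w \<in> space M. norm (Y m w) > K} < \<eta>)"

context prob_space
begin

lemma tendsto_in_probabilityI:
  assumes "\<And>\<epsilon> \<eta>. 0 < \<epsilon> \<Longrightarrow> 0 < \<eta> \<Longrightarrow> \<forall>\<^sub>F m in sequentially. prob {w \<in> space M. dist (Y m w) y > \<epsilon>} < \<eta>"
  shows "tendsto_in_probability M Y y"
  unfolding tendsto_in_probability_def
proof (intro allI impI tendstoI)
  fix \<epsilon> \<eta> :: real assume "0 < \<epsilon>" "0 < \<eta>"
  from assms[OF this] show "\<forall>\<^sub>F m in sequentially. dist (prob {w \<in> space M. dist (Y m w) y > \<epsilon>}) 0 < \<eta>"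
    by eventually_elim (simp add: dist_real_def)
qed

lemma tendsto_in_probabilityD:
  assumes "tendsto_in_probability M Y y" "0 < \<epsilon>" "0 < \<eta>"
  shows "\<forall>\<^sub>F m in sequentially. prob {w \<in> space M. dist (Y m w) y > \<epsilon>} < \<eta>"
  using assms order_tendstoD(2) unfolding tendsto_in_probability_def by blast

lemma bounded_in_probabilityD:
  assumes "bounded_in_probability M Y" "0 < \<eta>"
  obtains K where "\<forall>\<^sub>F m in sequentially. prob {w \<in> space M. norm (Y m w) > K} < \<eta>"
  using assms unfolding bounded_in_probability_def by blast

lemma prob_less_Un:
  assumes "A \<subseteq> B \<union> C" "B \<in> events" "C \<in> events" "prob B < \<eta> / 2" "prob C < \<eta> / 2"
  shows "prob A < \<eta>"
proof -
  have "prob A \<le> prob (B \<union> C)" using assms by (intro finite_measure_mono) auto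
  also have "\<dots> \<le> prob B + prob C" using assms by (intro measure_Un_le) auto
  finally show ?thesis using assms by simp
qed

lemma tendsto_in_probability_cong:
  assumes "\<forall>\<^sub>F m in sequentially. \<forall>w\<in>space M. Y m w = Z m w" "tendsto_in_probability M Y y"
  shows "tendsto_in_probability M Z y"
proof (rule tendsto_in_probabilityI)
  fix \<epsilon> \<eta> :: real assume "0 < \<epsilon>" "0 < \<eta>"
  from tendsto_in_probabilityD[OF assms(2) this] assms(1)
  show "\<forall>\<^sub>F m in sequentially. prob {w \<in> space M. dist (Z m w) y > \<epsilon>} < \<eta>"
  proof eventually_elim
    case (elim m)
    have "{w \<in> space M. dist (Z m w) y > \<epsilon>} = {w \<in> space M. dist (Y m w) y > \<epsilon>}"
      using elim(2) by auto
    then show ?case using elim(1) by simp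
  qed
qed

lemma tendsto_in_probability_deterministic:
  assumes "c \<longlonglongrightarrow> y"
  shows "tendsto_in_probability M (\<lambda>m w. c m) y"
proof (rule tendsto_in_probabilityI)
  fix \<epsilon> \<eta> :: real assume e: "0 < \<epsilon>" "0 < \<eta>"
  from tendstoD[OF assms e(1)]
  show "\<forall>\<^sub>F m in sequentially. prob {w \<in> space M. dist (c m) y > \<epsilon>} < \<eta>"
    by eventually_elim (use e in simp)
qed

lemma tendsto_in_probability_isCont:
  fixes Y :: "nat \<Rightarrow> 'a \<Rightarrow> 'b::{metric_space, second_countable_topology}" and g :: "'b \<Rightarrow> 'c::metric_space"
  assumes Y: "tendsto_in_probability M Y y" and g: "isCont g y"
    and m: "\<And>m. Y m \<in> borel_measurable M"
  shows "tendsto_in_probability M (\<lambda>m w. g (Y m w)) (g y)"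
proof (rule tendsto_in_probabilityI)
  fix \<epsilon> \<eta> :: real assume e: "0 < \<epsilon>" "0 < \<eta>"
  then obtain d where d: "0 < d" "\<And>x. dist x y < d \<Longrightarrow> dist (g x) (g y) < \<epsilon>"
    using g unfolding continuous_at_eps_delta by metis
  have "\<forall>\<^sub>F m in sequentially. prob {w \<in> space M. dist (Y m w) y > d / 2} < \<eta>"
    using d e by (intro tendsto_in_probabilityD[OF Y]) auto
  then show "\<forall>\<^sub>F m in sequentially. prob {w \<in> space M. dist (g (Y m w)) (g y) > \<epsilon>} < \<eta>"
  proof eventually_elim
    case (elim m)
    have "prob {w \<in> space M. dist (g (Y m w)) (g y) > \<epsilon>} \<le> prob {w \<in> space M. dist (Y m w) y > d / 2}"
    proof (intro finite_measure_mono subsetI)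
      fix w assume w: "w \<in> {w \<in> space M. dist (g (Y m w)) (g y) > \<epsilon>}"
      then have "\<not> dist (Y m w) y < d" using d(2)[of "Y m w"] by auto
      then show "w \<in> {w \<in> space M. dist (Y m w) y > d / 2}" using w d(1) by auto
    qed (use m[of m] in measurable)
    then show ?case using elim by simp
  qed
qed

lemma tendsto_in_probability_Pair:
  fixes Y :: "nat \<Rightarrow> 'a \<Rightarrow> 'b::{metric_space, second_countable_topology}"
    and Z :: "nat \<Rightarrow> 'a \<Rightarrow> 'c::{metric_space, second_countable_topology}"
  assumes Y: "tendsto_in_probability M Y y" and Z: "tendsto_in_probability M Z z"
    and m: "\<And>m. Y m \<in> borel_measurable M" "\<And>m. Z m \<in> borel_measurable M"
  shows "tendsto_in_probability M (\<lambda>m w. (Y m w, Z m w)) (y, z)"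
proof (rule tendsto_in_probabilityI)
  fix \<epsilon> \<eta> :: real assume e: "0 < \<epsilon>" "0 < \<eta>"
  then have "0 < \<epsilon> / 2" "0 < \<eta> / 2" by auto
  from tendsto_in_probabilityD[OF Y this] tendsto_in_probabilityD[OF Z this]
  show "\<forall>\<^sub>F m in sequentially. prob {w \<in> space M. dist (Y m w, Z m w) (y, z) > \<epsilon>} < \<eta>"
  proof eventually_elim
    case (elim m)
    have "{w \<in> space M. dist (Y m w, Z m w) (y, z) > \<epsilon>} \<subseteq>
       {w \<in> space M. dist (Y m w) y > \<epsilon> / 2} \<union> {w \<in> space M. dist (Z m w) z > \<epsilon> / 2}"
    proof
      fix w assume w: "w \<in> {w \<in> space M. dist (Y m w, Z m w) (y, z) > \<epsilon>}"
      have "dist (Y m w, Z m w) (y, z) \<le> dist (Y m w) y + dist (Z m w) z"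
        by (simp add: dist_Pair_Pair sqrt_sum_squares_le_sum)
      then show "w \<in> {w \<in> space M. dist (Y m w) y > \<epsilon> / 2} \<union> {w \<in> space M. dist (Z m w) z > \<epsilon> / 2}"
        using w by auto
    qed
    then show ?case by (rule prob_less_Un) (use m elim in auto)
  qed
qed

lemma tendsto_in_probability_add:
  fixes Y Z :: "nat \<Rightarrow> 'a \<Rightarrow> real"
  assumes "tendsto_in_probability M Y y" "tendsto_in_probability M Z z"
    and "\<And>m. Y m \<in> borel_measurable M" "\<And>m. Z m \<in> borel_measurable M"
  shows "tendsto_in_probability M (\<lambda>m w. Y m w + Z m w) (y + z)"
  using tendsto_in_probability_isCont[OF tendsto_in_probability_Pair[OF assms], of "\<lambda>p. fst p + snd p"] assms(3,4)
  by (auto intro!: continuous_intros)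

lemma tendsto_in_probability_sum:
  fixes Y :: "'i \<Rightarrow> nat \<Rightarrow> 'a \<Rightarrow> real"
  assumes "finite I" "\<And>i. i \<in> I \<Longrightarrow> tendsto_in_probability M (Y i) (y i)"
    and "\<And>i m. i \<in> I \<Longrightarrow> Y i m \<in> borel_measurable M"
  shows "tendsto_in_probability M (\<lambda>m w. \<Sum>i\<in>I. Y i m w) (\<Sum>i\<in>I. y i)"
  using assms
proof (induction I rule: finite_induct)
  case empty
  then show ?case by (simp add: tendsto_in_probability_def)
next
  case (insert i I)
  then show ?case by (auto intro!: tendsto_in_probability_add borel_measurable_sum)
qed

lemma tendsto_in_probability_vec:
  fixes Y :: "nat \<Rightarrow> 'a \<Rightarrow> real ^ 'n"
  assumes Y: "\<And>a. tendsto_in_probability M (\<lambda>m w. Y m w $ a) (y $ a)"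
    and m: "\<And>m. Y m \<in> borel_measurable M"
  shows "tendsto_in_probability M Y y"
proof -
  have c: "(\<lambda>w. Y m w $ a) \<in> borel_measurable M" for m a
    using m[of m] by (rule measurable_compose) (intro borel_measurable_continuous_onI continuous_intros)
  have abs: "tendsto_in_probability M (\<lambda>m w. \<bar>Y m w $ a - y $ a\<bar>) 0" for a
    using tendsto_in_probability_isCont[OF Y[of a], where g = "\<lambda>x. \<bar>x - y $ a\<bar>"] c by (auto intro!: continuous_intros)
  have s: "tendsto_in_probability M (\<lambda>m w. \<Sum>a\<in>UNIV. \<bar>Y m w $ a - y $ a\<bar>) (\<Sum>a\<in>(UNIV::'n set). 0)"
    by (rule tendsto_in_probability_sum) (use abs c in \<open>auto intro!: borel_measurable_abs borel_measurable_diff\<close>)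
  show ?thesis
  proof (rule tendsto_in_probabilityI)
    fix \<epsilon> \<eta> :: real assume e: "0 < \<epsilon>" "0 < \<eta>"
    from tendsto_in_probabilityD[OF s this]
    show "\<forall>\<^sub>F m in sequentially. prob {w \<in> space M. dist (Y m w) y > \<epsilon>} < \<eta>"
    proof eventually_elim
      case (elim m)
      have "dist (Y m w) y \<le> dist (\<Sum>a\<in>UNIV. \<bar>Y m w $ a - y $ a\<bar>) (\<Sum>a\<in>(UNIV::'n set). 0)" for w
        using norm_le_l1_cart[of "Y m w - y"] by (simp add: dist_norm sum_nonneg)
      then have "prob {w \<in> space M. dist (Y m w) y > \<epsilon>} \<le>
        prob {w \<in> space M. dist (\<Sum>a\<in>UNIV. \<bar>Y m w $ a - y $ a\<bar>) (\<Sum>a\<in>(UNIV::'n set). 0) > \<epsilon>}"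
        using c by (intro finite_measure_mono) (auto intro: less_le_trans)
      then show ?case using elim by simp
    qed
  qed
qed

lemma bounded_in_probability_second_moment:
  fixes Y :: "nat \<Rightarrow> 'a \<Rightarrow> real"
  assumes m: "\<And>m. Y m \<in> borel_measurable M" "\<And>m. integrable M (\<lambda>w. (Y m w)\<^sup>2)"
    and C: "\<forall>\<^sub>F m in sequentially. expectation (\<lambda>w. (Y m w)\<^sup>2) \<le> C"
  shows "bounded_in_probability M Y"
  unfolding bounded_in_probability_def
proof (intro allI impI)
  fix \<eta> :: real assume \<eta>: "0 < \<eta>"
  define K where "K = sqrt ((\<bar>C\<bar> + 1) / \<eta>)"
  have K: "K > 0" "K\<^sup>2 = (\<bar>C\<bar> + 1) / \<eta>" using \<eta> by (auto simp: K_def add_nonneg_pos)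
  from C have "\<forall>\<^sub>F m in sequentially. prob {w \<in> space M. norm (Y m w) > K} < \<eta>"
  proof eventually_elim
    case (elim m)
    have "prob {w \<in> space M. norm (Y m w) > K} \<le> prob {w \<in> space M. \<bar>Y m w\<bar> \<ge> K}"
      using m by (intro finite_measure_mono) auto
    also have "\<dots> \<le> expectation (\<lambda>w. (Y m w)\<^sup>2) / K\<^sup>2"
      by (intro second_moment_method m K)
    also have "\<dots> \<le> C / K\<^sup>2" using elim by (intro divide_right_mono) auto
    also have "C / K\<^sup>2 = (C / (\<bar>C\<bar> + 1)) * \<eta>" by (simp add: K(2))
    also have "\<dots> < 1 * \<eta>" using \<eta> by (intro mult_strict_right_mono) (auto simp: divide_less_eq)
    finally have "prob {w \<in> space M. norm (Y m w) > K} < \<eta>" by simp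
    then show ?case .
  qed
  then show "\<exists>K. \<forall>\<^sub>F m in sequentially. prob {w \<in> space M. norm (Y m w) > K} < \<eta>" by blast
qed

lemma tendsto_0_in_probability_second_moment:
  fixes Y :: "nat \<Rightarrow> 'a \<Rightarrow> real"
  assumes m: "\<And>m. Y m \<in> borel_measurable M" "\<And>m. integrable M (\<lambda>w. (Y m w)\<^sup>2)"
    and lim: "(\<lambda>m. expectation (\<lambda>w. (Y m w)\<^sup>2)) \<longlonglongrightarrow> 0"
  shows "tendsto_in_probability M Y 0"
  unfolding tendsto_in_probability_def
proof (intro allI impI)
  fix \<epsilon> :: real assume \<epsilon>: "0 < \<epsilon>"
  have bound: "norm (prob {w \<in> space M. dist (Y k w) 0 > \<epsilon>}) \<le> expectation (\<lambda>w. (Y k w)\<^sup>2) / \<epsilon>\<^sup>2" for k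
  proof -
    have "prob {w \<in> space M. dist (Y k w) 0 > \<epsilon>} \<le> prob {w \<in> space M. \<bar>Y k w\<bar> \<ge> \<epsilon>}"
      using m by (intro finite_measure_mono) auto
    also have "\<dots> \<le> expectation (\<lambda>w. (Y k w)\<^sup>2) / \<epsilon>\<^sup>2"
      by (intro second_moment_method m \<epsilon>)
    finally show ?thesis by simp
  qed
  have "(\<lambda>m. expectation (\<lambda>w. (Y m w)\<^sup>2) / \<epsilon>\<^sup>2) \<longlonglongrightarrow> 0 / \<epsilon>\<^sup>2"
    using \<epsilon> by (intro tendsto_intros lim) auto
  then have "(\<lambda>m. expectation (\<lambda>w. (Y m w)\<^sup>2) / \<epsilon>\<^sup>2) \<longlonglongrightarrow> 0" by simp
  with always_eventually[OF allI[OF bound]]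
  show "(\<lambda>m. prob {w \<in> space M. dist (Y m w) 0 > \<epsilon>}) \<longlonglongrightarrow> 0"
    by (rule Lim_null_comparison)
qed

lemma tendsto_0_in_probability_mult_bounded:
  fixes A Z :: "nat \<Rightarrow> 'a \<Rightarrow> real" and V :: "nat \<Rightarrow> 'a \<Rightarrow> 'b::{real_normed_vector, second_countable_topology}"
  assumes A: "tendsto_in_probability M A 0" and V: "bounded_in_probability M V"
    and Z: "\<And>m w. \<bar>Z m w\<bar> \<le> \<bar>A m w\<bar> * norm (V m w) ^ k"
    and m: "\<And>m. A m \<in> borel_measurable M" "\<And>m. V m \<in> borel_measurable M"
  shows "tendsto_in_probability M Z 0"
proof (rule tendsto_in_probabilityI)
  fix \<epsilon> \<eta> :: real assume e: "0 < \<epsilon>" "0 < \<eta>"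
  obtain K0 where K0: "\<forall>\<^sub>F m in sequentially. prob {w \<in> space M. norm (V m w) > K0} < \<eta> / 2"
    using bounded_in_probabilityD[OF V half_gt_zero[OF e(2)]] .
  define K where "K = max K0 1"
  have K: "K > 0" "K0 \<le> K" by (auto simp: K_def)
  have "\<forall>\<^sub>F m in sequentially. prob {w \<in> space M. dist (A m w) 0 > \<epsilon> / K ^ k} < \<eta> / 2"
    using e K by (intro tendsto_in_probabilityD[OF A]) auto
  with K0 show "\<forall>\<^sub>F m in sequentially. prob {w \<in> space M. dist (Z m w) 0 > \<epsilon>} < \<eta>"
  proof eventually_elim
    case (elim m)
    have "{w \<in> space M. dist (Z m w) 0 > \<epsilon>} \<subseteq>
      {w \<in> space M. norm (V m w) > K0} \<union> {w \<in> space M. dist (A m w) 0 > \<epsilon> / K ^ k}"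
    proof (intro subsetI, rule ccontr)
      fix w assume w: "w \<in> {w \<in> space M. dist (Z m w) 0 > \<epsilon>}"
        "w \<notin> {w \<in> space M. norm (V m w) > K0} \<union> {w \<in> space M. dist (A m w) 0 > \<epsilon> / K ^ k}"
      then have "\<bar>A m w\<bar> \<le> \<epsilon> / K ^ k" "norm (V m w) \<le> K" using K by auto
      then have "\<bar>A m w\<bar> * norm (V m w) ^ k \<le> \<epsilon> / K ^ k * K ^ k"
        using K e by (intro mult_mono power_mono) auto
      then show False using Z[of m w] w K by auto
    qed
    then show ?case by (rule prob_less_Un) (use m elim in auto)
  qed
qed

lemma bounded_in_probability_add_tendsto_0:
  fixes U V :: "nat \<Rightarrow> 'a \<Rightarrow> real"
  assumes U: "bounded_in_probability M U" and d: "tendsto_in_probability M (\<lambda>m w. V m w - U m w) 0"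
    and m: "\<And>m. U m \<in> borel_measurable M" "\<And>m. V m \<in> borel_measurable M"
  shows "bounded_in_probability M V"
  unfolding bounded_in_probability_def
proof (intro allI impI)
  fix \<eta> :: real assume \<eta>: "0 < \<eta>"
  obtain K where K: "\<forall>\<^sub>F m in sequentially. prob {w \<in> space M. norm (U m w) > K} < \<eta> / 2"
    using bounded_in_probabilityD[OF U half_gt_zero[OF \<eta>]] .
  have "\<forall>\<^sub>F m in sequentially. prob {w \<in> space M. dist (V m w - U m w) 0 > 1} < \<eta> / 2"
    using \<eta> by (intro tendsto_in_probabilityD[OF d]) auto
  with K have "\<forall>\<^sub>F m in sequentially. prob {w \<in> space M. norm (V m w) > K + 1} < \<eta>"
  proof eventually_elim
    case (elim m)
    have "{w \<in> space M. norm (V m w) > K + 1} \<subseteq>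
       {w \<in> space M. norm (U m w) > K} \<union> {w \<in> space M. dist (V m w - U m w) 0 > 1}" by auto
    then show ?case by (rule prob_less_Un) (use m elim in auto)
  qed
  then show "\<exists>K. \<forall>\<^sub>F m in sequentially. prob {w \<in> space M. norm (V m w) > K} < \<eta>" by blast
qed

lemma bounded_in_probability_vec:
  fixes V :: "nat \<Rightarrow> 'a \<Rightarrow> real ^ 'n"
  assumes V: "\<And>a. bounded_in_probability M (\<lambda>m w. V m w $ a)"
    and m: "\<And>m a. (\<lambda>w. V m w $ a) \<in> borel_measurable M"
  shows "bounded_in_probability M V"
  unfolding bounded_in_probability_def
proof (intro allI impI)
  fix \<eta> :: real assume \<eta>: "0 < \<eta>"
  define c where "c = real CARD('n)"
  have c: "c > 0" by (simp add: c_def)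
  have "\<exists>K. \<forall>\<^sub>F m in sequentially. prob {w \<in> space M. norm (V m w $ a) > K} < \<eta> / c" for a
    using V[of a] \<eta> c unfolding bounded_in_probability_def by simp
  then have "\<forall>a. \<exists>K. \<forall>\<^sub>F m in sequentially. prob {w \<in> space M. norm (V m w $ a) > K} < \<eta> / c" ..
  from choice[OF this] obtain K
    where K: "\<And>a. \<forall>\<^sub>F m in sequentially. prob {w \<in> space M. norm (V m w $ a) > K a} < \<eta> / c"
    by blast
  have "\<forall>\<^sub>F m in sequentially. \<forall>a\<in>UNIV. prob {w \<in> space M. norm (V m w $ a) > K a} < \<eta> / c"
    by (intro eventually_ball_finite) (use K in auto)
  then have "\<forall>\<^sub>F m in sequentially. prob {w \<in> space M. norm (V m w) > (\<Sum>a\<in>UNIV. K a)} < \<eta>"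
  proof eventually_elim
    case (elim m)
    have "\<exists>a. \<bar>V m w $ a\<bar> > K a" if "norm (V m w) > (\<Sum>a\<in>UNIV. K a)" for w
    proof (rule ccontr)
      assume "\<not> ?thesis"
      then have "(\<Sum>a\<in>UNIV. \<bar>V m w $ a\<bar>) \<le> (\<Sum>a\<in>UNIV. K a)" by (intro sum_mono) (auto simp: not_less)
      then show False using norm_le_l1_cart[of "V m w"] that by simp
    qed
    then have "prob {w \<in> space M. norm (V m w) > (\<Sum>a\<in>UNIV. K a)} \<le>
        prob (\<Union>a. {w \<in> space M. norm (V m w $ a) > K a})"
      using m by (intro finite_measure_mono) auto
    also have "\<dots> \<le> (\<Sum>a\<in>UNIV. prob {w \<in> space M. norm (V m w $ a) > K a})"
      using m by (intro measure_UNION_le) auto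
    also have "\<dots> < (\<Sum>a\<in>(UNIV::'n set). \<eta> / c)" using elim by (intro sum_strict_mono) auto
    also have "\<dots> = \<eta>" using c by (simp add: c_def)
    finally show ?case .
  qed
  then show "\<exists>K. \<forall>\<^sub>F m in sequentially. prob {w \<in> space M. norm (V m w) > K} < \<eta>" by blast
qed

text \<open>\<open>t \<mapsto> exp (\<i> t)\<close> is bounded and Lipschitz, so two sequences that are close in probability have
  the same limiting characteristic function.\<close>

lemma slutsky_characteristic_function:
  fixes A B :: "nat \<Rightarrow> 'a \<Rightarrow> real"
  assumes d: "tendsto_in_probability M (\<lambda>m w. A m w - B m w) 0"
    and m[measurable]: "\<And>m. A m \<in> borel_measurable M" "\<And>m. B m \<in> borel_measurable M"
    and A: "(\<lambda>m. CLINT w|M. iexp (A m w)) \<longlonglongrightarrow> c"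
  shows "(\<lambda>m. CLINT w|M. iexp (B m w)) \<longlonglongrightarrow> c"
proof -
  have int: "integrable M (\<lambda>w. iexp (Y w))" if [measurable]: "Y \<in> borel_measurable M" for Y :: "'a \<Rightarrow> real"
    by (intro integrable_const_bound[where B=1]) auto
  have "(\<lambda>m. (CLINT w|M. iexp (B m w)) - (CLINT w|M. iexp (A m w))) \<longlonglongrightarrow> 0"
  proof (rule tendstoI)
    fix \<eta> :: real assume \<eta>: "0 < \<eta>"
    have "\<forall>\<^sub>F m in sequentially. prob {w \<in> space M. dist (A m w - B m w) 0 > \<eta> / 4} < \<eta> / 8"
      using \<eta> by (intro tendsto_in_probabilityD[OF d]) auto
    then show "\<forall>\<^sub>F m in sequentially. dist ((CLINT w|M. iexp (B m w)) - (CLINT w|M. iexp (A m w))) 0 < \<eta>"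
    proof eventually_elim
      case (elim m)
      define S where "S = {w \<in> space M. dist (A m w - B m w) 0 > \<eta> / 4}"
      have S[measurable]: "S \<in> events" unfolding S_def by measurable
      have bd: "norm (iexp (B m w) - iexp (A m w)) \<le> \<eta> / 4 + 2 * indicator S w" if "w \<in> space M" for w
      proof (cases "w \<in> S")
        case True
        have "norm (iexp (B m w) - iexp (A m w)) \<le> norm (iexp (B m w)) + norm (iexp (A m w))"
          by (rule norm_triangle_ineq4)
        then show ?thesis using True \<eta> by simp
      next
        case False
        have "iexp (B m w) - iexp (A m w) = iexp (A m w) * (iexp (B m w - A m w) - 1)"
          by (simp add: right_diff_distrib mult_exp_exp)
        then have "norm (iexp (B m w) - iexp (A m w)) = norm (iexp (B m w - A m w) - 1)"
          by (simp add: norm_mult)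
        also have "\<dots> \<le> \<bar>B m w - A m w\<bar>" using iexp_approx1[of "B m w - A m w" 0] by simp
        finally show ?thesis using False that by (auto simp: S_def abs_minus_commute)
      qed
      have "norm ((CLINT w|M. iexp (B m w)) - (CLINT w|M. iexp (A m w))) =
          norm (CLINT w|M. iexp (B m w) - iexp (A m w))"
        by (subst Bochner_Integration.integral_diff) (auto intro: int)
      also have "\<dots> \<le> (LINT w|M. norm (iexp (B m w) - iexp (A m w)))" by (rule integral_norm_bound)
      also have "\<dots> \<le> (LINT w|M. \<eta> / 4 + 2 * indicator S w)"
      proof (rule integral_mono)
        show "integrable M (\<lambda>w. \<eta> / 4 + 2 * indicator S w)"
          by (intro integrable_const_bound[where B="\<eta> / 4 + 2"]) (use \<eta> in \<open>auto split: split_indicator\<close>)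
      qed (auto intro!: int bd Bochner_Integration.integrable_diff integrable_norm)
      also have "\<dots> = \<eta> / 4 + 2 * prob S"
        by (subst Bochner_Integration.integral_add) (simp_all add: prob_space S less_top[symmetric])
      also have "\<dots> < \<eta>" using elim \<eta> unfolding S_def by simp
      finally show ?case by simp
    qed
  qed
  from tendsto_add[OF this A] show ?thesis by simp
qed

lemma slutsky_weak_conv:
  fixes A B :: "nat \<Rightarrow> 'a \<Rightarrow> real"
  assumes d: "tendsto_in_probability M (\<lambda>m w. A m w - B m w) 0"
    and m[measurable]: "\<And>m. A m \<in> borel_measurable M" "\<And>m. B m \<in> borel_measurable M"
    and \<mu>: "real_distribution \<mu>" and A: "weak_conv_m (\<lambda>m. distr M borel (A m)) \<mu>"
  shows "weak_conv_m (\<lambda>m. distr M borel (B m)) \<mu>"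
proof (rule levy_continuity[OF _ \<mu>])
  fix t :: real
  show "real_distribution (distr M borel (B m))" for m by simp
  have "(\<lambda>m. char (distr M borel (A m)) t) \<longlonglongrightarrow> char \<mu> t"
    by (intro levy_continuity1[OF _ \<mu> A]) simp
  then have *: "(\<lambda>m. CLINT w|M. iexp (t * A m w)) \<longlonglongrightarrow> char \<mu> t"
    by (simp add: char_def integral_distr)
  have "tendsto_in_probability M (\<lambda>m w. t * A m w - t * B m w) 0"
    using tendsto_in_probability_isCont[OF d, of "\<lambda>x. t * x"]
    by (auto simp: right_diff_distrib intro!: continuous_intros)
  then have "(\<lambda>m. CLINT w|M. iexp (t * B m w)) \<longlonglongrightarrow> char \<mu> t"
    by (rule slutsky_characteristic_function) (use * in \<open>simp_all\<close>)
  then show "(\<lambda>m. char (distr M borel (B m)) t) \<longlonglongrightarrow> char \<mu> t"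
    by (simp add: char_def integral_distr)
qed

text \<open>An argument of Ghosh. If at every fixed level \<open>y\<close> the events \<open>V \<le> y\<close> and \<open>U \<le> y\<close> agree up to a
  vanishing perturbation of the level, then \<open>V\<close> and \<open>U\<close> are close: as \<open>U\<close> is tight, finitely many
  levels on a grid of mesh \<open>\<delta>\<close> suffice to trap \<open>V\<close> within \<open>3 \<delta>\<close> of \<open>U\<close>.\<close>

lemma difference_tendsto_0_if_same_level_sets:
  fixes U V :: "nat \<Rightarrow> 'a \<Rightarrow> real" and R :: "real \<Rightarrow> nat \<Rightarrow> 'a \<Rightarrow> real"
  assumes U: "bounded_in_probability M U" and R: "\<And>y. tendsto_in_probability M (R y) 0"
    and eq: "\<And>y. \<forall>\<^sub>F m in sequentially. \<forall>w\<in>space M. V m w \<le> y \<longleftrightarrow> U m w \<le> y + R y m w"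
    and m[measurable]: "\<And>m. U m \<in> borel_measurable M" "\<And>y m. R y m \<in> borel_measurable M"
  shows "tendsto_in_probability M (\<lambda>m w. V m w - U m w) 0"
proof (rule tendsto_in_probabilityI)
  fix \<epsilon> \<eta> :: real assume e: "0 < \<epsilon>" "0 < \<eta>"
  define \<delta> where "\<delta> = \<epsilon> / 3"
  have \<delta>: "\<delta> > 0" using e by (simp add: \<delta>_def)
  obtain K where K: "\<forall>\<^sub>F m in sequentially. prob {w \<in> space M. norm (U m w) > K} < \<eta> / 2"
    using bounded_in_probabilityD[OF U half_gt_zero[OF e(2)]] .
  \<comment> \<open>The levels within two grid steps of the interval from \<open>- K\<close> to \<open>K\<close>.\<close>
  define J where "J = {\<lfloor>- K / \<delta>\<rfloor> - 2 .. \<lfloor>K / \<delta>\<rfloor> + 2}"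
  define Bad where "Bad k m = {w \<in> space M. dist (R (\<delta> * of_int k) m w) 0 > \<delta>}" for k :: int and m
  have Bad[measurable]: "Bad k m \<in> events" for k m unfolding Bad_def by measurable
  have "(\<lambda>m. \<Sum>k\<in>J. prob (Bad k m)) \<longlonglongrightarrow> (\<Sum>k\<in>J. 0)"
    using R \<delta> unfolding Bad_def tendsto_in_probability_def by (intro tendsto_sum) auto
  then have "\<forall>\<^sub>F m in sequentially. (\<Sum>k\<in>J. prob (Bad k m)) < \<eta> / 2"
    using e by (intro order_tendstoD) auto
  moreover have "\<forall>\<^sub>F m in sequentially. \<forall>k\<in>J. \<forall>w\<in>space M.
      V m w \<le> \<delta> * of_int k \<longleftrightarrow> U m w \<le> \<delta> * of_int k + R (\<delta> * of_int k) m w"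
    using eq by (intro eventually_ball_finite) (auto simp: J_def)
  ultimately show "\<forall>\<^sub>F m in sequentially. prob {w \<in> space M. dist (V m w - U m w) 0 > \<epsilon>} < \<eta>"
    using K
  proof eventually_elim
    case (elim m)
    have sub: "{w \<in> space M. dist (V m w - U m w) 0 > \<epsilon>} \<subseteq>
       {w \<in> space M. norm (U m w) > K} \<union> (\<Union>k\<in>J. Bad k m)"
    proof (intro subsetI, rule ccontr)
      fix w assume w: "w \<in> {w \<in> space M. dist (V m w - U m w) 0 > \<epsilon>}"
        "w \<notin> {w \<in> space M. norm (U m w) > K} \<union> (\<Union>k\<in>J. Bad k m)"
      define u where "u = U m w"
      define k where "k = \<lfloor>u / \<delta>\<rfloor>"
      have uK: "\<bar>u\<bar> \<le> K" using w by (auto simp: u_def)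
      have "- K / \<delta> \<le> u / \<delta>" "u / \<delta> \<le> K / \<delta>"
        using uK \<delta> by (intro divide_right_mono; simp)+
      then have "\<lfloor>- K / \<delta>\<rfloor> \<le> k" "k \<le> \<lfloor>K / \<delta>\<rfloor>"
        unfolding k_def by (simp_all only: floor_mono)
      then have kJ: "k + 2 \<in> J" "k - 2 \<in> J"
        unfolding J_def by auto
      have ku: "\<delta> * of_int k \<le> u" "u \<le> \<delta> * of_int k + \<delta>"
      proof -
        have "of_int k \<le> u / \<delta>" "u / \<delta> \<le> of_int k + 1" unfolding k_def by linarith+
        then show "\<delta> * of_int k \<le> u" "u \<le> \<delta> * of_int k + \<delta>" using \<delta> by (auto simp: field_simps)
      qed
      have Rk: "\<bar>R (\<delta> * of_int (k + 2)) m w\<bar> \<le> \<delta>" "\<bar>R (\<delta> * of_int (k - 2)) m w\<bar> \<le> \<delta>"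
        using w kJ unfolding Bad_def by auto
      have up: "V m w \<le> \<delta> * of_int (k + 2)"
        using elim(2) kJ(1) w Rk(1) ku \<delta> by (auto simp: u_def[symmetric] algebra_simps)
      have lo: "\<not> V m w \<le> \<delta> * of_int (k - 2)"
        using elim(2) kJ(2) w Rk(2) ku \<delta> by (auto simp: u_def[symmetric] algebra_simps)
      have "\<bar>V m w - u\<bar> \<le> 3 * \<delta>" using up lo ku \<delta> by (auto simp: algebra_simps abs_le_iff)
      then show False using w by (simp add: \<delta>_def u_def)
    qed
    have "prob (\<Union>k\<in>J. Bad k m) \<le> (\<Sum>k\<in>J. prob (Bad k m))"
      by (intro measure_UNION_le) (auto simp: J_def)
    then have "prob (\<Union>k\<in>J. Bad k m) < \<eta> / 2" using elim(1) by simp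
    then show ?case using elim(3) by (intro prob_less_Un[OF sub]) (auto simp: J_def)
  qed
qed

end

section \<open>Laplace transforms and weak convergence of quadratic forms\<close>

text \<open>Polynomials in \<open>exp (- x)\<close> are dense among the continuous functions of \<open>exp (- x) \<in> {0..1}\<close>, so
  the values of the Laplace transforms at the natural numbers determine the weak limit on the half-line.
  The test functions \<open>cts_step a b\<close> vanish for large arguments, hence extend continuously to
  \<open>exp (- x) = 0\<close>.\<close>

theorem laplace_transform_weak_conv:
  fixes \<mu> :: "nat \<Rightarrow> real measure" and \<nu> :: "real measure"
  assumes \<mu>: "\<And>m. real_distribution (\<mu> m)" "\<And>m. AE x in \<mu> m. 0 \<le> x"
    and \<nu>: "real_distribution \<nu>" "AE x in \<nu>. 0 \<le> x"
    and conv: "\<And>k::nat. (\<lambda>m. LINT x|\<mu> m. exp (- (real k * x))) \<longlonglongrightarrow> (LINT x|\<nu>. exp (- (real k * x)))"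
  shows "weak_conv_m \<mu> \<nu>"
proof (rule integral_cts_step_conv_imp_weak_conv)
  show "real_distribution (\<mu> m)" "real_distribution \<nu>" for m by fact+
  fix a b :: real assume ab: "a < b"
  \<comment> \<open>Truncating at \<open>exp (- b)\<close> changes nothing, as the step vanishes beyond \<open>b\<close>.\<close>
  define g where "g w = cts_step a b (- ln (max w (exp (- b))))" for w
  have g_exp: "cts_step a b x = g (exp (- x))" for x
    using ab by (auto simp: g_def max_def cts_step_def)
  have cs: "continuous_on UNIV (cts_step a b)"
    using cts_step_uniformly_continuous[OF ab] by (rule uniformly_continuous_imp_continuous)
  have "continuous_on {0..1} (\<lambda>w. - ln (max w (exp (- b))))"
    by (intro continuous_intros) (auto simp: max_def)
  then have g: "continuous_on {0..1} g"
    unfolding g_def[abs_def] by (rule continuous_on_compose2[OF cs]) auto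
  show "(\<lambda>m. integral\<^sup>L (\<mu> m) (cts_step a b)) \<longlonglongrightarrow> integral\<^sup>L \<nu> (cts_step a b)"
  proof (rule tendstoI)
    fix e :: real assume e: "0 < e"
    obtain h where h: "real_polynomial_function h" "\<And>x. x \<in> {0..1} \<Longrightarrow> \<bar>g x - h x\<bar> < e / 3"
      using Stone_Weierstrass_real_polynomial_function[OF _ g, of "e / 3"] e by auto
    then obtain c N where hc: "h = (\<lambda>x. \<Sum>i\<le>N. c i * x ^ i)"
      unfolding real_polynomial_function_iff_sum by blast
    define H where "H x = (\<Sum>i\<le>N. c i * exp (- (real i * x)))" for x
    have H_h: "H x = h (exp (- x))" for x
      by (simp add: H_def hc flip: exp_of_nat_mult)
    have int_exp: "integrable \<rho> (\<lambda>x. exp (- (real i * x)))"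
      if "real_distribution \<rho>" "AE x in \<rho>. 0 \<le> x" for \<rho> i
    proof -
      interpret real_distribution \<rho> by fact
      show ?thesis using that(2)
        by (intro integrable_const_bound[where B=1]) (auto elim!: eventually_mono)
    qed
    have int_H: "integrable \<rho> H" "integral\<^sup>L \<rho> H = (\<Sum>i\<le>N. c i * (LINT x|\<rho>. exp (- (real i * x))))"
      if "real_distribution \<rho>" "AE x in \<rho>. 0 \<le> x" for \<rho>
      unfolding H_def using int_exp[OF that] by simp_all
    have near: "\<bar>integral\<^sup>L \<rho> (cts_step a b) - integral\<^sup>L \<rho> H\<bar> \<le> e / 3"
      if \<rho>: "real_distribution \<rho>" "AE x in \<rho>. 0 \<le> x" for \<rho>
    proof -
      interpret real_distribution \<rho> by fact
      have "integral\<^sup>L \<rho> (cts_step a b) - integral\<^sup>L \<rho> H = (LINT x|\<rho>. cts_step a b x - H x)"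
        using integrable_cts_step[OF ab] int_H(1)[OF \<rho>] by simp
      also have "\<bar>\<dots>\<bar> \<le> (LINT x|\<rho>. \<bar>cts_step a b x - H x\<bar>)"
        using integral_abs_bound[of \<rho> "\<lambda>x. cts_step a b x - H x"] by simp
      also have "\<dots> \<le> (LINT x|\<rho>. e / 3)"
      proof (rule integral_mono_AE)
        show "AE x in \<rho>. \<bar>cts_step a b x - H x\<bar> \<le> e / 3"
          using \<rho>(2)
        proof eventually_elim
          case (elim x)
          then show ?case using h(2)[of "exp (- x)"] by (simp add: g_exp H_h)
        qed
      qed (use integrable_cts_step[OF ab] int_H(1)[OF \<rho>] in auto)
      also have "\<dots> = e / 3" using prob_space by simp
      finally show ?thesis .
    qed
    have "(\<lambda>m. integral\<^sup>L (\<mu> m) H) \<longlonglongrightarrow> integral\<^sup>L \<nu> H"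
      unfolding int_H(2)[OF \<mu>] int_H(2)[OF \<nu>] by (intro tendsto_intros conv)
    then have "\<forall>\<^sub>F m in sequentially. dist (integral\<^sup>L (\<mu> m) H) (integral\<^sup>L \<nu> H) < e / 3"
      using e by (intro tendstoD) auto
    then show "\<forall>\<^sub>F m in sequentially. dist (integral\<^sup>L (\<mu> m) (cts_step a b)) (integral\<^sup>L \<nu> (cts_step a b)) < e"
    proof eventually_elim
      case (elim m)
      show ?case using elim near[OF \<mu>, of m] near[OF \<nu>] unfolding dist_real_def by linarith
    qed
  qed
qed

abbreviation gaussian :: "('n \<Rightarrow> real) measure" where
  "gaussian \<equiv> (\<Pi>\<^sub>M a\<in>UNIV. std_normal_distribution)"

lemma prob_space_std_normal: "prob_space std_normal_distribution"
  using real_dist_normal_dist real_distribution_def by blast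

lemma product_prob_space_gaussian: "product_prob_space (\<lambda>_. std_normal_distribution)"
  by (intro product_prob_spaceI prob_space_std_normal)

lemma prob_space_gaussian: "prob_space gaussian"
  by (intro prob_space_PiM prob_space_std_normal)

lemma gaussian_characteristic_function:
  "(CLINT \<xi>|(gaussian :: ('n::finite \<Rightarrow> real) measure). iexp (\<Sum>a\<in>UNIV. b a * \<xi> a)) = exp (- (\<Sum>a\<in>UNIV. (b a)\<^sup>2) / 2)"
proof -
  interpret product_prob_space "\<lambda>_::'n. std_normal_distribution" by (rule product_prob_space_gaussian)
  have "(CLINT \<xi>|(gaussian :: ('n \<Rightarrow> real) measure). iexp (\<Sum>a\<in>UNIV. b a * \<xi> a))
      = (CLINT \<xi>|(gaussian :: ('n \<Rightarrow> real) measure). (\<Prod>a\<in>UNIV. iexp (b a * \<xi> a)))"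
    by (simp add: exp_sum sum_distrib_left)
  also have "\<dots> = (\<Prod>a\<in>UNIV. CLINT x|std_normal_distribution. iexp (b a * x))"
    by (intro product_integral_prod prob_space.integrable_iexp[OF prob_space_std_normal]) auto
  also have "\<dots> = (\<Prod>a\<in>UNIV. complex_of_real (exp (- (b a)\<^sup>2 / 2)))"
    using char_std_normal_distribution by (simp add: char_def fun_eq_iff)
  also have "\<dots> = of_real (\<Prod>a\<in>UNIV. exp (- (b a)\<^sup>2 / 2))" by simp
  also have "(\<Prod>a\<in>UNIV. exp (- (b a)\<^sup>2 / 2)) = exp (- (\<Sum>a\<in>UNIV. (b a)\<^sup>2) / 2)"
    by (simp add: exp_sum[symmetric] sum_divide_distrib sum_negf)
  finally show ?thesis .
qed

lemma prob_space_chi_square_1: "prob_space chi_square_1"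
  unfolding chi_square_1_def by (intro prob_space.prob_space_distr prob_space_std_normal) simp

lemma real_distribution_weighted_chi_square: "real_distribution (weighted_chi_square (c :: 'n::finite \<Rightarrow> real))"
proof -
  interpret prob_space "\<Pi>\<^sub>M a\<in>(UNIV::'n set). chi_square_1"
    by (intro prob_space_PiM prob_space_chi_square_1)
  have "(\<lambda>b. \<Sum>a\<in>UNIV. c a * b a) \<in> borel_measurable (\<Pi>\<^sub>M a\<in>UNIV. chi_square_1)"
    by (intro borel_measurable_sum borel_measurable_times) (auto simp: chi_square_1_def)
  then show ?thesis
    unfolding weighted_chi_square_def by (rule real_distribution_distr)
qed

lemma AE_chi_square_1_nonneg: "AE x in chi_square_1. 0 \<le> x"
  unfolding chi_square_1_def by (subst AE_distr_iff) auto

lemma AE_weighted_chi_square_nonneg: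
  fixes c :: "'n::finite \<Rightarrow> real"
  assumes c: "\<And>a. 0 \<le> c a"
  shows "AE x in weighted_chi_square c. 0 \<le> x"
proof -
  have m: "(\<lambda>b. \<Sum>a\<in>UNIV. c a * b a) \<in> borel_measurable (\<Pi>\<^sub>M a\<in>UNIV. chi_square_1)"
    by (intro borel_measurable_sum borel_measurable_times) (auto simp: chi_square_1_def)
  have "AE b in (\<Pi>\<^sub>M a\<in>(UNIV::'n set). chi_square_1). \<forall>a\<in>UNIV. 0 \<le> b a"
    by (intro AE_finite_allI AE_PiM_component prob_space_chi_square_1 AE_chi_square_1_nonneg) auto
  then have "AE b in (\<Pi>\<^sub>M a\<in>(UNIV::'n set). chi_square_1). 0 \<le> (\<Sum>a\<in>UNIV. c a * b a)"
    by eventually_elim (auto intro!: sum_nonneg mult_nonneg_nonneg c)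
  then show ?thesis unfolding weighted_chi_square_def using m by (subst AE_distr_iff) auto
qed

text \<open>Both sides are the same product of one-dimensional integrals.\<close>

lemma weighted_chi_square_laplace:
  fixes c :: "'n::finite \<Rightarrow> real"
  assumes c: "\<And>a. 0 \<le> c a" and s: "0 \<le> s"
  shows "(LINT x|weighted_chi_square c. exp (- (s * x))) =
    (LINT \<xi>|gaussian. exp (- (s * (\<Sum>a\<in>UNIV. c a * (\<xi> a)\<^sup>2))))"
proof -
  interpret C: product_prob_space "\<lambda>_::'n. chi_square_1"
    by (intro product_prob_spaceI prob_space_chi_square_1)
  interpret G: product_prob_space "\<lambda>_::'n. std_normal_distribution" by (rule product_prob_space_gaussian)
  note bounded_chi = finite_measure.integrable_const_bound[OF prob_space.finite_measure[OF prob_space_chi_square_1]]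
  note bounded_normal = finite_measure.integrable_const_bound[OF prob_space.finite_measure[OF prob_space_std_normal]]
  have m: "(\<lambda>b. \<Sum>a\<in>UNIV. c a * b a) \<in> borel_measurable (\<Pi>\<^sub>M a\<in>UNIV. chi_square_1)"
    by (intro borel_measurable_sum borel_measurable_times) (auto simp: chi_square_1_def)
  have "integrable chi_square_1 (\<lambda>x. exp (- (s * c a * x)))" for a
  proof (intro bounded_chi[where B=1])
    show "AE x in chi_square_1. norm (exp (- (s * c a * x))) \<le> 1"
      using AE_chi_square_1_nonneg by eventually_elim (simp add: s c)
  qed (simp add: chi_square_1_def)
  moreover have "integrable std_normal_distribution (\<lambda>x. exp (- (s * c a * x\<^sup>2)))" for a
    by (intro bounded_normal[where B=1]) (auto simp: s c)
  moreover have "(LINT x|chi_square_1. exp (- (s * c a * x))) = (LINT x|std_normal_distribution. exp (- (s * c a * x\<^sup>2)))" for a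
    unfolding chi_square_1_def by (subst integral_distr) auto
  ultimately have "(LINT b|(\<Pi>\<^sub>M a\<in>UNIV. chi_square_1). (\<Prod>a\<in>UNIV. exp (- (s * c a * b a)))) =
      (LINT \<xi>|gaussian. (\<Prod>a\<in>UNIV. exp (- (s * c a * (\<xi> a)\<^sup>2))))"
    by (subst C.product_integral_prod, simp, simp, subst G.product_integral_prod) simp_all
  moreover have "(LINT x|weighted_chi_square c. exp (- (s * x))) =
      (LINT b|(\<Pi>\<^sub>M a\<in>UNIV. chi_square_1). exp (- (s * (\<Sum>a\<in>UNIV. c a * b a))))"
    unfolding weighted_chi_square_def by (rule integral_distr[OF m]) simp
  ultimately show ?thesis
    by (simp add: exp_sum[symmetric] sum_distrib_left sum_negf mult.assoc)
qed

lemma borel_measurable_matrix_vector_component: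
  fixes L :: "real ^ 'n ^ 'm"
  assumes "V \<in> borel_measurable M"
  shows "(\<lambda>w. (L *v V w) $ a) \<in> borel_measurable M"
  using assms by (rule measurable_compose) (intro borel_measurable_continuous_onI continuous_intros)

lemma inner_transpose_vector_sum:
  fixes L :: "real ^ 'n ^ 'm"
  shows "(c *\<^sub>R (transpose L *v (\<chi> a. \<xi> a))) \<bullet> v = (\<Sum>a\<in>UNIV. (c * (L *v v) $ a) * \<xi> a)"
proof -
  have "(transpose L *v (\<chi> a. \<xi> a)) \<bullet> v = (\<chi> a. \<xi> a) \<bullet> (L *v v)"
    by (metis dot_lmul_matrix transpose_matrix_vector)
  then show ?thesis
    unfolding inner_scaleR_left by (simp only:) (simp add: inner_vec_def sum_distrib_left mult_ac)
qed

context prob_space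
begin

lemma borel_measurable_gaussian_pair:
  fixes L :: "real ^ 'n ^ 'm"
  assumes V: "V \<in> borel_measurable M"
  shows "(\<lambda>(w, \<xi>). iexp ((c *\<^sub>R (transpose L *v (\<chi> a. \<xi> a))) \<bullet> V w)) \<in> borel_measurable (M \<Otimes>\<^sub>M gaussian)"
proof -
  have [measurable]: "(\<lambda>w. (L *v V w) $ a) \<in> borel_measurable M" for a
    by (rule borel_measurable_matrix_vector_component[OF V])
  have [measurable]: "(\<lambda>\<xi>. \<xi> a) \<in> borel_measurable (gaussian :: ('m \<Rightarrow> real) measure)" for a
    using measurable_component_singleton[of a UNIV "\<lambda>_. std_normal_distribution"] by simp
  show ?thesis unfolding inner_transpose_vector_sum by measurable
qed

text \<open>A Gaussian linearization of the square: averaging \<open>exp (\<i> \<surd>(2 s) (\<xi> \<bullet> y))\<close> over a standard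
  Gaussian vector \<open>\<xi>\<close> gives \<open>exp (- s |y|\<^sup>2)\<close>. So the Laplace transform of a quadratic form in \<open>V\<close> is
  a Gaussian mixture of values of the characteristic function of \<open>V\<close>.\<close>

lemma laplace_transform_gaussian_mixture:
  fixes V :: "'a \<Rightarrow> real ^ 'n" and L :: "real ^ 'n ^ 'm"
  assumes V: "V \<in> borel_measurable M" and s: "0 \<le> s"
  shows "complex_of_real (LINT w|M. exp (- (s * (norm (L *v V w))\<^sup>2))) =
    (CLINT \<xi>|gaussian. CLINT w|M. iexp ((sqrt (2 * s) *\<^sub>R (transpose L *v (\<chi> a. \<xi> a))) \<bullet> V w))"
proof -
  interpret G: prob_space "gaussian :: ('m \<Rightarrow> real) measure" by (rule prob_space_gaussian)
  interpret P: pair_prob_space M "gaussian :: ('m \<Rightarrow> real) measure" ..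
  define f where "f w \<xi> = iexp ((sqrt (2 * s) *\<^sub>R (transpose L *v (\<chi> a. \<xi> a))) \<bullet> V w)" for w \<xi>
  have f: "integrable (M \<Otimes>\<^sub>M gaussian) (\<lambda>(w, \<xi>). f w \<xi>)"
    unfolding f_def by (rule P.integrable_const_bound[where B=1]) (use borel_measurable_gaussian_pair[OF V] in auto)
  have "(CLINT \<xi>|gaussian. f w \<xi>) = exp (- (s * (norm (L *v V w))\<^sup>2))" for w
  proof -
    have "(\<Sum>a\<in>UNIV. (sqrt (2 * s) * (L *v V w) $ a)\<^sup>2) = 2 * (s * (norm (L *v V w))\<^sup>2)"
      using s by (simp add: norm_vec_def L2_set_def sum_nonneg power_mult_distrib sum_distrib_left mult.assoc)
    then show ?thesis
      unfolding f_def inner_transpose_vector_sum gaussian_characteristic_function by simp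
  qed
  then have "complex_of_real (LINT w|M. exp (- (s * (norm (L *v V w))\<^sup>2))) = (CLINT w|M. CLINT \<xi>|gaussian. f w \<xi>)"
    by simp
  also have "\<dots> = (CLINT \<xi>|gaussian. CLINT w|M. f w \<xi>)"
    using P.Fubini_integral[OF f] by simp
  finally show ?thesis unfolding f_def .
qed

text \<open>Pointwise convergence of multivariate characteristic functions to a Gaussian limit is passed to
  the quadratic form by dominated convergence under the Gaussian mixture, which makes weak convergence of
  random vectors dispensable. The limit is the Laplace transform of the weighted sum because
  \<open>L K L'\<close> is diagonal.\<close>

theorem quadratic_form_weak_conv:
  fixes V :: "nat \<Rightarrow> 'a \<Rightarrow> real ^ 'n" and K :: "real ^ 'n ^ 'n" and L :: "real ^ 'n ^ 'm"
  assumes V: "\<And>m. V m \<in> borel_measurable M"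
    and char: "\<And>t. (\<lambda>m. CLINT w|M. iexp (t \<bullet> V m w)) \<longlonglongrightarrow> exp (- (t \<bullet> (K *v t)) / 2)"
    and L: "L ** K ** transpose L = diag_mat lam" and lam: "\<And>a. 0 \<le> lam a"
  shows "weak_conv_m (\<lambda>m. distr M borel (\<lambda>w. (norm (L *v V m w))\<^sup>2)) (weighted_chi_square lam)"
proof (rule laplace_transform_weak_conv)
  interpret G: prob_space "gaussian :: ('m \<Rightarrow> real) measure" by (rule prob_space_gaussian)
  have LV[measurable]: "(\<lambda>w. L *v V m w) \<in> borel_measurable M" for m
    by (rule borel_measurable_vec) (rule borel_measurable_matrix_vector_component[OF V])
  show "real_distribution (distr M borel (\<lambda>w. (norm (L *v V m w))\<^sup>2))" for m
    by (rule real_distribution_distr) measurable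
  show "AE x in distr M borel (\<lambda>w. (norm (L *v V m w))\<^sup>2). 0 \<le> x" for m
    by (subst AE_distr_iff) auto
  show "real_distribution (weighted_chi_square lam)" by (rule real_distribution_weighted_chi_square)
  show "AE x in weighted_chi_square lam. 0 \<le> x" by (rule AE_weighted_chi_square_nonneg[OF lam])
  fix k :: nat
  \<comment> \<open>Arguments at which the mixture evaluates the characteristic function of \<open>V m\<close>.\<close>
  define t where "t \<xi> = sqrt (2 * real k) *\<^sub>R (transpose L *v (\<chi> a. \<xi> a))" for \<xi> :: "'m \<Rightarrow> real"
  have quad: "t \<xi> \<bullet> (K *v t \<xi>) = 2 * (real k * (\<Sum>a\<in>UNIV. lam a * (\<xi> a)\<^sup>2))" for \<xi>
  proof -
    define x :: "real^'m" where "x = (\<chi> a. \<xi> a)"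
    have "t \<xi> \<bullet> (K *v t \<xi>) = 2 * real k * ((transpose L *v x) \<bullet> (K *v (transpose L *v x)))"
      by (simp add: t_def x_def matrix_vector_mult_scaleR)
    also have "(transpose L *v x) \<bullet> (K *v (transpose L *v x)) = (\<Sum>a\<in>UNIV. lam a * (\<xi> a)\<^sup>2)"
      unfolding quadratic_form_conjugate[symmetric] L diag_mat_quadratic_form by (simp add: x_def)
    finally show ?thesis by simp
  qed
  have meas: "(\<lambda>\<xi>. CLINT w|M. iexp (t \<xi> \<bullet> V m w)) \<in> borel_measurable gaussian" for m
  proof -
    have "(\<lambda>(\<xi>, w). iexp (t \<xi> \<bullet> V m w)) \<in> borel_measurable (gaussian \<Otimes>\<^sub>M M)"
      using measurable_compose[OF measurable_pair_swap' borel_measurable_gaussian_pair[OF V, of "sqrt (2 * real k)" L]]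
      by (simp add: t_def case_prod_beta')
    then show ?thesis by (rule borel_measurable_lebesgue_integral)
  qed
  have "(\<lambda>m. CLINT \<xi>|gaussian. CLINT w|M. iexp (t \<xi> \<bullet> V m w)) \<longlonglongrightarrow>
      (CLINT \<xi>|gaussian. complex_of_real (exp (- (real k * (\<Sum>a\<in>UNIV. lam a * (\<xi> a)\<^sup>2)))))"
  proof (rule integral_dominated_convergence[where w = "\<lambda>_. 1"])
    show "AE \<xi> in gaussian. (\<lambda>m. CLINT w|M. iexp (t \<xi> \<bullet> V m w)) \<longlonglongrightarrow>
        complex_of_real (exp (- (real k * (\<Sum>a\<in>UNIV. lam a * (\<xi> a)\<^sup>2))))"
      using char[of "t _"] unfolding quad by simp
    show "AE \<xi> in gaussian. norm (CLINT w|M. iexp (t \<xi> \<bullet> V m w)) \<le> 1" for m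
    proof (intro AE_I2)
      fix \<xi>
      have "norm (CLINT w|M. iexp (t \<xi> \<bullet> V m w)) \<le> (LINT w|M. norm (iexp (t \<xi> \<bullet> V m w)))"
        by (rule integral_norm_bound)
      then show "norm (CLINT w|M. iexp (t \<xi> \<bullet> V m w)) \<le> 1" by (simp add: prob_space)
    qed
    have [measurable]: "(\<lambda>\<xi>. \<xi> a) \<in> borel_measurable (gaussian :: ('m \<Rightarrow> real) measure)" for a
      using measurable_component_singleton[of a UNIV "\<lambda>_. std_normal_distribution"] by simp
    show "(\<lambda>\<xi>. complex_of_real (exp (- (real k * (\<Sum>a\<in>UNIV. lam a * (\<xi> a)\<^sup>2))))) \<in> borel_measurable gaussian"
      by measurable
  qed (use meas in auto)
  then have "(\<lambda>m. complex_of_real (LINT w|M. exp (- (real k * (norm (L *v V m w))\<^sup>2)))) \<longlonglongrightarrow>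
      complex_of_real (LINT x|weighted_chi_square lam. exp (- (real k * x)))"
    unfolding laplace_transform_gaussian_mixture[OF V of_nat_0_le_iff] t_def[symmetric]
    by (simp add: weighted_chi_square_laplace[OF lam])
  then show "(\<lambda>m. LINT x|distr M borel (\<lambda>w. (norm (L *v V m w))\<^sup>2). exp (- (real k * x))) \<longlonglongrightarrow>
      (LINT x|weighted_chi_square lam. exp (- (real k * x)))"
    by (simp add: integral_distr tendsto_of_real_iff)
qed

end

section \<open>Quantiles\<close>

text \<open>Right-continuity means that the infimum is attained; the resulting Galois connection translates
  events about quantiles into events about distribution functions.\<close>

lemma quantile_le_iff:
  assumes mono: "mono F" and right_cont: "\<And>t. continuous (at_right t) F"
    and ex: "p \<le> F u" "F l < p"
  shows "quantile F p \<le> s \<longleftrightarrow> p \<le> F s"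
proof -
  define A where "A = {t. p \<le> F t}"
  have bdd: "bdd_below A"
  proof (rule bdd_belowI)
    fix t assume "t \<in> A"
    then have "\<not> F t \<le> F l" using ex by (simp add: A_def)
    then show "l \<le> t" using mono by (metis linear monoD)
  qed
  have ne: "A \<noteq> {}" using ex by (auto simp: A_def)
  have "p \<le> F (Inf A)"
  proof (rule tendsto_lowerbound)
    show "(F \<longlongrightarrow> F (Inf A)) (at_right (Inf A))"
      using right_cont[of "Inf A"] by (simp add: continuous_within)
    have "p \<le> F t" if t: "Inf A < t" for t
    proof -
      obtain a where "a \<in> A" "a < t" using t cInf_less_iff[OF ne bdd, of t] by blast
      then show ?thesis using monoD[OF mono, of a t] by (simp add: A_def)
    qed
    then show "\<forall>\<^sub>F t in at_right (Inf A). p \<le> F t" by (auto simp: eventually_at_filter)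
  qed simp
  then have "p \<le> F s" if "Inf A \<le> s" using monoD[OF mono that] by simp
  moreover have "Inf A \<le> s" if "p \<le> F s" using that bdd by (intro cInf_lower) (auto simp: A_def)
  ultimately show ?thesis unfolding quantile_def A_def by blast
qed

lemma (in real_distribution) quantile_cdf_le_iff:
  assumes "0 < p" "p < 1"
  shows "quantile (cdf M) p \<le> s \<longleftrightarrow> p \<le> cdf M s"
proof -
  have "\<forall>\<^sub>F t in at_top. p < cdf M t" using cdf_lim_at_top_prob assms(2) by (rule order_tendstoD)
  then obtain u where "p < cdf M u" using eventually_happens by fastforce
  moreover have "\<forall>\<^sub>F t in at_bot. cdf M t < p" using cdf_lim_at_bot assms(1) by (rule order_tendstoD)
  then obtain l where "cdf M l < p" using eventually_happens by fastforce
  ultimately show ?thesis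
    by (intro quantile_le_iff[of _ _ u l]) (auto intro!: monoI cdf_nondecreasing cdf_is_right_cont)
qed

lemma (in real_distribution) cdf_quantile_eq:
  assumes p: "0 < p" "p < 1" and cont: "isCont (cdf M) (quantile (cdf M) p)"
  shows "cdf M (quantile (cdf M) p) = p"
proof (rule antisym)
  define q where "q = quantile (cdf M) p"
  show "p \<le> cdf M (quantile (cdf M) p)" using quantile_cdf_le_iff[OF p] by blast
  have "cdf M q \<le> p"
  proof (rule tendsto_upperbound)
    show "(cdf M \<longlongrightarrow> cdf M q) (at_left q)"
      using cont unfolding q_def isCont_def by (rule filterlim_mono) (auto simp: at_le)
    show "\<forall>\<^sub>F t in at_left q. cdf M t \<le> p"
    proof -
      have "cdf M t \<le> p" if "t < q" for t
      proof -
        have "\<not> q \<le> t" using that by simp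
        then have "\<not> p \<le> cdf M t" using quantile_cdf_le_iff[OF p, of t] by (simp add: q_def)
        then show ?thesis by simp
      qed
      then show ?thesis by (auto simp: eventually_at_filter)
    qed
  qed simp
  then show "cdf M (quantile (cdf M) p) \<le> p" by (simp add: q_def)
qed

lemma empirical_quantile_le_iff:
  assumes r: "0 < r" and p: "0 < p" "p < 1"
  shows "quantile (empirical_cdf r x) p \<le> s \<longleftrightarrow> p \<le> empirical_cdf r x s"
proof (rule quantile_le_iff)
  show "mono (empirical_cdf r x)"
    unfolding empirical_cdf_def
    by (intro monoI divide_right_mono sum_mono) (auto simp: indicator_def)
  show "continuous (at_right t) (empirical_cdf r x)" for t
  proof -
    have "((\<lambda>t'. indicat_real {..t'} a) \<longlongrightarrow> indicat_real {..t} a) (at_right t)" for a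
    proof (rule tendsto_eventually)
      show "\<forall>\<^sub>F t' in at_right t. indicat_real {..t'} a = indicat_real {..t} a"
      proof (cases "a \<le> t")
        case True
        then show ?thesis by (auto simp: eventually_at_filter indicator_def intro!: always_eventually)
      next
        case False
        then have "\<forall>\<^sub>F t' in at_right t. t' \<in> {t<..<a}" by (intro eventually_at_right_real) simp
        then show ?thesis by eventually_elim (use False in auto)
      qed
    qed
    then show ?thesis unfolding continuous_within empirical_cdf_def
      using r by (intro tendsto_intros) auto
  qed
  have fin: "finite (x ` {..<r})" "x ` {..<r} \<noteq> {}" using r by auto
  have "indicat_real {..Max (x ` {..<r})} (x j) = 1" if "j < r" for j
    using that fin by (simp add: indicator_def)
  then show "p \<le> empirical_cdf r x (Max (x ` {..<r}))"
    using r p by (simp add: empirical_cdf_def)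
  have "indicat_real {..Min (x ` {..<r}) - 1} (x j) = 0" if "j < r" for j
  proof -
    have "Min (x ` {..<r}) \<le> x j" using that fin by simp
    then show ?thesis by (simp add: indicator_def)
  qed
  then show "empirical_cdf r x (Min (x ` {..<r}) - 1) < p"
    using p by (simp add: empirical_cdf_def)
qed

lemma borel_measurable_empirical_cdf:
  assumes [measurable]: "\<And>j. Y j \<in> borel_measurable M"
  shows "(\<lambda>w. empirical_cdf r (\<lambda>j. Y j w) s) \<in> borel_measurable M"
  unfolding empirical_cdf_def indicator_def by measurable

lemma borel_measurable_empirical_quantile:
  assumes Y: "\<And>j. Y j \<in> borel_measurable M" and p: "0 < p" "p < 1"
  shows "(\<lambda>w. quantile (empirical_cdf r (\<lambda>j. Y j w)) p) \<in> borel_measurable M"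
proof (cases "r = 0")
  case True
  have "empirical_cdf 0 x = (\<lambda>_. 0)" for x by (simp add: empirical_cdf_def fun_eq_iff)
  then show ?thesis using True by simp
next
  case False
  have [measurable]: "(\<lambda>w. empirical_cdf r (\<lambda>j. Y j w) s) \<in> borel_measurable M" for s
    by (rule borel_measurable_empirical_cdf[OF Y])
  show ?thesis
    unfolding borel_measurable_iff_le using False by (simp add: empirical_quantile_le_iff p)
qed

section \<open>Characteristic functions of sums of independent bounded variables\<close>

text \<open>Both terms have the second-order expansion \<open>1 - c\<^sup>2 * v / 2\<close>; boundedness of \<open>h\<close> makes the
  error explicit in \<open>c\<close>.\<close>

lemma norm_char_minus_exp_le:
  fixes h :: "'a \<Rightarrow> real"
  assumes P: "prob_space P" and h: "h \<in> borel_measurable P" "\<And>x. \<bar>h x\<bar> \<le> B"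
    and mean: "(LINT x|P. h x) = 0" and v: "(LINT x|P. (h x)\<^sup>2) = v"
  shows "norm ((CLINT x|P. iexp (c * h x)) - exp (- (c\<^sup>2 * v / 2))) \<le> \<bar>c\<bar> ^ 3 * B ^ 3 / 6 + (c\<^sup>2 * v / 2)\<^sup>2"
proof -
  interpret prob_space P by fact
  have B: "0 \<le> B" using h(2) by (meson abs_ge_zero order_trans)
  have int: "integrable P h"
    using h by (intro integrable_const_bound[where B=B]) auto
  have "(h x)\<^sup>2 \<le> B\<^sup>2" for x
    using power_mono[OF h(2), of x 2] by simp
  then have int2: "integrable P (\<lambda>x. (h x)\<^sup>2)"
    using h(1) by (intro integrable_const_bound[where B="B\<^sup>2"]) auto
  have "norm (char (distr P borel h) c - (1 - c\<^sup>2 * v / 2)) \<le>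
      (c\<^sup>2 / 6) * expectation (\<lambda>x. min (6 * (h x)\<^sup>2) (\<bar>c\<bar> * \<bar>h x\<bar> ^ 3))"
    by (intro char_approx3' h int int2 mean) (auto simp: mean v)
  also have "\<dots> \<le> (c\<^sup>2 / 6) * (LINT x|P. \<bar>c\<bar> * B ^ 3)"
  proof (intro mult_left_mono integral_mono)
    have "\<bar>c\<bar> * \<bar>h x\<bar> ^ 3 \<le> \<bar>c\<bar> * B ^ 3" for x
      by (intro mult_left_mono power_mono h) auto
    then show le: "min (6 * (h x)\<^sup>2) (\<bar>c\<bar> * \<bar>h x\<bar> ^ 3) \<le> \<bar>c\<bar> * B ^ 3" for x
      by (auto intro: min.coboundedI2)
    show "integrable P (\<lambda>x. min (6 * (h x)\<^sup>2) (\<bar>c\<bar> * \<bar>h x\<bar> ^ 3))"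
      using h(1) by (intro integrable_const_bound[where B="\<bar>c\<bar> * B ^ 3"]) (auto simp: le)
  qed auto
  also have "\<dots> = \<bar>c\<bar> ^ 3 * B ^ 3 / 6"
    by (simp add: prob_space power3_eq_cube power2_eq_square abs_mult)
  finally have 1: "norm ((CLINT x|P. iexp (c * h x)) - (1 - c\<^sup>2 * v / 2)) \<le> \<bar>c\<bar> ^ 3 * B ^ 3 / 6"
    using h(1) by (simp add: char_def integral_distr)
  define z where "z = c\<^sup>2 * v / 2"
  have z: "0 \<le> z" unfolding z_def v[symmetric] by simp
  have "1 - z \<le> exp (- z)" using exp_ge_add_one_self[of "- z"] by simp
  moreover have "exp (- z) \<le> 1 - z + z\<^sup>2"
  proof -
    \<comment> \<open>The product equals \<open>1 + z ^ 3\<close>.\<close>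
    have "1 \<le> (1 - z + z\<^sup>2) * (1 + z)"
      using z by (simp add: algebra_simps power2_eq_square)
    also have "\<dots> \<le> (1 - z + z\<^sup>2) * exp z"
    proof (intro mult_left_mono exp_ge_add_one_self)
      have "0 \<le> (1 - z / 2)\<^sup>2 + 3 / 4 * z\<^sup>2" by simp
      then show "0 \<le> 1 - z + z\<^sup>2" by (simp add: power2_eq_square algebra_simps)
    qed
    finally show ?thesis by (simp add: exp_minus field_simps)
  qed
  ultimately have "\<bar>(1 - z) - exp (- z)\<bar> \<le> z\<^sup>2" by linarith
  then have 2: "norm (complex_of_real (1 - z) - of_real (exp (- z))) \<le> z\<^sup>2"
    by (metis norm_of_real of_real_diff real_norm_def)
  show ?thesis
    using norm_triangle_mono[OF 1 2] unfolding z_def by (simp add: algebra_simps)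
qed

text \<open>The central limit theorem for a triangular scheme: the scale \<open>c m\<close> and the number \<open>r m\<close> of
  summands vary independently, coupled only through \<open>r m * (c m)\<^sup>2 \<longlonglongrightarrow> \<tau>\<close>. This accommodates groups of
  different sizes under the common normalization by the total sample size.\<close>

lemma iid_char_power_tendsto:
  fixes h :: "'a \<Rightarrow> real" and r :: "nat \<Rightarrow> nat"
  assumes P: "prob_space P" and h: "h \<in> borel_measurable P" "\<And>x. \<bar>h x\<bar> \<le> B"
    and mean: "(LINT x|P. h x) = 0" and v: "(LINT x|P. (h x)\<^sup>2) = v"
    and r: "filterlim r at_top sequentially" and c: "(\<lambda>m. real (r m) * (c m)\<^sup>2) \<longlonglongrightarrow> \<tau>"
  shows "(\<lambda>m. (CLINT x|P. iexp (c m * h x)) ^ r m) \<longlonglongrightarrow> exp (- (\<tau> * v / 2))"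
proof -
  interpret prob_space P by fact
  define \<phi> where "\<phi> m = (CLINT x|P. iexp (c m * h x))" for m
  define \<psi> where "\<psi> m = complex_of_real (exp (- ((c m)\<^sup>2 * v / 2)))" for m
  have "v \<ge> 0" unfolding v[symmetric] by simp
  then have \<psi>1: "norm (\<psi> m) \<le> 1" for m by (simp add: \<psi>_def)
  have \<phi>1: "norm (\<phi> m) \<le> 1" for m
  proof -
    have "norm (\<phi> m) \<le> (LINT x|P. norm (iexp (c m * h x)))"
      unfolding \<phi>_def by (rule integral_norm_bound)
    then show ?thesis by (simp add: prob_space)
  qed
  have rr: "filterlim (\<lambda>m. real (r m)) at_top sequentially"
    using r by (rule filterlim_compose[OF filterlim_real_sequentially])
  have "(\<lambda>m. (real (r m) * (c m)\<^sup>2) * inverse (real (r m))) \<longlonglongrightarrow> \<tau> * 0"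
    by (intro tendsto_mult c tendsto_inverse_0_at_top rr)
  moreover have "\<forall>\<^sub>F m in sequentially. (real (r m) * (c m)\<^sup>2) * inverse (real (r m)) = (c m)\<^sup>2"
    using eventually_gt_at_top[of 0] filterlim_at_top_dense[THEN iffD1, OF rr, rule_format, of 0]
    by (auto elim!: eventually_mono)
  ultimately have c2: "(\<lambda>m. (c m)\<^sup>2) \<longlonglongrightarrow> 0" by (simp add: tendsto_cong)
  then have ca: "(\<lambda>m. \<bar>c m\<bar>) \<longlonglongrightarrow> 0" using tendsto_real_sqrt[OF c2] by simp
  have bound: "norm (\<phi> m ^ r m - \<psi> m ^ r m) \<le>
      (real (r m) * (c m)\<^sup>2) * (\<bar>c m\<bar> * (B ^ 3 / 6) + (c m)\<^sup>2 * (v / 2)\<^sup>2)" for m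
  proof -
    have "norm (\<phi> m ^ r m - \<psi> m ^ r m) \<le> r m * norm (\<phi> m - \<psi> m)"
      by (rule norm_power_diff[OF \<phi>1 \<psi>1])
    also have "\<dots> \<le> r m * (\<bar>c m\<bar> ^ 3 * B ^ 3 / 6 + ((c m)\<^sup>2 * v / 2)\<^sup>2)"
      unfolding \<phi>_def \<psi>_def by (intro mult_left_mono norm_char_minus_exp_le P h mean v) auto
    also have "\<bar>c m\<bar> ^ 3 = (c m)\<^sup>2 * \<bar>c m\<bar>" by (simp add: power3_eq_cube power2_eq_square)
    finally show ?thesis by (simp add: algebra_simps power2_eq_square)
  qed
  have "(\<lambda>m. (real (r m) * (c m)\<^sup>2) * (\<bar>c m\<bar> * (B ^ 3 / 6) + (c m)\<^sup>2 * (v / 2)\<^sup>2))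
      \<longlonglongrightarrow> \<tau> * (0 * (B ^ 3 / 6) + 0 * (v / 2)\<^sup>2)"
    by (intro tendsto_intros c ca c2)
  then have "(\<lambda>m. (real (r m) * (c m)\<^sup>2) * (\<bar>c m\<bar> * (B ^ 3 / 6) + (c m)\<^sup>2 * (v / 2)\<^sup>2)) \<longlonglongrightarrow> 0"
    by simp
  with always_eventually[OF allI[OF bound]] have "(\<lambda>m. \<phi> m ^ r m - \<psi> m ^ r m) \<longlonglongrightarrow> 0"
    by (rule Lim_null_comparison)
  moreover have "(\<lambda>m. \<psi> m ^ r m) \<longlonglongrightarrow> exp (- (\<tau> * v / 2))"
  proof -
    have "\<psi> m ^ r m = of_real (exp (- ((real (r m) * (c m)\<^sup>2) * v / 2)))" for m
      unfolding \<psi>_def by (simp flip: of_real_power exp_of_nat_mult add: mult.assoc)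
    then show ?thesis by (simp only:) (intro tendsto_intros c, simp)
  qed
  ultimately have "(\<lambda>m. (\<phi> m ^ r m - \<psi> m ^ r m) + \<psi> m ^ r m) \<longlonglongrightarrow> 0 + complex_of_real (exp (- (\<tau> * v / 2)))"
    by (rule tendsto_add)
  then show ?thesis by (simp add: \<phi>_def)
qed

section \<open>Linearization of the sample quantiles\<close>

locale quantile_sample = prob_space M for M :: "'w measure" +
  fixes P :: "'k::finite \<Rightarrow> (real ^ 'd::finite) measure"
    and X :: "'k \<Rightarrow> nat \<Rightarrow> 'w \<Rightarrow> real ^ 'd"
    and n :: "nat \<Rightarrow> 'k \<Rightarrow> nat"
    and \<kappa> :: "'k \<Rightarrow> real"
    and p :: real
  assumes p: "0 < p" "p < 1"
    and indep: "indep_vars (\<lambda>_. borel) (\<lambda>(i, j). X i j) UNIV"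
    and distr_X: "\<And>i j. distr M borel (X i j) = P i"
    and total_at_top: "filterlim (\<lambda>m. \<Sum>i\<in>UNIV. n m i) at_top sequentially"
    and ratio: "\<And>i. (\<lambda>m. real (n m i) / real (\<Sum>i\<in>UNIV. n m i)) \<longlonglongrightarrow> \<kappa> i"
    and \<kappa>: "\<And>i. \<kappa> i > 0"
    and derivative: "\<And>i l. (marginal_cdf (P i) l has_real_derivative density_at_quantile (P i) p l)
        (at (quantile (marginal_cdf (P i) l) p))"
    and density: "\<And>i l. density_at_quantile (P i) p l > 0"
begin

definition N :: "nat \<Rightarrow> nat" where "N m = (\<Sum>i\<in>UNIV. n m i)"

abbreviation q :: "real ^ ('k \<times> 'd)" where "q \<equiv> quantile_vector P p"

abbreviation f :: "'k \<times> 'd \<Rightarrow> real" where "f a \<equiv> density_at_quantile (P (fst a)) p (snd a)"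

abbreviation F :: "'k \<times> 'd \<Rightarrow> real \<Rightarrow> real" where "F a \<equiv> marginal_cdf (P (fst a)) (snd a)"

abbreviation q_hat :: "nat \<Rightarrow> 'w \<Rightarrow> real ^ ('k \<times> 'd)" where
  "q_hat m w \<equiv> empirical_quantile_vector (n m) (\<lambda>i j. X i j w) p"

definition scaled_error :: "nat \<Rightarrow> 'w \<Rightarrow> real ^ ('k \<times> 'd)" where
  "scaled_error m w = sqrt (real (N m)) *\<^sub>R (q_hat m w - q)"

text \<open>The influence function of the quantile functional: \<open>a\<close> picks the group and the coordinate.\<close>

definition influence :: "'k \<times> 'd \<Rightarrow> real ^ 'd \<Rightarrow> real" where
  "influence a x = (p - indicator {..q $ a} (x $ snd a)) / f a"

text \<open>The linear approximation to \<open>scaled_error\<close>; its summands are independent, bounded and centred.\<close>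

definition linear_term :: "nat \<Rightarrow> 'w \<Rightarrow> real ^ ('k \<times> 'd)" where
  "linear_term m w = (\<chi> a. sqrt (real (N m)) / real (n m (fst a)) * (\<Sum>j<n m (fst a). influence a (X (fst a) j w)))"

lemma measurable_X [measurable]: "X i j \<in> borel_measurable M"
  using indep_vars_def[THEN iffD1, OF indep] by auto

lemma measurable_component [measurable]: "(\<lambda>x :: real ^ 'd. x $ l) \<in> borel_measurable borel"
  by (intro borel_measurable_continuous_onI continuous_intros)

lemma sets_P [measurable_cong]: "sets (P i) = sets borel" and space_P: "space (P i) = UNIV"
  using distr_X[of i 0] by (metis sets_distr, metis space_distr space_borel)

lemma prob_space_P: "prob_space (P i)"
  using distr_X[of i 0] prob_space_distr[OF measurable_X] by metis

lemma integral_X: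
  fixes g :: "real ^ 'd \<Rightarrow> 'b::{banach, second_countable_topology}"
  assumes "g \<in> borel_measurable borel"
  shows "(\<integral>w. g (X i j w) \<partial>M) = (\<integral>x. g x \<partial>P i)"
  unfolding distr_X[of i j, symmetric] by (rule integral_distr[symmetric]) (use assms in auto)

lemma real_distribution_marginal: "real_distribution (distr (P i) borel (\<lambda>x. x $ l))"
proof -
  interpret P: prob_space "P i" by (rule prob_space_P)
  show ?thesis by (rule P.real_distribution_distr) measurable
qed

lemma integral_indicator_marginal: "(LINT x|P (fst a). indicat_real {..s} (x $ snd a)) = F a s"
proof -
  have "(LINT x|P (fst a). indicat_real {..s} (x $ snd a)) =
      (LINT y|distr (P (fst a)) borel (\<lambda>x. x $ snd a). indicat_real {..s} y)"
    by (rule integral_distr[symmetric]) measurable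
  also have "\<dots> = F a s" by (simp add: marginal_cdf_def cdf_def)
  finally show ?thesis .
qed

lemma integrable_P_bounded:
  fixes g :: "real ^ 'd \<Rightarrow> real"
  assumes "g \<in> borel_measurable borel" "\<And>x. \<bar>g x\<bar> \<le> B"
  shows "integrable (P i) g"
proof -
  interpret P: prob_space "P i" by (rule prob_space_P)
  show ?thesis by (rule P.integrable_const_bound[where B=B]) (use assms in auto)
qed

lemma F_q: "F a (q $ a) = p"
proof -
  interpret R: real_distribution "distr (P (fst a)) borel (\<lambda>x. x $ snd a)" by (rule real_distribution_marginal)
  have "isCont (F a) (q $ a)"
    using DERIV_isCont[OF derivative] by (simp add: quantile_vector_def)
  then show ?thesis
    using R.cdf_quantile_eq[OF p] by (simp add: quantile_vector_def marginal_cdf_def)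
qed

lemma borel_measurable_influence [measurable]: "influence a \<in> borel_measurable borel"
  unfolding influence_def[abs_def] by measurable

lemma influence_bound: "\<bar>influence a x\<bar> \<le> 1 / f a"
  using density[of "fst a" "snd a"] p by (auto simp: influence_def divide_simps indicator_def)

lemma influence_mean: "(LINT x|P (fst a). influence a x) = 0"
proof -
  interpret P: prob_space "P (fst a)" by (rule prob_space_P)
  have "(LINT x|P (fst a). p - indicat_real {..q $ a} (x $ snd a)) = p - p"
    by (subst Bochner_Integration.integral_diff)
      (auto simp: integral_indicator_marginal F_q P.prob_space intro!: integrable_P_bounded[where B=1] split: split_indicator)
  then show ?thesis by (simp add: influence_def)
qed

lemma N_at_top: "filterlim N at_top sequentially"
  using total_at_top by (simp add: N_def[abs_def])

lemma real_N_at_top: "filterlim (\<lambda>m. real (N m)) at_top sequentially"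
  using N_at_top by (rule filterlim_compose[OF filterlim_real_sequentially])

lemma eventually_N_pos: "\<forall>\<^sub>F m in sequentially. 0 < N m"
  using N_at_top[unfolded filterlim_at_top, rule_format, of 1] by eventually_elim simp

lemma n_at_top: "filterlim (\<lambda>m. n m i) at_top sequentially"
proof -
  have "filterlim (\<lambda>m. real (n m i) / real (N m) * real (N m)) at_top sequentially"
    using ratio[of i] \<kappa>[of i] real_N_at_top unfolding N_def by (rule filterlim_tendsto_pos_mult_at_top)
  moreover have "\<forall>\<^sub>F m in sequentially. real (n m i) / real (N m) * real (N m) = real (n m i)"
    using eventually_N_pos by eventually_elim simp
  ultimately have "filterlim (\<lambda>m. real (n m i)) at_top sequentially"
    using filterlim_cong[OF refl refl] by fast
  then show ?thesis by (simp add: filterlim_real_sequentially filterlim_sequentially_iff_filterlim_real)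
qed

lemma eventually_n_pos: "\<forall>\<^sub>F m in sequentially. 0 < n m i"
  using n_at_top[of i, unfolded filterlim_at_top, rule_format, of 1] by eventually_elim simp

lemma N_over_n: "(\<lambda>m. real (N m) / real (n m i)) \<longlonglongrightarrow> 1 / \<kappa> i"
proof -
  have "(\<lambda>m. 1 / (real (n m i) / real (N m))) \<longlonglongrightarrow> 1 / \<kappa> i"
    using ratio[of i] \<kappa>[of i] unfolding N_def by (intro tendsto_intros) auto
  then show ?thesis by simp
qed

text \<open>Mixed products of independent centred variables integrate to zero.\<close>

lemma mean_square_sum:
  fixes g :: "real ^ 'd \<Rightarrow> real"
  assumes g: "g \<in> borel_measurable borel" "\<And>x. \<bar>g x\<bar> \<le> B" and mean: "(LINT x|P i. g x) = 0"
  shows "expectation (\<lambda>w. (\<Sum>j<r. g (X i j w))\<^sup>2) = real r * (LINT x|P i. (g x)\<^sup>2)"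
proof -
  have gm[measurable]: "(\<lambda>w. g (X i j w)) \<in> borel_measurable M" for j
    using g(1) by measurable
  have B: "0 \<le> B" using order_trans[OF abs_ge_zero g(2)] .
  have int: "integrable M (\<lambda>w. g (X i j w))" for j
    using g(2) by (intro integrable_const_bound[where B=B]) auto
  have "\<bar>g x * g y\<bar> \<le> B * B" for x y
    unfolding abs_mult by (intro mult_mono g(2) B) auto
  then have int2: "integrable M (\<lambda>w. g (X i j w) * g (X i j' w))" for j j'
    by (intro integrable_const_bound[where B="B * B"]) auto
  have prod: "expectation (\<lambda>w. g (X i j w) * g (X i j' w)) = (if j = j' then LINT x|P i. (g x)\<^sup>2 else 0)" for j j'
  proof (cases "j = j'")
    case True
    have "(\<lambda>x. (g x)\<^sup>2) \<in> borel_measurable borel" using g(1) by measurable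
    then show ?thesis using True integral_X[of "\<lambda>x. (g x)\<^sup>2" i j] by (simp add: power2_eq_square)
  next
    case False
    have "indep_vars (\<lambda>_. borel) (\<lambda>a w. g ((case a of (i, j) \<Rightarrow> X i j) w)) {(i, j), (i, j')}"
      by (rule indep_vars_compose2[OF indep_vars_subset[OF indep subset_UNIV]]) (rule g(1))
    from indep_vars_lebesgue_integral[OF _ this]
    have "expectation (\<lambda>w. \<Prod>a\<in>{(i, j), (i, j')}. g ((case a of (i, j) \<Rightarrow> X i j) w)) =
        (\<Prod>a\<in>{(i, j), (i, j')}. expectation (\<lambda>w. g ((case a of (i, j) \<Rightarrow> X i j) w)))"
      using int by auto
    then show ?thesis using False integral_X[OF g(1)] mean by simp
  qed
  have "expectation (\<lambda>w. (\<Sum>j<r. g (X i j w))\<^sup>2) =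
      expectation (\<lambda>w. \<Sum>j<r. \<Sum>j'<r. g (X i j w) * g (X i j' w))"
    by (simp add: power2_eq_square sum_product)
  also have "\<dots> = (\<Sum>j<r. \<Sum>j'<r. expectation (\<lambda>w. g (X i j w) * g (X i j' w)))"
    using int2 by simp
  also have "\<dots> = real r * (LINT x|P i. (g x)\<^sup>2)"
    by (simp add: prod)
  finally show ?thesis .
qed

lemma integrable_square_sum:
  fixes g :: "real ^ 'd \<Rightarrow> real"
  assumes g: "g \<in> borel_measurable borel" "\<And>x. \<bar>g x\<bar> \<le> B"
  shows "integrable M (\<lambda>w. (c * (\<Sum>j<r. g (X i j w)))\<^sup>2)"
proof -
  have gm[measurable]: "(\<lambda>w. g (X i j w)) \<in> borel_measurable M" for j
    using g(1) by measurable
  have "(c * (\<Sum>j<r. g (X i j w)))\<^sup>2 \<le> (\<bar>c\<bar> * (real r * B))\<^sup>2" for w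
  proof -
    have "\<bar>\<Sum>j<r. g (X i j w)\<bar> \<le> (\<Sum>j<r. B)"
      by (rule order_trans[OF sum_abs]) (intro sum_mono g)
    then have "\<bar>c * (\<Sum>j<r. g (X i j w))\<bar> \<le> \<bar>c\<bar> * (real r * B)"
      by (auto simp: abs_mult intro: mult_left_mono)
    then show ?thesis using abs_le_square_iff[of "c * (\<Sum>j<r. g (X i j w))" "\<bar>c\<bar> * (real r * B)"] by simp
  qed
  then show ?thesis by (intro integrable_const_bound) auto
qed

lemma scaled_mean_square:
  fixes g :: "real ^ 'd \<Rightarrow> real"
  assumes g: "g \<in> borel_measurable borel" "\<And>x. \<bar>g x\<bar> \<le> B" and mean: "(LINT x|P i. g x) = 0" and r: "0 < n m i"
  shows "expectation (\<lambda>w. (sqrt (real (N m)) / real (n m i) * (\<Sum>j<n m i. g (X i j w)))\<^sup>2) =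
    real (N m) / real (n m i) * (LINT x|P i. (g x)\<^sup>2)"
  using r by (simp add: power_mult_distrib power_divide mean_square_sum[OF g mean]) (simp add: power2_eq_square)

lemma measurable_linear_term: "(\<lambda>w. linear_term m w $ a) \<in> borel_measurable M"
  unfolding linear_term_def by simp measurable

lemma measurable_q_hat: "(\<lambda>w. q_hat m w $ a) \<in> borel_measurable M"
  unfolding empirical_quantile_vector_def by (simp, intro borel_measurable_empirical_quantile p) measurable

lemma measurable_scaled_error: "(\<lambda>w. scaled_error m w $ a) \<in> borel_measurable M"
  using measurable_q_hat[of m a] unfolding scaled_error_def by simp

lemma bounded_linear_term: "bounded_in_probability M (\<lambda>m w. linear_term m w $ a)"
proof (rule bounded_in_probability_second_moment)
  let ?i = "fst a"
  show "(\<lambda>w. linear_term m w $ a) \<in> borel_measurable M" for m by (rule measurable_linear_term)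
  show "integrable M (\<lambda>w. (linear_term m w $ a)\<^sup>2)" for m
    unfolding linear_term_def vec_lambda_beta by (rule integrable_square_sum[OF borel_measurable_influence influence_bound])
  define v where "v = (LINT x|P ?i. (influence a x)\<^sup>2)"
  have "(\<lambda>m. real (N m) / real (n m ?i) * v) \<longlonglongrightarrow> 1 / \<kappa> ?i * v"
    by (intro tendsto_intros N_over_n)
  then have "\<forall>\<^sub>F m in sequentially. real (N m) / real (n m ?i) * v < 1 / \<kappa> ?i * v + 1"
    by (rule order_tendstoD) simp
  then show "\<forall>\<^sub>F m in sequentially. expectation (\<lambda>w. (linear_term m w $ a)\<^sup>2) \<le> 1 / \<kappa> ?i * v + 1"
    using eventually_n_pos[of ?i]
  proof eventually_elim
    case (elim m)
    show ?case
      unfolding linear_term_def vec_lambda_beta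
        scaled_mean_square[OF borel_measurable_influence influence_bound influence_mean elim(2)] v_def[symmetric]
      using elim(1) by simp
  qed
qed

text \<open>The centred and scaled increment of the empirical process between the quantile and a nearby
  point \<open>s\<close>. Its variance is at most of the order \<open>|F s - p|\<close>, which vanishes as \<open>s\<close> approaches
  the quantile; this is why the remainder in the linearization is negligible.\<close>

definition increment :: "'k \<times> 'd \<Rightarrow> real \<Rightarrow> real ^ 'd \<Rightarrow> real" where
  "increment a s x = (indicator {..s} (x $ snd a) - indicator {..q $ a} (x $ snd a) - (F a s - p)) / f a"

lemma F_bounds: "0 \<le> F a s" "F a s \<le> 1"
proof -
  interpret R: real_distribution "distr (P (fst a)) borel (\<lambda>x. x $ snd a)" by (rule real_distribution_marginal)
  show "0 \<le> F a s" "F a s \<le> 1"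
    unfolding marginal_cdf_def by (auto simp: R.cdf_nonneg R.cdf_bounded_prob)
qed

lemma borel_measurable_increment [measurable]: "increment a s \<in> borel_measurable borel"
  unfolding increment_def[abs_def] by measurable

lemma increment_bound: "\<bar>increment a s x\<bar> \<le> 2 / f a"
proof -
  have "\<bar>indicator {..s} (x $ snd a) - indicator {..q $ a} (x $ snd a) - (F a s - p)\<bar> \<le> 2"
    using F_bounds[of a s] p by (auto simp: indicator_def)
  then show ?thesis
    using density[of "fst a" "snd a"] unfolding increment_def by (simp add: divide_right_mono)
qed

text \<open>The difference \<open>h\<close> of the two indicators takes values of one sign in \<open>{- 1, 0, 1}\<close>, so its second
  moment is the absolute value of its mean; centring can only reduce the second moment.\<close>

lemma increment_moments:
  "(LINT x|P (fst a). increment a s x) = 0"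
  "(LINT x|P (fst a). (increment a s x)\<^sup>2) \<le> \<bar>F a s - p\<bar> / (f a)\<^sup>2"
proof -
  interpret P: prob_space "P (fst a)" by (rule prob_space_P)
  define h where "h x = indicat_real {..s} (x $ snd a) - indicat_real {..q $ a} (x $ snd a)" for x :: "real ^ 'd"
  have hm[measurable]: "h \<in> borel_measurable borel" unfolding h_def[abs_def] by measurable
  have hb: "\<bar>h x\<bar> \<le> 1" for x by (auto simp: h_def indicator_def)
  have hi: "integrable (P (fst a)) h" using hm hb by (rule integrable_P_bounded)
  have hi2: "integrable (P (fst a)) (\<lambda>x. (h x)\<^sup>2)"
    by (rule integrable_P_bounded[where B=1]) (auto simp: h_def indicator_def)
  have hE: "(LINT x|P (fst a). h x) = F a s - p"
    unfolding h_def
    by (subst Bochner_Integration.integral_diff)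
      (auto simp: integral_indicator_marginal F_q intro!: integrable_P_bounded[where B=1] split: split_indicator)
  have hE2: "(LINT x|P (fst a). (h x)\<^sup>2) = \<bar>F a s - p\<bar>"
  proof -
    define \<sigma> :: real where "\<sigma> = (if q $ a \<le> s then 1 else - 1)"
    have "(h x)\<^sup>2 = \<sigma> * h x" for x by (auto simp: h_def indicator_def \<sigma>_def)
    then have "(LINT x|P (fst a). (h x)\<^sup>2) = \<sigma> * (F a s - p)" using hE by simp
    moreover have "0 \<le> (LINT x|P (fst a). (h x)\<^sup>2)" by simp
    ultimately show ?thesis by (auto simp: \<sigma>_def split: if_splits)
  qed
  have inc: "increment a s x = (h x - (F a s - p)) / f a" for x by (simp add: increment_def h_def)
  show "(LINT x|P (fst a). increment a s x) = 0"
    unfolding inc using hi by (simp add: hE P.prob_space)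
  have "(LINT x|P (fst a). (h x - (F a s - p))\<^sup>2) = \<bar>F a s - p\<bar> - (F a s - p)\<^sup>2"
    using P.variance_eq[OF hi hi2] by (simp add: hE hE2)
  then have "(LINT x|P (fst a). (increment a s x)\<^sup>2) = (\<bar>F a s - p\<bar> - (F a s - p)\<^sup>2) / (f a)\<^sup>2"
    unfolding inc by (simp add: power_divide)
  then show "(LINT x|P (fst a). (increment a s x)\<^sup>2) \<le> \<bar>F a s - p\<bar> / (f a)\<^sup>2"
    by (simp add: divide_right_mono)
qed

end

context quantile_sample
begin

definition shifted_quantile :: "'k \<times> 'd \<Rightarrow> real \<Rightarrow> nat \<Rightarrow> real" where
  "shifted_quantile a y m = q $ a + y / sqrt (real (N m))"

text \<open>The perturbation of the level \<open>y\<close> that relates the events \<open>scaled_error m w $ a \<le> y\<close> and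
  \<open>linear_term m w $ a \<le> y\<close>. The first summand is random and small by the variance bound on the
  increments; the second is deterministic and small because \<open>F a\<close> is differentiable at the quantile.\<close>

definition remainder :: "'k \<times> 'd \<Rightarrow> real \<Rightarrow> nat \<Rightarrow> 'w \<Rightarrow> real" where
  "remainder a y m w =
     sqrt (real (N m)) / real (n m (fst a)) * (\<Sum>j<n m (fst a). increment a (shifted_quantile a y m) (X (fst a) j w)) +
     (sqrt (real (N m)) * (F a (shifted_quantile a y m) - p) / f a - y)"

lemma sqrt_N_at_top: "filterlim (\<lambda>m. sqrt (real (N m))) at_top sequentially"
  by (rule filterlim_compose[OF sqrt_at_top real_N_at_top])

lemma shift_tendsto_0: "(\<lambda>m. y / sqrt (real (N m))) \<longlonglongrightarrow> 0"
  by (rule real_tendsto_divide_at_top[OF tendsto_const sqrt_N_at_top])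

lemma derivative_F: "(F a has_real_derivative f a) (at (q $ a))"
  using derivative by (simp add: quantile_vector_def)

lemma F_shifted_tendsto: "(\<lambda>m. F a (shifted_quantile a y m)) \<longlonglongrightarrow> p"
proof -
  have "(\<lambda>m. shifted_quantile a y m) \<longlonglongrightarrow> q $ a + 0"
    unfolding shifted_quantile_def by (intro tendsto_intros shift_tendsto_0)
  then have "(\<lambda>m. F a (shifted_quantile a y m)) \<longlonglongrightarrow> F a (q $ a)"
    using DERIV_isCont[OF derivative_F] by (intro isCont_tendsto_compose[of "q $ a" "F a"]) auto
  then show ?thesis by (simp add: F_q)
qed

lemma drift_tendsto: "(\<lambda>m. sqrt (real (N m)) * (F a (shifted_quantile a y m) - p) / f a) \<longlonglongrightarrow> y"
proof (cases "y = 0")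
  case True
  then show ?thesis by (simp add: shifted_quantile_def F_q)
next
  case False
  define h where "h m = y / sqrt (real (N m))" for m
  have "\<forall>\<^sub>F m in sequentially. h m \<noteq> 0"
    using eventually_N_pos by eventually_elim (simp add: h_def False)
  then have "filterlim h (at 0) sequentially"
    using shift_tendsto_0[of y] by (intro filterlim_atI) (auto simp: h_def[abs_def])
  moreover have "((\<lambda>h. (F a (q $ a + h) - F a (q $ a)) / h) \<longlongrightarrow> f a) (at 0)"
    using derivative_F by (rule DERIV_D)
  ultimately have "(\<lambda>m. (F a (q $ a + h m) - F a (q $ a)) / h m) \<longlonglongrightarrow> f a"
    by (rule filterlim_compose[rotated])
  then have "(\<lambda>m. y * ((F a (q $ a + h m) - F a (q $ a)) / h m) / f a) \<longlonglongrightarrow> y * f a / f a"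
    using density[of "fst a" "snd a"] by (intro tendsto_intros) auto
  moreover have "\<forall>\<^sub>F m in sequentially. y * ((F a (q $ a + h m) - F a (q $ a)) / h m) / f a =
      sqrt (real (N m)) * (F a (shifted_quantile a y m) - p) / f a"
    using eventually_N_pos by eventually_elim (simp add: h_def False F_q shifted_quantile_def)
  ultimately show ?thesis
    using density[of "fst a" "snd a"] by (simp add: tendsto_cong)
qed

lemma measurable_remainder: "(\<lambda>w. remainder a y m w) \<in> borel_measurable M"
  unfolding remainder_def by measurable

lemma remainder_tendsto_0: "tendsto_in_probability M (remainder a y) 0"
proof -
  let ?i = "fst a"
  define A where "A m w = sqrt (real (N m)) / real (n m ?i) *
      (\<Sum>j<n m ?i. increment a (shifted_quantile a y m) (X ?i j w))" for m w
  have mA: "A m \<in> borel_measurable M" for m unfolding A_def by measurable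
  have "tendsto_in_probability M A 0"
  proof (rule tendsto_0_in_probability_second_moment[OF mA])
    show "integrable M (\<lambda>w. (A m w)\<^sup>2)" for m
      unfolding A_def by (rule integrable_square_sum[OF borel_measurable_increment increment_bound])
    define D where "D m = \<bar>F a (shifted_quantile a y m) - p\<bar> / (f a)\<^sup>2" for m
    have "D \<longlonglongrightarrow> \<bar>p - p\<bar> / (f a)\<^sup>2"
      unfolding D_def using density[of ?i "snd a"] by (intro tendsto_intros F_shifted_tendsto) auto
    then have "(\<lambda>m. real (N m) / real (n m ?i) * D m) \<longlonglongrightarrow> 1 / \<kappa> ?i * 0"
      by (intro tendsto_mult N_over_n) simp
    then have lim: "(\<lambda>m. real (N m) / real (n m ?i) * D m) \<longlonglongrightarrow> 0" by simp
    have "\<forall>\<^sub>F m in sequentially. norm (expectation (\<lambda>w. (A m w)\<^sup>2)) \<le> real (N m) / real (n m ?i) * D m"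
      using eventually_n_pos[of ?i]
    proof eventually_elim
      case (elim m)
      have "expectation (\<lambda>w. (A m w)\<^sup>2) = real (N m) / real (n m ?i) *
          (LINT x|P ?i. (increment a (shifted_quantile a y m) x)\<^sup>2)"
        unfolding A_def
        by (rule scaled_mean_square[OF borel_measurable_increment increment_bound increment_moments(1) elim])
      also have "\<dots> \<le> real (N m) / real (n m ?i) * D m"
        unfolding D_def by (intro mult_left_mono increment_moments) auto
      finally show ?case by simp
    qed
    then show "(\<lambda>m. expectation (\<lambda>w. (A m w)\<^sup>2)) \<longlonglongrightarrow> 0"
      using lim by (rule Lim_null_comparison)
  qed
  moreover have "(\<lambda>m. sqrt (real (N m)) * (F a (shifted_quantile a y m) - p) / f a - y) \<longlonglongrightarrow> y - y"
    by (intro tendsto_intros drift_tendsto)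
  then have "tendsto_in_probability M (\<lambda>m w. sqrt (real (N m)) * (F a (shifted_quantile a y m) - p) / f a - y) 0"
    by (intro tendsto_in_probability_deterministic) simp
  ultimately have "tendsto_in_probability M (\<lambda>m w. A m w +
      (sqrt (real (N m)) * (F a (shifted_quantile a y m) - p) / f a - y)) (0 + 0)"
    by (rule tendsto_in_probability_add[OF _ _ mA]) simp
  then show ?thesis by (simp add: A_def remainder_def[abs_def])
qed

lemma scaled_error_le_iff:
  assumes N: "0 < N m" and r: "0 < n m (fst a)"
  shows "scaled_error m w $ a \<le> y \<longleftrightarrow> linear_term m w $ a \<le> y + remainder a y m w"
proof -
  let ?i = "fst a" and ?l = "snd a" and ?s = "shifted_quantile a y m" and ?r = "real (n m (fst a))"
  define G where "G = empirical_cdf (n m ?i) (\<lambda>j. X ?i j w $ ?l) ?s"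
  have sN: "sqrt (real (N m)) > 0" using N by simp
  have fa: "f a > 0" using density by simp
  have "scaled_error m w $ a \<le> y \<longleftrightarrow> q_hat m w $ a \<le> ?s"
    using sN by (simp add: scaled_error_def shifted_quantile_def field_simps)
  also have "\<dots> \<longleftrightarrow> p \<le> G"
    unfolding G_def empirical_quantile_vector_def by (simp add: empirical_quantile_le_iff[OF r p])
  also have "\<dots> \<longleftrightarrow> sqrt (real (N m)) / f a * (F a ?s - G) \<le> sqrt (real (N m)) / f a * (F a ?s - p)"
    using sN fa by (subst mult_le_cancel_left_pos) auto
  also have "sqrt (real (N m)) / f a * (F a ?s - G) =
      linear_term m w $ a - sqrt (real (N m)) / ?r * (\<Sum>j<n m ?i. increment a ?s (X ?i j w))"
  proof -
    have "(\<Sum>j<n m ?i. influence a (X ?i j w)) - (\<Sum>j<n m ?i. increment a ?s (X ?i j w)) =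
        (\<Sum>j<n m ?i. (F a ?s - indicator {..?s} (X ?i j w $ ?l)) / f a)"
      unfolding sum_subtractf[symmetric] influence_def increment_def
      by (intro sum.cong refl) (simp add: diff_divide_distrib[symmetric])
    also have "\<dots> = ?r * ((F a ?s - G) / f a)"
      using r by (simp add: G_def empirical_cdf_def sum_subtractf right_diff_distrib diff_divide_distrib flip: sum_divide_distrib)
    finally have eq: "(\<Sum>j<n m ?i. influence a (X ?i j w)) - (\<Sum>j<n m ?i. increment a ?s (X ?i j w)) = ?r * ((F a ?s - G) / f a)" .
    have "linear_term m w $ a - sqrt (real (N m)) / ?r * (\<Sum>j<n m ?i. increment a ?s (X ?i j w)) =
        sqrt (real (N m)) / ?r * ((\<Sum>j<n m ?i. influence a (X ?i j w)) - (\<Sum>j<n m ?i. increment a ?s (X ?i j w)))"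
      by (simp add: linear_term_def right_diff_distrib)
    then show ?thesis unfolding eq using r by simp
  qed
  finally show ?thesis by (simp add: remainder_def algebra_simps diff_divide_distrib)
qed

text \<open>Bahadur's representation in its weak form, by comparison of level sets.\<close>

theorem bahadur_linearization:
  "tendsto_in_probability M (\<lambda>m w. scaled_error m w $ a - linear_term m w $ a) 0"
proof (rule difference_tendsto_0_if_same_level_sets[where R = "remainder a"])
  fix y
  show "\<forall>\<^sub>F m in sequentially. \<forall>w\<in>space M. scaled_error m w $ a \<le> y \<longleftrightarrow> linear_term m w $ a \<le> y + remainder a y m w"
    using eventually_N_pos eventually_n_pos[of "fst a"] by eventually_elim (simp add: scaled_error_le_iff)
qed (rule bounded_linear_term remainder_tendsto_0 measurable_linear_term measurable_remainder)+

lemma bounded_scaled_error: "bounded_in_probability M scaled_error"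
proof (rule bounded_in_probability_vec)
  show "(\<lambda>w. scaled_error m w $ a) \<in> borel_measurable M" for m a by (rule measurable_scaled_error)
  show "bounded_in_probability M (\<lambda>m w. scaled_error m w $ a)" for a
    by (rule bounded_in_probability_add_tendsto_0[OF bounded_linear_term bahadur_linearization])
      (rule measurable_linear_term measurable_scaled_error)+
qed

lemma q_hat_consistent: "tendsto_in_probability M q_hat q"
proof (rule tendsto_in_probability_vec)
  show "q_hat m \<in> borel_measurable M" for m by (rule borel_measurable_vec) (rule measurable_q_hat)
  fix a
  have mV: "scaled_error m \<in> borel_measurable M" for m by (rule borel_measurable_vec) (rule measurable_scaled_error)
  have "tendsto_in_probability M (\<lambda>m w. 1 / sqrt (real (N m))) 0"
    by (rule tendsto_in_probability_deterministic[OF shift_tendsto_0])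
  then have "tendsto_in_probability M (\<lambda>m w. 1 / sqrt (real (N m)) * scaled_error m w $ a) 0"
    by (rule tendsto_0_in_probability_mult_bounded[OF _ bounded_scaled_error, where k = 1])
      (use mV component_le_norm_cart in \<open>auto simp: abs_mult intro!: divide_right_mono mult_left_mono\<close>)
  then have lim: "tendsto_in_probability M (\<lambda>m w. 1 / sqrt (real (N m)) * scaled_error m w $ a + q $ a) (0 + q $ a)"
    by (rule tendsto_in_probability_add[OF _ tendsto_in_probability_deterministic[OF tendsto_const]])
      (use measurable_scaled_error in auto)
  have "\<forall>\<^sub>F m in sequentially. \<forall>w\<in>space M. 1 / sqrt (real (N m)) * scaled_error m w $ a + q $ a = q_hat m w $ a"
    using eventually_N_pos by eventually_elim (simp add: scaled_error_def)
  from tendsto_in_probability_cong[OF this lim]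
  show "tendsto_in_probability M (\<lambda>m w. q_hat m w $ a) (q $ a)" by simp
qed

section \<open>Asymptotic covariance and characteristic functions\<close>

definition \<Sigma> :: "real ^ ('k \<times> 'd) ^ ('k \<times> 'd)" where "\<Sigma> = quantile_covariance P \<kappa> p"

lemma covariance_influence:
  assumes "fst a = fst b"
  shows "\<Sigma> $ a $ b = 1 / \<kappa> (fst a) * (LINT x|P (fst a). influence a x * influence b x)"
proof -
  let ?i = "fst a" and ?l = "snd a" and ?m = "snd b"
  interpret P: prob_space "P ?i" by (rule prob_space_P)
  define I where "I c x = indicat_real {..q $ c} (x $ snd c)" for c :: "'k \<times> 'd" and x :: "real ^ 'd"
  have [measurable]: "I c \<in> borel_measurable borel" for c unfolding I_def[abs_def] by measurable
  have Ib: "\<bar>I c x\<bar> \<le> 1" for c x by (simp add: I_def indicator_def)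
  have int: "integrable (P ?i) (I c)" for c by (rule integrable_P_bounded[OF _ Ib]) measurable
  have int2: "integrable (P ?i) (\<lambda>x. I a x * I b x)"
    by (rule integrable_P_bounded[where B=1]) (auto simp: I_def indicator_def)
  have EI: "(LINT x|P ?i. I a x) = p" "(LINT x|P ?i. I b x) = p"
    unfolding I_def using integral_indicator_marginal[of a] integral_indicator_marginal[of b] F_q[of a] F_q[of b] assms by simp_all
  have "(LINT x|P ?i. p\<^sup>2 - p * I a x - p * I b x + I a x * I b x) = p\<^sup>2 - p * p - p * p + (LINT x|P ?i. I a x * I b x)"
    using int int2 by (simp add: EI P.prob_space)
  moreover have "influence a x * influence b x = (p\<^sup>2 - p * I a x - p * I b x + I a x * I b x) / (f a * f b)" for x
    by (simp add: influence_def I_def power2_eq_square algebra_simps)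
  ultimately have E: "(LINT x|P ?i. influence a x * influence b x) = ((LINT x|P ?i. I a x * I b x) - p\<^sup>2) / (f a * f b)"
    by (simp add: power2_eq_square)
  show ?thesis
  proof (cases "?l = ?m")
    case True
    then have ab: "a = b" using assms by (simp add: prod_eq_iff)
    have "(\<lambda>x. I a x * I b x) = I b" using ab by (auto simp: I_def indicator_def fun_eq_iff)
    then have "(LINT x|P ?i. I a x * I b x) = p" using EI by simp
    then show ?thesis unfolding E
      by (simp add: \<Sigma>_def quantile_covariance_def group_covariance_def ab divide_simps power2_eq_square)
  next
    case False
    have "(LINT x|P ?i. I a x * I b x) = (LINT x|P ?i. indicat_real {x \<in> space (P ?i). x $ ?l \<le> q $ a \<and> x $ ?m \<le> q $ b} x)"
      by (intro Bochner_Integration.integral_cong) (auto simp: I_def indicator_def)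
    also have "\<dots> = joint_cdf (P ?i) ?l ?m (q $ a) (q $ b)"
      by (simp add: joint_cdf_def)
    finally show ?thesis unfolding E using False
      by (simp add: \<Sigma>_def quantile_covariance_def group_covariance_def quantile_vector_def assms[symmetric] divide_simps)
  qed
qed

text \<open>The contribution of one observation of group \<open>i\<close> to the inner product of \<open>t\<close> with the
  linear term, up to the normalization of the group.\<close>

definition score :: "real ^ ('k \<times> 'd) \<Rightarrow> 'k \<Rightarrow> real ^ 'd \<Rightarrow> real" where
  "score t i x = (\<Sum>l\<in>UNIV. t $ (i, l) * influence (i, l) x)"

lemma sum_pairs: "(\<Sum>a\<in>UNIV. g (a :: 'k \<times> 'd)) = (\<Sum>i\<in>UNIV. \<Sum>l\<in>UNIV. g (i, l))"
  by (simp add: sum.cartesian_product flip: UNIV_Times_UNIV)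

lemma borel_measurable_score [measurable]: "score t i \<in> borel_measurable borel"
  unfolding score_def[abs_def] by measurable

lemma score_bound: "\<exists>B. \<forall>x. \<bar>score t i x\<bar> \<le> B"
proof -
  have "\<bar>score t i x\<bar> \<le> (\<Sum>l\<in>UNIV. \<bar>t $ (i, l)\<bar> * (1 / f (i, l)))" for x
    unfolding score_def
    by (rule order_trans[OF sum_abs]) (unfold abs_mult, intro sum_mono mult_left_mono influence_bound, simp)
  then show ?thesis by blast
qed

lemma integrable_influence: "integrable (P i) (influence a)"
  by (rule integrable_P_bounded[OF borel_measurable_influence influence_bound])

lemma integrable_influence_mult: "integrable (P i) (\<lambda>x. influence a x * influence b x)"
proof (rule integrable_P_bounded)
  show "\<bar>influence a x * influence b x\<bar> \<le> 1 / f a * (1 / f b)" for x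
    unfolding abs_mult using density[of "fst a" "snd a"] by (intro mult_mono influence_bound) auto
qed measurable

lemma score_mean: "(LINT x|P i. score t i x) = 0"
  using influence_mean[of "(i, _)"] unfolding score_def by (simp add: integrable_influence)

text \<open>The matrix is block diagonal because different groups are independent, and within a group it is
  the covariance of the influence functions divided by the limiting share of the group. In this form
  it is visibly positive semidefinite, and it is the exponent delivered by the central limit theorem.\<close>

lemma covariance_quadratic_form: "t \<bullet> (\<Sigma> *v t) = (\<Sum>i\<in>UNIV. 1 / \<kappa> i * (LINT x|P i. (score t i x)\<^sup>2))"
proof -
  have E: "(LINT x|P i. (score t i x)\<^sup>2) =
      (\<Sum>l\<in>UNIV. \<Sum>m\<in>UNIV. t $ (i, l) * t $ (i, m) * (LINT x|P i. influence (i, l) x * influence (i, m) x))" for i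
  proof -
    have "(score t i x)\<^sup>2 = (\<Sum>l\<in>UNIV. \<Sum>m\<in>UNIV. t $ (i, l) * t $ (i, m) * (influence (i, l) x * influence (i, m) x))" for x
      unfolding score_def power2_eq_square sum_product by (simp add: mult_ac)
    then show ?thesis by (simp add: integrable_influence_mult)
  qed
  have zero: "\<Sigma> $ (i, l) $ (i', m) = 0" if "i \<noteq> i'" for i i' l m
    using that by (simp add: \<Sigma>_def quantile_covariance_def)
  have "t \<bullet> (\<Sigma> *v t) = (\<Sum>i\<in>UNIV. \<Sum>l\<in>UNIV. \<Sum>i'\<in>UNIV. \<Sum>m\<in>UNIV. t $ (i, l) * (\<Sigma> $ (i, l) $ (i', m) * t $ (i', m)))"
    by (simp add: inner_vec_def matrix_vector_mult_def sum_distrib_left sum_pairs)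
  also have "\<dots> = (\<Sum>i\<in>UNIV. \<Sum>l\<in>UNIV. \<Sum>m\<in>UNIV. t $ (i, l) * (\<Sigma> $ (i, l) $ (i, m) * t $ (i, m)))"
  proof (intro sum.cong refl)
    fix i :: 'k and l :: 'd
    have "(\<Sum>i'\<in>UNIV. \<Sum>m\<in>UNIV. t $ (i, l) * (\<Sigma> $ (i, l) $ (i', m) * t $ (i', m))) =
        (\<Sum>i'\<in>UNIV. if i' = i then \<Sum>m\<in>UNIV. t $ (i, l) * (\<Sigma> $ (i, l) $ (i, m) * t $ (i, m)) else 0)"
      by (intro sum.cong refl) (auto simp: zero)
    then show "(\<Sum>i'\<in>UNIV. \<Sum>m\<in>UNIV. t $ (i, l) * (\<Sigma> $ (i, l) $ (i', m) * t $ (i', m))) =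
        (\<Sum>m\<in>UNIV. t $ (i, l) * (\<Sigma> $ (i, l) $ (i, m) * t $ (i, m)))" by simp
  qed
  also have "\<dots> = (\<Sum>i\<in>UNIV. 1 / \<kappa> i * (LINT x|P i. (score t i x)\<^sup>2))"
    unfolding E by (simp add: covariance_influence sum_distrib_left mult_ac)
  finally show ?thesis .
qed

lemma psd_covariance: "psd \<Sigma>"
proof -
  have "\<Sigma> $ b $ a = \<Sigma> $ a $ b" for a b
  proof (cases "fst a = fst b")
    case True
    then show ?thesis using covariance_influence[of a b] covariance_influence[of b a] by (simp add: mult.commute)
  next
    case False
    then show ?thesis by (simp add: \<Sigma>_def quantile_covariance_def)
  qed
  then have "transpose \<Sigma> = \<Sigma>" by (simp add: vec_eq_iff transpose_def)
  moreover have "0 \<le> t \<bullet> (\<Sigma> *v t)" for t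
    unfolding covariance_quadratic_form using \<kappa> by (intro sum_nonneg mult_nonneg_nonneg) (auto simp: less_imp_le)
  ultimately show ?thesis by (simp add: psd_def)
qed

lemma covariance_diag_pos: "0 < \<Sigma> $ a $ a"
proof -
  have "p\<^sup>2 < p" using p by (simp add: power2_eq_square)
  then show ?thesis
    using \<kappa>[of "fst a"] density[of "fst a" "snd a"]
    by (simp add: \<Sigma>_def quantile_covariance_def group_covariance_def)
qed

text \<open>By independence the characteristic function factors over all observations, and within a group all
  factors coincide.\<close>

theorem linear_term_characteristic_function:
  "(\<lambda>m. CLINT w|M. iexp (t \<bullet> linear_term m w)) \<longlonglongrightarrow> exp (- (t \<bullet> (\<Sigma> *v t)) / 2)"
proof -
  define c where "c m i = sqrt (real (N m)) / real (n m i)" for m i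
  define \<phi> where "\<phi> m i = (CLINT x|P i. iexp (c m i * score t i x))" for m i
  have lin: "t \<bullet> linear_term m w = (\<Sum>i\<in>UNIV. \<Sum>j<n m i. c m i * score t i (X i j w))" for m w
  proof -
    have "t \<bullet> linear_term m w = (\<Sum>i\<in>UNIV. \<Sum>l\<in>UNIV. \<Sum>j<n m i. c m i * (t $ (i, l) * influence (i, l) (X i j w)))"
      by (simp add: inner_vec_def sum_pairs linear_term_def c_def sum_distrib_left mult_ac)
    also have "\<dots> = (\<Sum>i\<in>UNIV. \<Sum>j<n m i. \<Sum>l\<in>UNIV. c m i * (t $ (i, l) * influence (i, l) (X i j w)))"
      by (intro sum.cong refl sum.swap)
    finally show ?thesis by (simp add: score_def sum_distrib_left)
  qed
  have "(CLINT w|M. iexp (t \<bullet> linear_term m w)) = (\<Prod>i\<in>UNIV. \<phi> m i ^ n m i)" for m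
  proof -
    define J where "J = Sigma UNIV (\<lambda>i. {..<n m i})"
    define Y where "Y a x = iexp (c m (fst a) * score t (fst a) x)" for a :: "'k \<times> nat" and x
    have Ym: "Y a \<in> borel_measurable borel" for a unfolding Y_def by measurable
    have Ym': "(\<lambda>w. Y a ((case a of (i, j) \<Rightarrow> X i j) w)) \<in> borel_measurable M" for a
      by (rule measurable_compose[OF _ Ym]) (cases a, simp)
    have fin: "finite J" by (simp add: J_def)
    have ind: "indep_vars (\<lambda>_. borel) (\<lambda>a w. Y a ((case a of (i, j) \<Rightarrow> X i j) w)) J"
      by (rule indep_vars_compose2[OF indep_vars_subset[OF indep subset_UNIV]]) (rule Ym)
    have int: "integrable M (\<lambda>w. Y a ((case a of (i, j) \<Rightarrow> X i j) w))" for a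
      by (rule integrable_const_bound[where B=1]) (use Ym' in \<open>auto simp: Y_def\<close>)
    have "iexp (t \<bullet> linear_term m w) = (\<Prod>a\<in>J. Y a ((case a of (i, j) \<Rightarrow> X i j) w))" for w
      unfolding lin J_def Y_def
      by (simp add: exp_sum sum_distrib_left prod.Sigma case_prod_beta)
    then have "(CLINT w|M. iexp (t \<bullet> linear_term m w)) = (CLINT w|M. \<Prod>a\<in>J. Y a ((case a of (i, j) \<Rightarrow> X i j) w))"
      by simp
    also have "\<dots> = (\<Prod>a\<in>J. CLINT w|M. Y a ((case a of (i, j) \<Rightarrow> X i j) w))"
      by (rule indep_vars_lebesgue_integral[OF fin ind int])
    also have "\<dots> = (\<Prod>a\<in>J. \<phi> m (fst a))"
    proof (rule prod.cong[OF refl])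
      fix a :: "'k \<times> nat"
      have "(CLINT w|M. Y a (X (fst a) (snd a) w)) = (CLINT x|P (fst a). Y a x)"
        by (rule integral_X[OF Ym])
      then show "(CLINT w|M. Y a ((case a of (i, j) \<Rightarrow> X i j) w)) = \<phi> m (fst a)"
        by (simp add: \<phi>_def Y_def case_prod_beta)
    qed
    also have "\<dots> = (\<Prod>i\<in>UNIV. \<Prod>j<n m i. \<phi> m i)"
      unfolding J_def by (subst prod.Sigma) (auto simp: case_prod_beta)
    finally show ?thesis by simp
  qed
  moreover have "(\<lambda>m. \<Prod>i\<in>UNIV. \<phi> m i ^ n m i) \<longlonglongrightarrow>
      (\<Prod>i\<in>UNIV. complex_of_real (exp (- (1 / \<kappa> i * (LINT x|P i. (score t i x)\<^sup>2) / 2))))"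
  proof (rule tendsto_prod)
    fix i
    obtain B where B: "\<And>x. \<bar>score t i x\<bar> \<le> B" using score_bound by blast
    have "(\<lambda>m. real (n m i) * (c m i)\<^sup>2) \<longlonglongrightarrow> 1 / \<kappa> i"
    proof -
      have "real (n m i) * (c m i)\<^sup>2 = real (N m) / real (n m i)" for m
        by (simp add: c_def power_divide) (simp add: power2_eq_square)
      then show ?thesis using N_over_n[of i] by simp
    qed
    then show "(\<lambda>m. \<phi> m i ^ n m i) \<longlonglongrightarrow>
        complex_of_real (exp (- (1 / \<kappa> i * (LINT x|P i. (score t i x)\<^sup>2) / 2)))"
      unfolding \<phi>_def
      by (intro iid_char_power_tendsto[OF prob_space_P _ B score_mean refl n_at_top]) measurable
  qed
  moreover have "(\<Prod>i\<in>UNIV. complex_of_real (exp (- (1 / \<kappa> i * (LINT x|P i. (score t i x)\<^sup>2) / 2)))) =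
      exp (- (t \<bullet> (\<Sigma> *v t)) / 2)"
    unfolding covariance_quadratic_form
    by (simp add: exp_sum[symmetric] sum_negf sum_divide_distrib flip: of_real_prod)
  ultimately show ?thesis by simp
qed

theorem scaled_error_characteristic_function:
  "(\<lambda>m. CLINT w|M. iexp (t \<bullet> scaled_error m w)) \<longlonglongrightarrow> exp (- (t \<bullet> (\<Sigma> *v t)) / 2)"
proof (rule slutsky_characteristic_function[OF _ _ _ linear_term_characteristic_function])
  show "(\<lambda>w. t \<bullet> linear_term m w) \<in> borel_measurable M" "(\<lambda>w. t \<bullet> scaled_error m w) \<in> borel_measurable M" for m
    using measurable_linear_term measurable_scaled_error by (simp_all add: inner_vec_def)
  have "tendsto_in_probability M (\<lambda>m w. - t $ a * (scaled_error m w $ a - linear_term m w $ a)) (- t $ a * 0)" for a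
    using measurable_linear_term measurable_scaled_error
    by (intro tendsto_in_probability_isCont[OF bahadur_linearization, of "\<lambda>x. - t $ a * x"]) (auto intro!: continuous_intros)
  then have "tendsto_in_probability M (\<lambda>m w. \<Sum>a\<in>UNIV. - t $ a * (scaled_error m w $ a - linear_term m w $ a))
      (\<Sum>a\<in>(UNIV :: ('k \<times> 'd) set). 0)"
    using measurable_linear_term measurable_scaled_error by (intro tendsto_in_probability_sum) auto
  moreover have "(\<Sum>a\<in>UNIV. - t $ a * (scaled_error m w $ a - linear_term m w $ a)) =
      t \<bullet> linear_term m w - t \<bullet> scaled_error m w" for m w
    by (simp add: inner_vec_def sum_subtractf[symmetric] algebra_simps)
  ultimately show "tendsto_in_probability M (\<lambda>m w. t \<bullet> linear_term m w - t \<bullet> scaled_error m w) 0"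
    by simp
qed

end

section \<open>The quantile statistic\<close>

lemma tendsto_matrix_vector_mult [tendsto_intros]:
  fixes f :: "'a \<Rightarrow> real ^ 'n ^ 'm" and g :: "'a \<Rightarrow> real ^ 'n"
  assumes "(f \<longlongrightarrow> A) F" "(g \<longlongrightarrow> x) F"
  shows "((\<lambda>z. f z *v g z) \<longlongrightarrow> A *v x) F"
  unfolding matrix_vector_mult_def
  by (intro vec_tendstoI) (simp, intro tendsto_intros assms)

lemma abs_quadratic_form_le:
  fixes C :: "real ^ 'n ^ 'n"
  shows "\<bar>x \<bullet> (C *v x)\<bar> \<le> (\<Sum>a\<in>UNIV. \<Sum>b\<in>UNIV. \<bar>C $ a $ b\<bar>) * (norm x)\<^sup>2"
proof -
  have "x \<bullet> (C *v x) = (\<Sum>a\<in>UNIV. \<Sum>b\<in>UNIV. x $ a * (C $ a $ b * x $ b))"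
    by (simp add: inner_vec_def matrix_vector_mult_def sum_distrib_left)
  also have "\<bar>\<dots>\<bar> \<le> (\<Sum>a\<in>UNIV. \<Sum>b\<in>UNIV. \<bar>x $ a * (C $ a $ b * x $ b)\<bar>)"
    by (intro order_trans[OF sum_abs] sum_mono sum_abs)
  also have "\<dots> \<le> (\<Sum>a\<in>UNIV. \<Sum>b\<in>UNIV. \<bar>C $ a $ b\<bar> * (norm x)\<^sup>2)"
  proof (intro sum_mono)
    fix a b
    have "\<bar>x $ a\<bar> * \<bar>x $ b\<bar> \<le> norm x * norm x"
      by (intro mult_mono component_le_norm_cart) auto
    then have "\<bar>C $ a $ b\<bar> * (\<bar>x $ a\<bar> * \<bar>x $ b\<bar>) \<le> \<bar>C $ a $ b\<bar> * (norm x * norm x)"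
      by (intro mult_left_mono) auto
    then show "\<bar>x $ a * (C $ a $ b * x $ b)\<bar> \<le> \<bar>C $ a $ b\<bar> * (norm x)\<^sup>2"
      by (simp add: abs_mult power2_eq_square mult_ac)
  qed
  also have "\<dots> = (\<Sum>a\<in>UNIV. \<Sum>b\<in>UNIV. \<bar>C $ a $ b\<bar>) * (norm x)\<^sup>2"
    by (simp add: sum_distrib_right)
  finally show ?thesis .
qed

lemma (in prob_space) tendsto_infinity_in_probability_mult:
  fixes c :: real and Z :: "nat \<Rightarrow> 'a \<Rightarrow> real"
  assumes Z: "tendsto_in_probability M Z c" and c: "0 < c" and N: "filterlim N at_top sequentially"
    and m: "\<And>m. Z m \<in> borel_measurable M"
  shows "tendsto_infinity_in_probability M (\<lambda>m w. N m * Z m w)"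
  unfolding tendsto_infinity_in_probability_def
proof
  fix K :: real
  have Nm: "\<forall>\<^sub>F m in sequentially. max 1 (2 * (\<bar>K\<bar> + 1) / c) \<le> N m"
    using N unfolding filterlim_at_top by blast
  have "(\<lambda>m. prob {w \<in> space M. dist (Z m w) c > c / 2}) \<longlonglongrightarrow> 0"
    using Z half_gt_zero[OF c] unfolding tendsto_in_probability_def by blast
  then have "(\<lambda>m. 1 - prob {w \<in> space M. dist (Z m w) c > c / 2}) \<longlonglongrightarrow> 1 - 0"
    by (intro tendsto_intros)
  then have lim: "(\<lambda>m. 1 - prob {w \<in> space M. dist (Z m w) c > c / 2}) \<longlonglongrightarrow> 1" by simp
  from Nm have "\<forall>\<^sub>F m in sequentially. 1 - prob {w \<in> space M. dist (Z m w) c > c / 2}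
      \<le> prob {w \<in> space M. N m * Z m w > K}"
  proof eventually_elim
    case (elim m)
    have meas: "{w \<in> space M. dist (Z m w) c > c / 2} \<in> events" "{w \<in> space M. N m * Z m w > K} \<in> events"
      using m[of m] by measurable
    have "space M - {w \<in> space M. dist (Z m w) c > c / 2} \<subseteq> {w \<in> space M. N m * Z m w > K}"
    proof
      fix w assume w: "w \<in> space M - {w \<in> space M. dist (Z m w) c > c / 2}"
      then have "\<not> c / 2 < \<bar>Z m w - c\<bar>" by (simp add: dist_real_def)
      then have "c / 2 \<le> Z m w" by linarith
      then have "2 * (\<bar>K\<bar> + 1) / c * (c / 2) \<le> N m * Z m w"
        using elim c by (intro mult_mono) auto
      then have "\<bar>K\<bar> + 1 \<le> N m * Z m w" using c by simp
      then show "w \<in> {w \<in> space M. N m * Z m w > K}" using w by auto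
    qed
    then have "prob (space M - {w \<in> space M. dist (Z m w) c > c / 2}) \<le> prob {w \<in> space M. N m * Z m w > K}"
      using meas(2) by (intro finite_measure_mono)
    then show ?case using prob_compl[OF meas(1)] by simp
  qed
  then show "(\<lambda>m. prob {w \<in> space M. N m * Z m w > K}) \<longlonglongrightarrow> 1"
    by (rule tendsto_sandwich[OF _ always_eventually lim tendsto_const]) (simp add: prob_le_1)
qed

context quantile_sample
begin

context
  fixes T :: "real ^ ('k \<times> 'd) ^ ('k \<times> 'd)"
    and E :: scaling
    and S :: "nat \<Rightarrow> 'w \<Rightarrow> real ^ ('k \<times> 'd) ^ ('k \<times> 'd)"
  assumes sym: "transpose T = T" and idem: "T ** T = T"
    and measurable_S: "\<And>m. S m \<in> borel_measurable M"
    and S_consistent: "tendsto_in_probability M S \<Sigma>"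
    and trace: "E = ATS \<Longrightarrow> trace (T ** \<Sigma> ** T) \<noteq> 0"
begin

abbreviation stat :: "nat \<Rightarrow> 'w \<Rightarrow> real" where
  "stat m w \<equiv> quantile_statistic E T (N m) (q_hat m w) (S m w)"

definition form :: "real ^ ('k \<times> 'd) ^ ('k \<times> 'd) \<Rightarrow> real ^ ('k \<times> 'd) \<Rightarrow> real" where
  "form B v = (T *v v) \<bullet> (B *v (T *v v))"

lemma tendsto_form:
  assumes "(g \<longlongrightarrow> B) G" "(h \<longlongrightarrow> v) G"
  shows "((\<lambda>z. form (g z) (h z)) \<longlongrightarrow> form B v) G"
  unfolding form_def by (intro tendsto_intros assms)

lemma measurable_form:
  assumes "g \<in> borel_measurable M" "h \<in> borel_measurable M"
  shows "(\<lambda>w. form (g w) (h w)) \<in> borel_measurable M"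
proof -
  have "(\<lambda>z. form (fst z) (snd z)) \<in> borel_measurable borel"
    by (intro borel_measurable_isCont) (simp only: isCont_def, intro tendsto_form tendsto_intros)
  from measurable_compose[OF borel_measurable_Pair[OF assms] this] show ?thesis by simp
qed

lemma measurable_scaling: "(\<lambda>w. scaling_matrix E T (S m w)) \<in> borel_measurable M"
  by (rule measurable_compose[OF measurable_S borel_measurable_scaling_matrix[OF sym]])

lemma isCont_scaling: "isCont (scaling_matrix E T) \<Sigma>"
  by (rule isCont_scaling_matrix[OF sym idem covariance_diag_pos trace])

lemma borel_measurable_q_hat: "q_hat m \<in> borel_measurable M"
  by (rule borel_measurable_vec) (rule measurable_q_hat)

lemma borel_measurable_scaled_error: "scaled_error m \<in> borel_measurable M"
  by (rule borel_measurable_vec) (rule measurable_scaled_error)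

lemma stat_eq: "stat m w = real (N m) * form (scaling_matrix E T (S m w)) (q_hat m w)"
  by (simp add: quantile_statistic_def form_def)

lemma measurable_stat: "stat m \<in> borel_measurable M"
  unfolding stat_eq using measurable_form[OF measurable_scaling borel_measurable_q_hat] by simp

text \<open>The statistic is the sample size times a quantity that converges in probability to a positive
  constant.\<close>

theorem stat_tendsto_infinity:
  assumes "T *v q \<noteq> 0"
  shows "tendsto_infinity_in_probability M stat"
  unfolding stat_eq
proof (rule tendsto_infinity_in_probability_mult)
  have "isCont (\<lambda>z. form (scaling_matrix E T (fst z)) (snd z)) (\<Sigma>, q)"
    unfolding isCont_def
  proof (rule tendsto_form)
    have "isCont (\<lambda>z. scaling_matrix E T (fst z)) (\<Sigma>, q)"
      by (rule isCont_o2[where f = fst and g = "scaling_matrix E T"]) (simp_all add: isCont_scaling isCont_fst)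
    then show "(\<lambda>z. scaling_matrix E T (fst z)) \<midarrow>(\<Sigma>, q)\<rightarrow> scaling_matrix E T (fst (\<Sigma>, q))"
      by (simp add: isCont_def)
  qed (intro tendsto_intros)
  from tendsto_in_probability_isCont[OF
      tendsto_in_probability_Pair[OF S_consistent q_hat_consistent measurable_S borel_measurable_q_hat] this]
  show "tendsto_in_probability M (\<lambda>m w. form (scaling_matrix E T (S m w)) (q_hat m w)) (form (scaling_matrix E T \<Sigma>) q)"
    using measurable_S borel_measurable_q_hat by simp
  show "0 < form (scaling_matrix E T \<Sigma>) q"
    unfolding form_def
    by (rule scaling_matrix_psd(2)[OF sym idem psd_covariance covariance_diag_pos trace assms])
  show "filterlim (\<lambda>m. real (N m)) at_top sequentially" by (rule real_N_at_top)
  show "(\<lambda>w. form (scaling_matrix E T (S m w)) (q_hat m w)) \<in> borel_measurable M" for m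
    by (rule measurable_form[OF measurable_scaling borel_measurable_q_hat])
qed

text \<open>As \<open>T *v q = 0\<close>, the statistic is a quadratic form in the scaled errors. Replacing the estimated
  scaling matrix by its limit costs a term that is negligible since the scaled errors are tight; the
  remaining form has a fixed matrix and a known normal form.\<close>

theorem stat_weak_conv:
  assumes Tq: "T *v q = 0"
  shows "\<exists>lam. (\<forall>a. 0 \<le> lam a) \<and> eigenvalues_of (scaling_matrix E T \<Sigma> ** T ** \<Sigma> ** T) lam \<and>
    weak_conv_m (\<lambda>m. distr M borel (stat m)) (weighted_chi_square lam)"
proof -
  define C where "C = scaling_matrix E T \<Sigma>"
  have "psd C" unfolding C_def
    by (rule scaling_matrix_psd(1)[OF sym idem psd_covariance covariance_diag_pos trace])
  then obtain L lam where lam: "\<And>a. 0 \<le> lam a" "eigenvalues_of (C ** T ** \<Sigma> ** T) lam"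
      and L: "transpose L ** L = T ** C ** T" "L ** \<Sigma> ** transpose L = diag_mat lam"
    using quadratic_form_normal_form[OF sym _ psd_covariance] by metis
  have norm_L: "(norm (L *v v))\<^sup>2 = form C v" for v
  proof -
    have "(norm (L *v v))\<^sup>2 = v \<bullet> ((transpose L ** L) *v v)"
      unfolding power2_norm_eq_inner matrix_vector_mul_assoc[symmetric]
      by (metis dot_lmul_matrix inner_commute transpose_matrix_vector)
    also have "\<dots> = form C v"
      unfolding L(1) form_def using quadratic_form_conjugate[of v T C] sym by simp
    finally show ?thesis .
  qed
  have stat_scaled: "stat m w = form (scaling_matrix E T (S m w)) (scaled_error m w)" for m w
  proof -
    have "T *v scaled_error m w = sqrt (real (N m)) *\<^sub>R (T *v q_hat m w)"
      by (simp add: scaled_error_def matrix_vector_mult_scaleR matrix_vector_mult_diff_distrib Tq)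
    then show ?thesis by (simp add: stat_eq form_def matrix_vector_mult_scaleR)
  qed
  have "tendsto_in_probability M (\<lambda>m w. (norm (L *v scaled_error m w))\<^sup>2 - stat m w) 0"
  proof -
    obtain K where K: "0 < K" "\<And>x. norm (T *v x) \<le> norm x * K"
      using bounded_linear.pos_bounded[OF matrix_vector_mul_bounded_linear[of T]] by blast
    define g where "g B = (\<Sum>a\<in>UNIV. \<Sum>b\<in>UNIV. \<bar>(C - scaling_matrix E T B) $ a $ b\<bar>) * K\<^sup>2" for B
    have "isCont g \<Sigma>"
      using isCont_scaling unfolding g_def isCont_def by (intro tendsto_intros)
    then have "tendsto_in_probability M (\<lambda>m w. g (S m w)) (g \<Sigma>)"
      by (rule tendsto_in_probability_isCont[OF S_consistent _ measurable_S])
    moreover have "g \<Sigma> = 0" by (simp add: g_def C_def)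
    ultimately have g0: "tendsto_in_probability M (\<lambda>m w. g (S m w)) 0" by simp
    have mg: "(\<lambda>w. g (S m w)) \<in> borel_measurable M" for m
    proof -
      have "(\<lambda>w. scaling_matrix E T (S m w) $ a $ b) \<in> borel_measurable M" for a b
        by (rule measurable_compose[OF measurable_scaling]) (intro borel_measurable_continuous_onI continuous_intros)
      then show ?thesis unfolding g_def by simp
    qed
    have bound: "\<bar>(norm (L *v scaled_error m w))\<^sup>2 - stat m w\<bar> \<le> \<bar>g (S m w)\<bar> * norm (scaled_error m w) ^ 2" for m w
    proof -
      define x where "x = T *v scaled_error m w"
      define s where "s = (\<Sum>a\<in>UNIV. \<Sum>b\<in>UNIV. \<bar>(C - scaling_matrix E T (S m w)) $ a $ b\<bar>)"
      have s: "0 \<le> s" unfolding s_def by (intro sum_nonneg) auto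
      have "(norm (L *v scaled_error m w))\<^sup>2 - stat m w = x \<bullet> ((C - scaling_matrix E T (S m w)) *v x)"
        unfolding norm_L stat_scaled form_def x_def by (simp add: matrix_vector_mult_diff_rdistrib inner_diff_right)
      also have "\<bar>\<dots>\<bar> \<le> s * (norm x)\<^sup>2" unfolding s_def by (rule abs_quadratic_form_le)
      also have "\<dots> \<le> s * (norm (scaled_error m w) * K)\<^sup>2"
        unfolding x_def by (intro mult_left_mono power_mono K s) auto
      also have "\<dots> = \<bar>g (S m w)\<bar> * norm (scaled_error m w) ^ 2"
      proof -
        have "g (S m w) = s * K\<^sup>2" by (simp only: g_def s_def)
        then show ?thesis using s by (simp add: power_mult_distrib abs_mult)
      qed
      finally show ?thesis .
    qed
    show ?thesis
      by (rule tendsto_0_in_probability_mult_bounded[OF g0 bounded_scaled_error bound mg borel_measurable_scaled_error])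
  qed
  moreover have "weak_conv_m (\<lambda>m. distr M borel (\<lambda>w. (norm (L *v scaled_error m w))\<^sup>2)) (weighted_chi_square lam)"
    by (rule quadratic_form_weak_conv[OF borel_measurable_scaled_error scaled_error_characteristic_function L(2) lam(1)])
  moreover have "(\<lambda>w. (norm (L *v scaled_error m w))\<^sup>2) \<in> borel_measurable M" for m
    unfolding norm_L using borel_measurable_scaled_error by (intro measurable_form) auto
  ultimately have "weak_conv_m (\<lambda>m. distr M borel (stat m)) (weighted_chi_square lam)"
    by (intro slutsky_weak_conv[OF _ _ measurable_stat real_distribution_weighted_chi_square])
  then show ?thesis using lam by (auto simp: C_def)
qed

end

end

theorem theorem4:
  fixes M :: "'w measure"
    and P :: "'k::finite \<Rightarrow> (real ^ 'd::finite) measure"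
    and X :: "'k \<Rightarrow> nat \<Rightarrow> 'w \<Rightarrow> real ^ 'd"
    and n :: "nat \<Rightarrow> 'k \<Rightarrow> nat"
    and \<kappa> :: "'k \<Rightarrow> real"
    and p :: real
    and H :: "real ^ ('k \<times> 'd) ^ 'r::finite"
    and S :: "nat \<Rightarrow> 'w \<Rightarrow> real ^ ('k \<times> 'd) ^ ('k \<times> 'd)"
    and E :: scaling
    and N :: "nat \<Rightarrow> nat"
    and q :: "real ^ ('k \<times> 'd)"
    and T \<Sigma> :: "real ^ ('k \<times> 'd) ^ ('k \<times> 'd)"
    and Stat :: "nat \<Rightarrow> 'w \<Rightarrow> real"
  defines "N \<equiv> \<lambda>m. \<Sum>i\<in>UNIV. n m i"
    and "q \<equiv> quantile_vector P p"
    and "T \<equiv> projection_matrix H"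
    and "\<Sigma> \<equiv> quantile_covariance P \<kappa> p"
    and "Stat \<equiv> \<lambda>m w. quantile_statistic E T (N m)
                 (empirical_quantile_vector (n m) (\<lambda>i j. X i j w) p) (S m w)"
  assumes "prob_space M"
    and "0 < p" and "p < 1"
    and "prob_space.indep_vars M (\<lambda>_. borel) (\<lambda>(i, j). X i j) UNIV"
    and "\<And>i j. distr M borel (X i j) = P i"
    and "contrast_matrix H"
    and "filterlim N at_top sequentially"
    and "\<And>i. (\<lambda>m. real (n m i) / real (N m)) \<longlonglongrightarrow> \<kappa> i" and "\<And>i. \<kappa> i > 0"
    and "\<And>i l. continuously_differentiable_at (marginal_cdf (P i) l) (q $ (i, l))"
    and "\<And>i l. deriv (marginal_cdf (P i) l) (q $ (i, l)) > 0"
    and "\<And>m. S m \<in> borel_measurable M"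
    and "tendsto_in_probability M S \<Sigma>"
    and "E = ATS \<Longrightarrow> trace (T ** \<Sigma> ** T) \<noteq> 0"
  shows "(T *v q = 0 \<longrightarrow>
           (\<exists>lam. (\<forall>a. lam a \<ge> 0) \<and>
                 eigenvalues_of (scaling_matrix E T \<Sigma> ** T ** \<Sigma> ** T) lam \<and>
                 weak_conv_m (\<lambda>m. distr M borel (Stat m)) (weighted_chi_square lam)))
       \<and> (T *v q \<noteq> 0 \<longrightarrow> tendsto_infinity_in_probability M Stat)"
proof -
  have derivative: "(marginal_cdf (P i) l has_real_derivative density_at_quantile (P i) p l)
      (at (quantile (marginal_cdf (P i) l) p))" for i l
  proof -
    have "marginal_cdf (P i) l field_differentiable (at (q $ (i, l)))"
      using assms(15)[of i l] eventually_nhds_x_imp_x unfolding continuously_differentiable_at_def by blast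
    then show ?thesis
      by (simp add: DERIV_deriv_iff_field_differentiable density_at_quantile_def q_def quantile_vector_def)
  qed
  have density: "density_at_quantile (P i) p l > 0" for i l
    using assms(16)[of i l] by (simp add: density_at_quantile_def q_def quantile_vector_def)
  interpret Q: quantile_sample M P X n \<kappa> p
    using assms(6-10,12-14) derivative density
    unfolding quantile_sample_def quantile_sample_axioms_def N_def by blast
  have T: "transpose T = T" "T ** T = T"
    unfolding T_def by (rule projection_matrix_symmetric projection_matrix_idempotent)+
  have N: "Q.N = N" by (simp add: fun_eq_iff N_def Q.N_def)
  have \<Sigma>: "Q.\<Sigma> = \<Sigma>" by (simp add: \<Sigma>_def Q.\<Sigma>_def)
  show ?thesis
    using Q.stat_weak_conv[OF T, of S E] Q.stat_tendsto_infinity[OF T, of S E] assms(17-19)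
    unfolding Stat_def q_def N \<Sigma> by blast
qed

end
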